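(* Let $V=\bigoplus_{t\in\mathbb{F}_{13}}V_t$ be the $78$-dimensional real vector space, and let $G=\langle a,b,c,d,e\rangle$ be the group of real-linear automorphisms of $V$, defined in the context. Let $[\cdot,\cdot]$ be the unique $G$-invariant real-bilinear product on $V$ with $$[(1,0,0)_0,(1,0,0)_1]=(\overline{\omega},1,1)_3-(1,\overline{\omega},\overline{\omega})_9.$$ Then $V$ with this product is the compact real form of the simple Lie algebra of type $E_6$; that is, $(V,[\cdot,\cdot])$ is a simple real Lie algebra whose complexification is the complex simple Lie algebra of type $E_6$ and whose Killing form is negative definite.
   Context: Let $\omega=e^{2\pi i/3}$, $\overline{\omega}=\omega^2$, $\theta=\omega-\overline{\omega}=\sqrt{-3}$. For each $t\in\mathbb{F}_{13}=\{0,1,\dots,12\}$ let $V_t$ be a copy of $\mathbb{C}^3$, regarded as a $6$-dimensional real vector space; for $v\in\mathbb{C}^3$ write $v_t$ for the corresponding vector of $V_t$. Let $V=\bigoplus_{t}V_t$ (real dimension $78$). Vectors of $\mathbb{C}^3$ are row vectors; a matrix acts on them by right multiplication, and $v_tM$ means $(vM)_t$. Complex scalars are only notation: all maps and products are real-(bi)linear. Group elements act on the right (products $gh$ mean first $g$, then $h$). Define real-linear automorphisms of $V$ as follows (subscripts mod $13$). $a$: $v_t\mapsto v_{t+1}$. $b$: $(x,y,z)_t\mapsto(\omega x,\overline{\omega}y,\overline{\omega}z)_{3t}$. $c$: with $$M_1=\tfrac{\theta}{3}\begin{pmatrix}\omega&1&1\\1&\omega&1\\1&1&\omega\end{pmatrix},\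 M_2=\tfrac{\theta}{3}\begin{pmatrix}1&1&1\\1&\overline{\omega}&\omega\\1&\omega&\overline{\omega}\end{pmatrix},\ M_3=\tfrac{\theta}{3}\begin{pmatrix}\omega&\omega&\omega\\\overline{\omega}&\omega&1\\\overline{\omega}&1&\omega\end{pmatrix},\ M_4=\tfrac{\theta}{3}\begin{pmatrix}1&\omega&\omega\\\overline{\omega}&\overline{\omega}&\omega\\\overline{\omega}&\omega&\overline{\omega}\end{pmatrix},$$ $c$ maps $(x,y,z)_0\mapsto-(\overline{x},\overline{z},\overline{y})_0$; $(x,y,z)_1\mapsto-(x,z,y)_1$; $(x,y,z)_3\mapsto-(\omega x,\overline{\omega}z,\overline{\omega}y)_9$; $(x,y,z)_9\mapsto-(\overline{\omega}x,\omega z,\omega y)_3$; $(x,y,z)_4\mapsto(\overline{x},\overline{y},\overline{z})_{10}$; $(x,y,z)_{10}\mapsto(\overline{x},\overline{y},\overline{z})_4$; $(x,y,z)_{12}\mapsto(\overline{x},\overline{y},\overline{z})_{12}$; $(x,y,z)_2\mapsto(\overline{x},\overline{y},\overline{z})_2M_1$; $(x,y,z)_8\mapsto(\overline{x},\overline{y},\overline{z})_8M_2$; $(x,y,z)_5\mapsto(\overline{x},\overline{y},\overline{z})_6M_3$; $(x,y,z)_6\mapsto(\overline{x},\overline{y},\overline{z})_5M_3^{\top}$; $(x,y,z)_7\mapsto(\overline{x},\overline{y},\overline{z})_{11}M_4$; $(x,y,z)_{11}\mapsto(\overline{x},\overline{y},\overline{z})_7M_4^{\top}$. $d$: $v_t\mapsto\delta_tv_t$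 where $(\delta_0,\dots,\delta_{12})=(1,\omega,1,\omega,\omega,\omega,\overline{\omega},\overline{\omega},1,\omega,\overline{\omega},\omega,1)$. $e$: $(x,y,z)_0\mapsto(x,y,z)_0$; $(x,y,z)_t\mapsto(z,x,y)_t$ for $t=1,11$; $(x,y,z)_2\mapsto(\overline{\omega}y,z,\omega x)_2$; $(x,y,z)_t\mapsto(\overline{\omega}z,\omega x,y)_t$ for $t=3,7$; $(x,y,z)_t\mapsto(x,\omega y,\overline{\omega}z)_t$ for $t=4,10,12$; $(x,y,z)_5\mapsto(y,z,x)_5$; $(x,y,z)_6\mapsto(\omega y,z,\overline{\omega}x)_6$; $(x,y,z)_t\mapsto(\omega z,\overline{\omega}x,y)_t$ for $t=8,9$. Put $G=\langle a,b,c,d,e\rangle$. A bilinear product on $V$ is $G$-invariant if $[u^g,v^g]=[u,v]^g$ for all $u,v\in V$, $g\in G$. It is known that there is exactly one $G$-invariant real-bilinear product on $V$ with the value given in the claim. *)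

theory Defs
  imports
    "HOL-Analysis.Analysis"
    "HOL-Algebra.Bij"
    "HOL-Algebra.Generated_Groups"
begin

locale lie_algebra = vector_space scale
  for scale :: "'k::field \<Rightarrow> 'v::ab_group_add \<Rightarrow> 'v" +
  fixes bracket :: "'v \<Rightarrow> 'v \<Rightarrow> 'v"
  assumes bracket_linear_right: "Vector_Spaces.linear scale scale (\<lambda>y. bracket x y)"
    and bracket_linear_left: "Vector_Spaces.linear scale scale (\<lambda>x. bracket x y)"
    and bracket_self: "bracket x x = 0"
    and jacobi: "bracket x (bracket y z) + bracket y (bracket z x) + bracket z (bracket x y) = 0"
begin

definition lie_ideal :: "'v set \<Rightarrow> bool" where
  "lie_ideal I \<longleftrightarrow> subspace I \<and> (\<forall>x. \<forall>y\<in>I. bracket x y \<in> I)"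

definition lie_subalgebra :: "'v set \<Rightarrow> bool" where
  "lie_subalgebra H \<longleftrightarrow> subspace H \<and> (\<forall>x\<in>H. \<forall>y\<in>H. bracket x y \<in> H)"

definition bracket_span :: "'v set \<Rightarrow> 'v set \<Rightarrow> 'v set" where
  "bracket_span X Y = span {bracket x y | x y. x \<in> X \<and> y \<in> Y}"

primrec lower_central :: "'v set \<Rightarrow> nat \<Rightarrow> 'v set" where
  "lower_central H 0 = H"
| "lower_central H (Suc n) = bracket_span H (lower_central H n)"

definition normalizer :: "'v set \<Rightarrow> 'v set" where
  "normalizer H = {x. \<forall>y\<in>H. bracket x y \<in> H}"

definition cartan_subalgebra :: "'v set \<Rightarrow> bool" where
  "cartan_subalgebra H \<longleftrightarrow>
     lie_subalgebra H \<and> (\<exists>n. lower_central H n = {0}) \<and> normalizer H = H"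

text \<open>A linear form on the subspace \<open>H\<close> is represented by its extension by zero to the whole type,
  so that equality of forms is equality of functions.\<close>

definition dual_space :: "'v set \<Rightarrow> ('v \<Rightarrow> 'k) set" where
  "dual_space H = {\<alpha>. (\<forall>x. x \<notin> H \<longrightarrow> \<alpha> x = 0) \<and>
     (\<forall>x\<in>H. \<forall>y\<in>H. \<alpha> (x + y) = \<alpha> x + \<alpha> y) \<and> (\<forall>k. \<forall>x\<in>H. \<alpha> (scale k x) = k * \<alpha> x)}"

text \<open>Genuine (not generalized) eigenspaces: the notions below are used for semisimple algebras over
  the complex numbers only, where a Cartan subalgebra acts diagonalizably.\<close>

definition root_space :: "'v set \<Rightarrow> ('v \<Rightarrow> 'k) \<Rightarrow> 'v set" where
  "root_space H \<alpha> = {x. \<forall>h\<in>H. bracket h x = scale (\<alpha> h) x}"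

definition roots :: "'v set \<Rightarrow> ('v \<Rightarrow> 'k) set" where
  "roots H = {\<alpha> \<in> dual_space H. \<alpha> \<noteq> (\<lambda>_. 0) \<and> root_space H \<alpha> \<noteq> {0}}"

definition root_base :: "'v set \<Rightarrow> 'i set \<Rightarrow> ('i \<Rightarrow> 'v \<Rightarrow> 'k) \<Rightarrow> bool" where
  "root_base H I \<alpha> \<longleftrightarrow>
     finite I \<and> (\<forall>i\<in>I. \<alpha> i \<in> roots H) \<and>
     (\<forall>c. (\<forall>h\<in>H. (\<Sum>i\<in>I. c i * \<alpha> i h) = 0) \<longrightarrow> (\<forall>i\<in>I. c i = 0)) \<and>
     (\<forall>\<beta>\<in>roots H. \<exists>n :: 'i \<Rightarrow> nat.
        \<beta> = (\<lambda>h. \<Sum>i\<in>I. of_nat (n i) * \<alpha> i h) \<or>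
        \<beta> = (\<lambda>h. - (\<Sum>i\<in>I. of_nat (n i) * \<alpha> i h)))"

text \<open>In a complex semisimple algebra \<open>[L\<^sub>\<alpha>, L\<^sub>-\<^sub>\<alpha>]\<close> is a line in \<open>H\<close> on which \<open>\<alpha>\<close> does not vanish, so each
  root has exactly one coroot, and the Cartan integer of \<open>\<beta>\<close> against \<open>\<alpha>\<close> is the value of \<open>\<beta>\<close> there.\<close>

definition is_coroot :: "'v set \<Rightarrow> ('v \<Rightarrow> 'k) \<Rightarrow> 'v \<Rightarrow> bool" where
  "is_coroot H \<alpha> h \<longleftrightarrow>
     h \<in> bracket_span (root_space H \<alpha>) (root_space H (\<lambda>x. - \<alpha> x)) \<and> \<alpha> h = 2"

definition has_cartan_matrix :: "'i set \<Rightarrow> ('i \<Rightarrow> 'i \<Rightarrow> int) \<Rightarrow> bool" where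
  "has_cartan_matrix I A \<longleftrightarrow>
     (\<exists>H \<alpha> h. cartan_subalgebra H \<and> root_base H I \<alpha> \<and> (\<forall>i\<in>I. is_coroot H (\<alpha> i) (h i)) \<and>
        (\<forall>i\<in>I. \<forall>j\<in>I. \<alpha> j (h i) = of_int (A i j)))"

end

locale simple_lie_algebra = lie_algebra +
  assumes nonabelian: "\<exists>x y. bracket x y \<noteq> 0"
    and ideal_trivial: "lie_ideal I \<Longrightarrow> I = {0} \<or> I = UNIV"

text \<open>Bourbaki's numbering: the Dynkin diagram is the path 1 - 3 - 4 - 5 - 6 with 2 attached to 4.\<close>

definition cartan_matrix_E6 :: "nat \<Rightarrow> nat \<Rightarrow> int" where
  "cartan_matrix_E6 i j =
     (if i = j then 2
      else if {i, j} \<in> {{1, 3}, {3, 4}, {4, 5}, {5, 6}, {2, 4}} then - 1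
      else 0)"

locale complex_simple_lie_algebra_E6 = simple_lie_algebra scale bracket
  for scale :: "complex \<Rightarrow> 'v::ab_group_add \<Rightarrow> 'v" and bracket +
  assumes finite_dimensional: "\<exists>B. finite B \<and> span B = UNIV"
    and type_E6: "has_cartan_matrix {1..6} cartan_matrix_E6"

text \<open>The complexification of \<open>V\<close> is \<open>V \<times> V\<close>, the pair \<open>(x, y)\<close> standing for \<open>x + \<i> y\<close>.\<close>

definition complexified_scale :: "complex \<Rightarrow> 'a \<times> 'a \<Rightarrow> 'a \<times> ('a::real_vector)" where
  "complexified_scale k p =
     (Re k *\<^sub>R fst p - Im k *\<^sub>R snd p, Re k *\<^sub>R snd p + Im k *\<^sub>R fst p)"

definition complexified_bracket ::
    "('a \<Rightarrow> 'a \<Rightarrow> 'a::real_vector) \<Rightarrow> 'a \<times> 'a \<Rightarrow> 'a \<times> 'a \<Rightarrow> 'a \<times> 'a" where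
  "complexified_bracket br p q =
     (br (fst p) (fst q) - br (snd p) (snd q), br (fst p) (snd q) + br (snd p) (fst q))"

text \<open>\<open>Basis\<close> is orthonormal, so \<open>f b \<bullet> b\<close> are the diagonal entries of the matrix of a linear \<open>f\<close>.\<close>

definition lin_trace :: "('a \<Rightarrow> 'a::euclidean_space) \<Rightarrow> real" where
  "lin_trace f = (\<Sum>b\<in>Basis. f b \<bullet> b)"

definition killing_form :: "('a \<Rightarrow> 'a \<Rightarrow> 'a::euclidean_space) \<Rightarrow> 'a \<Rightarrow> 'a \<Rightarrow> real" where
  "killing_form br x y = lin_trace (\<lambda>z. br x (br y z))"

text \<open>The index type \<open>13\<close> is the ring of integers modulo 13, and \<open>axis t v\<close> is the vector \<open>v\<^sub>t\<close>.\<close>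

type_synonym V78 = "complex ^ 3 ^ 13"

abbreviation vec3 :: "complex \<Rightarrow> complex \<Rightarrow> complex \<Rightarrow> complex ^ 3" where
  "vec3 x y z \<equiv> vector [x, y, z]"

definition \<omega> :: complex where
  "\<omega> = exp (2 * pi * \<i> / 3)"

abbreviation \<omega>' :: complex where
  "\<omega>' \<equiv> cnj \<omega>"

definition \<theta> :: complex where
  "\<theta> = \<omega> - \<omega>'"

definition cnj_vec :: "complex ^ 3 \<Rightarrow> complex ^ 3" where
  "cnj_vec v = (\<chi> i. cnj (v $ i))"

definition theta_third_matrix :: "complex ^ 3 \<Rightarrow> complex ^ 3 \<Rightarrow> complex ^ 3 \<Rightarrow> complex ^ 3 ^ 3" where
  "theta_third_matrix r1 r2 r3 = (\<chi> i j. \<theta> / 3 * vector [r1, r2, r3] $ i $ j)"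

definition M1 :: "complex ^ 3 ^ 3" where
  "M1 = theta_third_matrix (vec3 \<omega> 1 1) (vec3 1 \<omega> 1) (vec3 1 1 \<omega>)"

definition M2 :: "complex ^ 3 ^ 3" where
  "M2 = theta_third_matrix (vec3 1 1 1) (vec3 1 \<omega>' \<omega>) (vec3 1 \<omega> \<omega>')"

definition M3 :: "complex ^ 3 ^ 3" where
  "M3 = theta_third_matrix (vec3 \<omega> \<omega> \<omega>) (vec3 \<omega>' \<omega> 1) (vec3 \<omega>' 1 \<omega>)"

definition M4 :: "complex ^ 3 ^ 3" where
  "M4 = theta_third_matrix (vec3 1 \<omega> \<omega>) (vec3 \<omega>' \<omega>' \<omega>) (vec3 \<omega>' \<omega> \<omega>')"

definition from_summands :: "(13 \<Rightarrow> complex ^ 3 \<Rightarrow> V78) \<Rightarrow> V78 \<Rightarrow> V78" where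
  "from_summands F u = (\<Sum>t\<in>UNIV. F t (u $ t))"

definition gen_a :: "V78 \<Rightarrow> V78" where
  "gen_a = from_summands (\<lambda>t v. axis (t + 1) v)"

definition gen_b :: "V78 \<Rightarrow> V78" where
  "gen_b = from_summands (\<lambda>t v. axis (3 * t) (vec3 (\<omega> * v $ 1) (\<omega>' * v $ 2) (\<omega>' * v $ 3)))"

definition gen_c :: "V78 \<Rightarrow> V78" where
  "gen_c = from_summands (\<lambda>t v.
     let x = v $ 1; y = v $ 2; z = v $ 3 in
     if t = 0 then - axis 0 (vec3 (cnj x) (cnj z) (cnj y))
     else if t = 1 then - axis 1 (vec3 x z y)
     else if t = 3 then - axis 9 (vec3 (\<omega> * x) (\<omega>' * z) (\<omega>' * y))
     else if t = 9 then - axis 3 (vec3 (\<omega>' * x) (\<omega> * z) (\<omega> * y))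
     else if t = 4 then axis 10 (cnj_vec v)
     else if t = 10 then axis 4 (cnj_vec v)
     else if t = 12 then axis 12 (cnj_vec v)
     else if t = 2 then axis 2 (cnj_vec v v* M1)
     else if t = 8 then axis 8 (cnj_vec v v* M2)
     else if t = 5 then axis 6 (cnj_vec v v* M3)
     else if t = 6 then axis 5 (cnj_vec v v* transpose M3)
     else if t = 7 then axis 11 (cnj_vec v v* M4)
     else axis 7 (cnj_vec v v* transpose M4))"

definition delta :: "13 \<Rightarrow> complex" where
  "delta t =
     (if t \<in> {0, 2, 8, 12} then 1 else if t \<in> {1, 3, 4, 5, 9, 11} then \<omega> else \<omega>')"

definition gen_d :: "V78 \<Rightarrow> V78" where
  "gen_d = from_summands (\<lambda>t v. axis t (delta t *s v))"

definition gen_e :: "V78 \<Rightarrow> V78" where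
  "gen_e = from_summands (\<lambda>t v.
     let x = v $ 1; y = v $ 2; z = v $ 3 in
     axis t
      (if t = 0 then vec3 x y z
       else if t \<in> {1, 11} then vec3 z x y
       else if t = 2 then vec3 (\<omega>' * y) z (\<omega> * x)
       else if t \<in> {3, 7} then vec3 (\<omega>' * z) (\<omega> * x) y
       else if t \<in> {4, 10, 12} then vec3 x (\<omega> * y) (\<omega>' * z)
       else if t = 5 then vec3 y z x
       else if t = 6 then vec3 (\<omega> * y) z (\<omega>' * x)
       else vec3 (\<omega> * z) (\<omega>' * x) y))"

text \<open>The group operation is \<open>g \<circ> f\<close> here, opposite to that of right actions; the subgroup generated is the
  same set of maps.\<close>

definition group_G :: "(V78 \<Rightarrow> V78) set" where
  "group_G = generate (BijGroup UNIV) {gen_a, gen_b, gen_c, gen_d, gen_e}"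

definition G_invariant :: "(V78 \<Rightarrow> V78 \<Rightarrow> V78) \<Rightarrow> bool" where
  "G_invariant br \<longleftrightarrow> (\<forall>g\<in>group_G. \<forall>u v. br (g u) (g v) = g (br u v))"

end

theory Submission
  imports Defs
begin

text \<open>The thirteen indices are the points of the projective plane over the field with three elements, and
its lines are the sets \<open>{k, k + 1, k + 3, k + 9}\<close>. The reason is that the conjugates of \<open>d\<close> by
powers of \<open>a\<close> generate an elementary abelian group of order 27, whose 26 nontrivial characters form
13 pairs \<open>\<plusminus>\<chi>\<close>, one for each summand \<open>V\<^sub>t\<close>. An invariant product of \<open>V\<^sub>s\<close> and \<open>V\<^sub>t\<close> therefore has
its values in the two other summands on the line through \<open>s\<close> and \<open>t\<close>.

The four summands on one line form three commuting copies of \<open>su(3)\<close>: at each point of the line there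
is an orthogonal frame of \<open>\<complex>\<^sup>3\<close>, and the three coordinates with respect to these frames do not
interact. In each coordinate the product is the one of \<open>su(3)\<close> in the basis of Weyl matrices
\<open>W(p)\<close>, where \<open>p\<close> is a nonzero vector over the field with three elements and \<open>[W(p), W(q)]\<close> is a
multiple of \<open>\<langle>p, q\<rangle> W(p + q)\<close> for the symplectic form. The one given value, moved around by
finitely many elements of the group, forces this table (\<open>br_line_vec\<close>), and invariance also forces
the product to vanish on each \<open>V\<^sub>t\<close> (\<open>br_same\<close>). So the product is known explicitly.

The Jacobi identity is compatible with the group, which moves every triple of points, up to order, to one of
\<open>(0, 0, 0)\<close>, \<open>(0, 0, 1)\<close>, \<open>(0, 1, 3)\<close>, \<open>(0, 1, 2)\<close>. The first three lie on a line and are read off the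
table; the triangle is a polynomial identity in \<open>\<omega>\<close> (\<open>jacobi_012\<close>). The table also shows that the
standard inner product is invariant (\<open>invariant\<close>). Hence every \<open>ad x\<close> is skew, and the Killing form
\<open>- (\<Sum>b. |[x, b]|\<^sup>2)\<close> is negative definite because the centre is zero.

The Cartan subalgebra is \<open>V\<^sub>0\<close>. On the other three points of each of the four lines through 0, and for
each of the three factors \<open>su(3)\<close>, it acts by rotations of three real planes (\<open>plane_vec_eigen\<close>). The
36 rotation speeds and their negatives are the 72 roots of \<open>E\<^sub>6\<close>. The locale \<open>compact_root_datum\<close>
carries out the general step from such rotation planes, with a base and its Cartan integers, to
the simplicity and the Cartan matrix of the complexification.
\<close>


section \<open>Weights, complexification and the Killing form\<close>

lemma (in lie_algebra) bracket_add_right: "bracket x (y + z) = bracket x y + bracket x z"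
  using bracket_linear_right[of x] by (simp add: Vector_Spaces.linear_iff)

lemma (in lie_algebra) bracket_scale_right: "bracket x (scale c y) = scale c (bracket x y)"
  using bracket_linear_right[of x] by (simp add: Vector_Spaces.linear_iff)

lemma (in lie_algebra) bracket_add_left: "bracket (x + y) z = bracket x z + bracket y z"
  using bracket_linear_left[of z] by (simp add: Vector_Spaces.linear_iff)

lemma (in lie_algebra) bracket_zero_right: "bracket x 0 = 0"
  using bracket_scale_right[of x 0 0] by simp

lemma (in lie_algebra) bracket_sum_right: "bracket x (\<Sum>k\<in>K. f k) = (\<Sum>k\<in>K. bracket x (f k))"
  by (induction K rule: infinite_finite_induct) (simp_all add: bracket_zero_right bracket_add_right)

lemma (in lie_algebra) bracket_swap: "bracket x y = - bracket y x"
proof -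
  have "bracket x y + bracket y x = 0"
    using bracket_self[of "x + y", unfolded bracket_add_left bracket_add_right]
    by (simp add: bracket_self add.commute)
  then show ?thesis by (simp add: eq_neg_iff_add_eq_0)
qed

text \<open>The operator \<open>ad h - w m h\<close> kills the component of weight \<open>w m\<close> and rescales the others, whence an
  induction on the number of weights. For \<open>I = {0}\<close> this is the independence of eigenvectors; for an
  ideal \<open>I\<close> it says that \<open>I\<close> is the sum of its weight components.\<close>

lemma (in lie_algebra) weight_components_in_subspace:
  assumes "finite K" and "subspace I" and "\<And>h x. h \<in> H \<Longrightarrow> x \<in> I \<Longrightarrow> bracket h x \<in> I"
    and "\<And>k l. k \<in> K \<Longrightarrow> l \<in> K \<Longrightarrow> k \<noteq> l \<Longrightarrow> \<exists>h\<in>H. w k h \<noteq> w l h"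
    and "\<And>k h. k \<in> K \<Longrightarrow> h \<in> H \<Longrightarrow> bracket h (x k) = scale (w k h) (x k)"
    and "(\<Sum>k\<in>K. x k) \<in> I" and "k \<in> K"
  shows "x k \<in> I"
  using assms(1,4-7)
proof (induction K arbitrary: k x rule: finite_induct)
  case empty
  then show ?case by simp
next
  case (insert m K)
  let ?s = "\<Sum>k\<in>insert m K. x k"
  have rest: "x l \<in> I" if l: "l \<in> K" for l
  proof -
    obtain h where h: "h \<in> H" "w l h \<noteq> w m h"
      using insert.prems(1)[of l m] insert.hyps l by blast
    have eq: "bracket h ?s - scale (w m h) ?s = (\<Sum>k\<in>K. scale (w k h - w m h) (x k))"
    proof -
      have "bracket h ?s = (\<Sum>k\<in>insert m K. scale (w k h) (x k))"
        unfolding bracket_sum_right by (rule sum.cong) (use insert.prems(2) h in auto)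
      then show ?thesis
        using insert.hyps
        by (simp add: scale_right_distrib scale_sum_right scale_left_diff_distrib sum_subtractf)
    qed
    have "bracket h ?s - scale (w m h) ?s \<in> I"
      using insert.prems(3) h assms(2,3) by (intro subspace_diff subspace_scale) auto
    then have "(\<Sum>k\<in>K. scale (w k h - w m h) (x k)) \<in> I" using eq by simp
    from insert.IH[of "\<lambda>k. scale (w k h - w m h) (x k)", OF _ _ this l]
    have "scale (w l h - w m h) (x l) \<in> I"
      using insert.prems(1,2)
      by (simp add: bracket_scale_right scale_left_commute)
    from subspace_scale[OF assms(2) this, of "inverse (w l h - w m h)"] show ?thesis using h by simp
  qed
  have "(\<Sum>k\<in>K. x k) \<in> I" using rest by (rule subspace_sum[OF assms(2)])
  from subspace_diff[OF assms(2) insert.prems(3) this] have "x m \<in> I" using insert.hyps by simp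
  then show ?case using rest insert.prems(4) by auto
qed

lemma vector_space_complexified: "vector_space (complexified_scale :: complex \<Rightarrow> 'a \<times> 'a \<Rightarrow> 'a \<times> 'a::real_vector)"
  by unfold_locales
    (auto simp: complexified_scale_def algebra_simps prod_eq_iff scaleR_add_left)

locale real_lie_algebra =
  fixes br :: "'a::real_vector \<Rightarrow> 'a \<Rightarrow> 'a"
  assumes bilinear_br: "bilinear br"
    and br_self: "br x x = 0"
    and br_jacobi: "br x (br y z) + br y (br z x) + br z (br x y) = 0"
begin

lemmas br_simps = bilinear_ladd[OF bilinear_br] bilinear_radd[OF bilinear_br]
  bilinear_lmul[OF bilinear_br] bilinear_rmul[OF bilinear_br]
  bilinear_lneg[OF bilinear_br] bilinear_rneg[OF bilinear_br]
  bilinear_lsub[OF bilinear_br] bilinear_rsub[OF bilinear_br]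
  bilinear_lzero[OF bilinear_br] bilinear_rzero[OF bilinear_br]

sublocale real: lie_algebra scaleR br
  by (intro lie_algebra.intro lie_algebra_axioms.intro)
    (auto simp: Vector_Spaces.linear_iff br_simps real_vector.vector_space_axioms br_self br_jacobi)

lemma br_swap: "br x y = - br y x"
  by (fact real.bracket_swap)

sublocale complex: lie_algebra complexified_scale "complexified_bracket br"
proof (intro lie_algebra.intro lie_algebra_axioms.intro)
  interpret vector_space "complexified_scale :: complex \<Rightarrow> 'a \<times> 'a \<Rightarrow> 'a \<times> 'a"
    by (rule vector_space_complexified)
  show "vector_space (complexified_scale :: complex \<Rightarrow> 'a \<times> 'a \<Rightarrow> 'a \<times> 'a)" ..
  show "Vector_Spaces.linear complexified_scale complexified_scale (\<lambda>y. complexified_bracket br x y)"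
    "Vector_Spaces.linear complexified_scale complexified_scale (\<lambda>x. complexified_bracket br x y)" for x y
    by (auto simp: Vector_Spaces.linear_iff vector_space_axioms complexified_bracket_def
        complexified_scale_def br_simps algebra_simps)
  show "complexified_bracket br x x = 0" for x
    using br_swap[of "fst x" "snd x"]
    by (simp add: complexified_bracket_def br_self zero_prod_def)
  let ?J = "\<lambda>a b c. br a (br b c) + br b (br c a) + br c (br a b)"
  show "complexified_bracket br x (complexified_bracket br y z) +
    complexified_bracket br y (complexified_bracket br z x) +
    complexified_bracket br z (complexified_bracket br x y) = 0" (is "?L = 0") for x y z
  proof -
    have "fst ?L = ?J (fst x) (fst y) (fst z) - ?J (snd x) (snd y) (fst z)
        - ?J (snd x) (fst y) (snd z) - ?J (fst x) (snd y) (snd z)"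
      by (simp add: complexified_bracket_def br_simps algebra_simps)
    moreover have "snd ?L = ?J (fst x) (fst y) (snd z) + ?J (fst x) (snd y) (fst z)
        + ?J (snd x) (fst y) (fst z) - ?J (snd x) (snd y) (snd z)"
      by (simp add: complexified_bracket_def br_simps algebra_simps)
    ultimately show ?thesis by (simp add: br_jacobi prod_eq_iff)
  qed
qed

text \<open>An ideal \<open>I\<close> of the real algebra yields the ideal \<open>I \<times> I\<close> of its complexification.\<close>

lemma simple_real_form:
  assumes "simple_lie_algebra complexified_scale (complexified_bracket br)"
  shows "simple_lie_algebra scaleR br"
proof -
  interpret S: simple_lie_algebra complexified_scale "complexified_bracket br" by fact
  show ?thesis
  proof unfold_locales
    show "\<exists>x y. br x y \<noteq> 0"
      using S.nonabelian by (rule contrapos_pp) (simp add: complexified_bracket_def zero_prod_def)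
  next
    fix I assume I: "real.lie_ideal I"
    then have sub: "subspace I" and br: "\<And>x y. y \<in> I \<Longrightarrow> br x y \<in> I"
      by (auto simp: real.lie_ideal_def subspace_raw_def)
    have "complex.lie_ideal (I \<times> I)"
      unfolding complex.lie_ideal_def complex.subspace_def
      by (auto simp: complexified_scale_def complexified_bracket_def zero_prod_def br
          subspace_0[OF sub] subspace_add[OF sub] subspace_diff[OF sub] subspace_scale[OF sub])
    from S.ideal_trivial[OF this] show "I = {0} \<or> I = UNIV"
    proof
      assume "I \<times> I = {0}"
      then have "I = {0}" using subspace_0[OF sub] by (auto simp: zero_prod_def)
      then show ?thesis ..
    next
      assume "I \<times> I = UNIV"
      then have "I = UNIV" by auto
      then show ?thesis ..
    qed
  qed
qed

end

text \<open>Invariance makes every \<open>ad x\<close> skew-symmetric, which is how compactness enters.\<close>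

locale compact_lie_algebra = real_lie_algebra br
  for br :: "'a::euclidean_space \<Rightarrow> 'a \<Rightarrow> 'a" +
  assumes br_invariant: "br x y \<bullet> z = x \<bullet> br y z"
begin

text \<open>As \<open>ad x\<close> is skew, the trace of its square is \<open>- (\<Sum>b. |[x, b]|\<^sup>2)\<close>, which vanishes only for central
  \<open>x\<close>, and the centre of a simple algebra is an ideal other than the whole algebra.\<close>

lemma killing_form_negative:
  assumes simple: "simple_lie_algebra scaleR br" and "x \<noteq> 0"
  shows "killing_form br x x < 0"
proof -
  interpret S: simple_lie_algebra scaleR br by fact
  have skew: "br x y \<bullet> z = - (y \<bullet> br x z)" for y z
    using br_invariant[of y x z] br_swap[of x y] by simp
  have kill: "killing_form br x x = - (\<Sum>b\<in>Basis. (norm (br x b))\<^sup>2)"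
    unfolding killing_form_def lin_trace_def
    by (simp add: skew[of "br x b" b for b] power2_norm_eq_inner sum_negf)
  have "\<exists>b\<in>Basis. br x b \<noteq> 0"
  proof (rule ccontr)
    assume "\<not> ?thesis"
    then have *: "br x y = 0" for y
      using linear_eq_0_on_span[of "br x" Basis y] bilinear_br
      unfolding bilinear_def by simp
    let ?Z = "{x. \<forall>y. br x y = 0}"
    have "real.lie_ideal ?Z"
      unfolding real.lie_ideal_def real.subspace_def
    proof (intro conjI allI ballI)
      fix y z assume "z \<in> ?Z"
      then have "br y z = 0" using br_swap[of y z] by simp
      then show "br y z \<in> ?Z" by (simp add: br_simps)
    qed (simp_all add: br_simps)
    moreover have "?Z \<noteq> {0}" using * assms(2) by blast
    moreover have "?Z \<noteq> UNIV" using S.nonabelian by blast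
    ultimately show False using S.ideal_trivial by blast
  qed
  then have "(\<Sum>b\<in>Basis. (norm (br x b))\<^sup>2) > 0"
    by (auto intro!: sum_pos2)
  then show ?thesis by (simp add: kill)
qed

end

section \<open>From rotation planes to the Cartan matrix\<close>

text \<open>The vectors \<open>\<rho> r\<close> represent the positive roots through the inner product: on the plane spanned by \<open>p r\<close>
  and \<open>q r\<close> an element \<open>h\<close> of \<open>H\<close> acts as a rotation with speed \<open>\<rho> r \<bullet> h\<close>, so that the roots of the
  complexification are \<open>\<plusminus>\<i>\<close> times these forms. The simple roots are the \<open>\<rho> (\<iota> i)\<close>, the coordinates of
  \<open>\<rho> r\<close> in them are \<open>n r\<close>, and \<open>A\<close> is the Cartan matrix.\<close>

locale compact_root_datum = compact_lie_algebra br
  for br :: "'a::euclidean_space \<Rightarrow> 'a \<Rightarrow> 'a" +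
  fixes H :: "'a set" and R :: "'r set" and \<rho> p q :: "'r \<Rightarrow> 'a"
    and I :: "'i set" and \<iota> :: "'i \<Rightarrow> 'r" and n :: "'r \<Rightarrow> 'i \<Rightarrow> nat" and A :: "'i \<Rightarrow> 'i \<Rightarrow> int"
  assumes subspace_H: "subspace H"
    and abelian_H: "h \<in> H \<Longrightarrow> h' \<in> H \<Longrightarrow> br h h' = 0"
    and finite_R: "finite R"
    and rho_H: "r \<in> R \<Longrightarrow> \<rho> r \<in> H"
    and rho_nz: "r \<in> R \<Longrightarrow> \<rho> r \<noteq> 0"
    and p_nz: "r \<in> R \<Longrightarrow> p r \<noteq> 0"
    and br_H_p: "r \<in> R \<Longrightarrow> h \<in> H \<Longrightarrow> br h (p r) = (\<rho> r \<bullet> h) *\<^sub>R q r"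
    and br_H_q: "r \<in> R \<Longrightarrow> h \<in> H \<Longrightarrow> br h (q r) = - (\<rho> r \<bullet> h) *\<^sub>R p r"
    and spanning: "span (H \<union> p ` R \<union> q ` R) = UNIV"
    and finite_I: "finite I" and I_ne: "I \<noteq> {}"
    and simple_R: "i \<in> I \<Longrightarrow> \<iota> i \<in> R"
    and rho_comb: "r \<in> R \<Longrightarrow> \<rho> r = (\<Sum>i\<in>I. real (n r i) *\<^sub>R \<rho> (\<iota> i))"
    and inj_n: "r \<in> R \<Longrightarrow> s \<in> R \<Longrightarrow> (\<And>i. i \<in> I \<Longrightarrow> n r i = n s i) \<Longrightarrow> r = s"
    and simple_indep: "(\<Sum>i\<in>I. c i *\<^sub>R \<rho> (\<iota> i)) = 0 \<Longrightarrow> i \<in> I \<Longrightarrow> c i = 0"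
    and H_span: "H \<subseteq> span ((\<lambda>i. \<rho> (\<iota> i)) ` I)"
    and cartan_ints: "i \<in> I \<Longrightarrow> j \<in> I \<Longrightarrow>
      2 * (\<rho> (\<iota> i) \<bullet> \<rho> (\<iota> j)) = of_int (A i j) * (\<rho> (\<iota> i) \<bullet> \<rho> (\<iota> i))"
    and connected: "J \<subseteq> I \<Longrightarrow> J \<noteq> {} \<Longrightarrow> J \<noteq> I \<Longrightarrow> \<exists>i\<in>J. \<exists>j\<in>I - J. A i j \<noteq> 0"
begin

abbreviation (input) cs :: "complex \<Rightarrow> 'a \<times> 'a \<Rightarrow> 'a \<times> 'a" where "cs \<equiv> complexified_scale"
abbreviation (input) cb where "cb \<equiv> complexified_bracket br"
abbreviation (input) HC where "HC \<equiv> H \<times> H"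

text \<open>These pairs stand for \<open>p r - \<i> q r\<close> and its conjugate, the eigenvectors of the rotations.\<close>

definition root_vec :: "bool \<Rightarrow> 'r \<Rightarrow> 'a \<times> 'a" where
  "root_vec b r = (p r, if b then - q r else q r)"

text \<open>The form \<open>\<plusminus>\<i> (\<rho> r \<bullet> h)\<close>, extended complex linearly to \<open>H \<times> H\<close> and by zero outside, as forms on a
  subspace are represented.\<close>

definition weight :: "bool \<Rightarrow> 'r \<Rightarrow> 'a \<times> 'a \<Rightarrow> complex" where
  "weight b r z = (if z \<in> HC then (if b then 1 else - 1) * Complex (- (\<rho> r \<bullet> snd z)) (\<rho> r \<bullet> fst z) else 0)"

lemma cb_root_vec:
  assumes "r \<in> R" "z \<in> HC"
  shows "cb z (root_vec b r) = cs (weight b r z) (root_vec b r)"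
  using assms
  by (auto simp: root_vec_def weight_def complexified_bracket_def complexified_scale_def br_H_p br_H_q br_simps)

lemma root_vec_nz: "r \<in> R \<Longrightarrow> root_vec b r \<noteq> 0"
  by (simp add: root_vec_def p_nz zero_prod_def)

lemma cs_nz: "cs c z = 0 \<longleftrightarrow> c = 0 \<or> z = 0"
  by (rule complex.scale_eq_0_iff)

lemma weight_uminus: "(\<lambda>z. - weight b r z) = weight (\<not> b) r"
  by (auto simp: weight_def fun_eq_iff)

lemma weight_nz: "r \<in> R \<Longrightarrow> \<exists>z\<in>HC. weight b r z \<noteq> 0"
  by (rule bexI[of _ "(\<rho> r, 0)"])
    (auto simp: weight_def rho_H rho_nz subspace_0[OF subspace_H] complex_eq_iff)

lemma inj_rho:
  assumes "r \<in> R" "s \<in> R" "\<rho> r = \<rho> s" shows "r = s"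
proof (rule inj_n[OF assms(1,2)])
  fix i assume i: "i \<in> I"
  have "(\<Sum>i\<in>I. (real (n r i) - real (n s i)) *\<^sub>R \<rho> (\<iota> i)) = \<rho> r - \<rho> s"
    by (simp add: rho_comb[OF assms(1)] rho_comb[OF assms(2)] scaleR_diff_left sum_subtractf)
  then show "n r i = n s i" using simple_indep[OF _ i, of "\<lambda>i. real (n r i) - real (n s i)"] assms(3) by simp
qed

lemma rho_not_opposite:
  assumes "r \<in> R" "s \<in> R" shows "\<rho> r \<noteq> - \<rho> s"
proof
  assume "\<rho> r = - \<rho> s"
  moreover have "(\<Sum>i\<in>I. (real (n r i) + real (n s i)) *\<^sub>R \<rho> (\<iota> i)) = \<rho> r + \<rho> s"
    by (simp add: rho_comb[OF assms(1)] rho_comb[OF assms(2)] scaleR_add_left sum.distrib)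
  ultimately have "real (n r i) + real (n s i) = 0" if "i \<in> I" for i
    using simple_indep[of "\<lambda>i. real (n r i) + real (n s i)"] that by auto
  then have "n r i = 0" if "i \<in> I" for i
    using that by (metis add_is_0 of_nat_0_eq_iff of_nat_add)
  then have "\<rho> r = 0" using rho_comb[OF assms(1)] by simp
  then show False using rho_nz[OF assms(1)] by simp
qed

lemma eq_if_inner_H_eq:
  assumes "x \<in> H" "y \<in> H" "\<And>h. h \<in> H \<Longrightarrow> x \<bullet> h = y \<bullet> h" shows "x = y"
proof -
  have "(x - y) \<bullet> (x - y) = 0"
    using assms(3)[OF subspace_diff[OF subspace_H assms(1,2)]] by (simp add: inner_diff_left)
  then show ?thesis by simp
qed

lemma weight_distinct:
  assumes "r \<in> R" "s \<in> R" "(b, r) \<noteq> (c, s)"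
  shows "\<exists>z\<in>HC. weight b r z \<noteq> weight c s z"
proof (rule ccontr)
  assume *: "\<not> ?thesis"
  let ?e = "\<lambda>b. if b then 1 else - 1 :: real"
  have "(?e b *\<^sub>R \<rho> r) \<bullet> h = (?e c *\<^sub>R \<rho> s) \<bullet> h" if "h \<in> H" for h
  proof -
    have "weight b r (h, 0) = weight c s (h, 0)" using * that subspace_0[OF subspace_H] by auto
    then show ?thesis using that subspace_0[OF subspace_H] 
      by (auto simp: weight_def complex_eq_iff split: if_splits)
  qed
  then have "?e b *\<^sub>R \<rho> r = ?e c *\<^sub>R \<rho> s"
    using rho_H[OF assms(1)] rho_H[OF assms(2)]
    by (intro eq_if_inner_H_eq) (auto intro!: subspace_scale[OF subspace_H] subspace_neg[OF subspace_H])
  then show False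
    using inj_rho[OF assms(1,2)] rho_not_opposite[OF assms(1,2)] rho_not_opposite[OF assms(2,1)] assms(3)
    by (auto split: if_splits)
qed

text \<open>The label \<open>None\<close> stands for the weight zero, whose weight space is \<open>H \<times> H\<close>.\<close>

definition weight_labels :: "(bool \<times> 'r) option set" where "weight_labels = insert None (Some ` (UNIV \<times> R))"

definition weight_of :: "(bool \<times> 'r) option \<Rightarrow> 'a \<times> 'a \<Rightarrow> complex" where
  "weight_of k z = (case k of None \<Rightarrow> 0 | Some (b, r) \<Rightarrow> weight b r z)"

definition weight_family :: "((bool \<times> 'r) option \<Rightarrow> 'a \<times> 'a) \<Rightarrow> bool" where
  "weight_family x \<longleftrightarrow> x None \<in> HC \<and> (\<forall>b. \<forall>r\<in>R. \<exists>c. x (Some (b, r)) = cs c (root_vec b r))"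

lemma HC_comm: "z \<in> HC \<Longrightarrow> z' \<in> HC \<Longrightarrow> cb z z' = 0"
  by (auto simp: complexified_bracket_def abelian_H zero_prod_def)

lemma subspace_HC: "complex.subspace HC"
  unfolding complex.subspace_def using subspace_H
  by (auto simp: complexified_scale_def zero_prod_def intro!: subspace_0 subspace_add subspace_diff subspace_scale)

lemma weight_family_eigen:
  assumes "weight_family x" "k \<in> weight_labels" "h \<in> HC"
  shows "cb h (x k) = cs (weight_of k h) (x k)"
proof (cases k)
  case None
  then show ?thesis using assms by (simp add: weight_family_def weight_of_def HC_comm)
next
  case (Some br)
  then obtain b r where k: "k = Some (b, r)" "r \<in> R" using assms(2) by (auto simp: weight_labels_def)
  then obtain c where "x k = cs c (root_vec b r)" using assms(1) by (auto simp: weight_family_def)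
  then show ?thesis using k assms(3)
    by (simp add: weight_of_def complex.bracket_scale_right cb_root_vec mult.commute)
qed

lemma weight_of_distinct:
  assumes "k \<in> weight_labels" "l \<in> weight_labels" "k \<noteq> l" shows "\<exists>h\<in>HC. weight_of k h \<noteq> weight_of l h"
proof -
  consider b r where "k = None" "l = Some (b, r)" "r \<in> R" | b r where "l = None" "k = Some (b, r)" "r \<in> R"
    | b r c s where "k = Some (b, r)" "l = Some (c, s)" "r \<in> R" "s \<in> R" "(b, r) \<noteq> (c, s)"
    using assms unfolding weight_labels_def by blast
  then show ?thesis
  proof cases
    case 1 then show ?thesis using weight_nz[of r b] by (auto simp: weight_of_def)
  next
    case 2 then show ?thesis using weight_nz[of r b] by (auto simp: weight_of_def)
  next
    case 3 then show ?thesis using weight_distinct[of r s b c] by (auto simp: weight_of_def)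
  qed
qed

lemma finite_weight_labels: "finite weight_labels" by (simp add: weight_labels_def finite_R)

lemma components_in_subspace:
  assumes "weight_family x" "complex.subspace S" "\<And>h z. h \<in> HC \<Longrightarrow> z \<in> S \<Longrightarrow> cb h z \<in> S"
    "(\<Sum>k\<in>weight_labels. x k) \<in> S" "k \<in> weight_labels"
  shows "x k \<in> S"
  by (rule complex.weight_components_in_subspace[where H=HC and w=weight_of and K=weight_labels and x=x])
    (use assms finite_weight_labels weight_of_distinct weight_family_eigen in auto)

text \<open>The root space decomposition. The decomposable elements form a complex subspace, and it contains
  \<open>p r\<close> and \<open>q r\<close> since these are combinations of the two conjugate root vectors.\<close>

lemma ex_decomposition: "\<exists>x. weight_family x \<and> z = (\<Sum>k\<in>weight_labels. x k)"
proof -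
  let ?D = "{z. \<exists>x. weight_family x \<and> z = (\<Sum>k\<in>weight_labels. x k)}"
  have sub: "complex.subspace ?D"
    unfolding complex.subspace_def
  proof (intro conjI allI ballI)
    have "weight_family (\<lambda>_. 0)"
      unfolding weight_family_def
    proof (intro conjI allI ballI)
      show "\<exists>c. 0 = cs c (root_vec b r)" for b r by (rule exI[of _ 0]) simp
    qed (rule complex.subspace_0[OF subspace_HC])
    then show "0 \<in> ?D" by (intro CollectI exI[of _ "\<lambda>_. 0"]) simp
  next
    fix z w assume "z \<in> ?D" "w \<in> ?D"
    then obtain x y where xy: "weight_family x" "z = (\<Sum>k\<in>weight_labels. x k)" "weight_family y" "w = (\<Sum>k\<in>weight_labels. y k)"
      by auto
    have "weight_family (\<lambda>k. x k + y k)"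
      unfolding weight_family_def
    proof (intro conjI allI ballI)
      show "x None + y None \<in> HC" using xy complex.subspace_add[OF subspace_HC] by (auto simp: weight_family_def)
      fix b r assume "r \<in> R"
      then obtain c d where "x (Some (b, r)) = cs c (root_vec b r)" "y (Some (b, r)) = cs d (root_vec b r)"
        using xy unfolding weight_family_def by metis
      then show "\<exists>c. x (Some (b, r)) + y (Some (b, r)) = cs c (root_vec b r)"
        by (metis complex.scale_left_distrib)
    qed
    then show "z + w \<in> ?D" using xy by (auto simp: sum.distrib)
  next
    fix a z assume "z \<in> ?D"
    then obtain x where xy: "weight_family x" "z = (\<Sum>k\<in>weight_labels. x k)" by auto
    have "weight_family (\<lambda>k. cs a (x k))"
      unfolding weight_family_def
    proof (intro conjI allI ballI)
      show "cs a (x None) \<in> HC" using xy complex.subspace_scale[OF subspace_HC] by (auto simp: weight_family_def)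
      fix b r assume "r \<in> R"
      then obtain c where "x (Some (b, r)) = cs c (root_vec b r)"
        using xy unfolding weight_family_def by metis
      then show "\<exists>c. cs a (x (Some (b, r))) = cs c (root_vec b r)"
        by (metis complex.scale_scale)
    qed
    then show "cs a z \<in> ?D" using xy by (auto simp: complex.scale_sum_right)
  qed
  have hD: "z \<in> ?D" if "z \<in> HC" for z
  proof -
    let ?x = "\<lambda>k. if k = None then z else 0"
    have "weight_family ?x" using that by (auto simp: weight_family_def intro: exI[of _ 0])
    moreover have "z = (\<Sum>k\<in>weight_labels. ?x k)" using finite_weight_labels by (simp add: sum.delta weight_labels_def)
    ultimately show ?thesis by blast
  qed
  have eD: "root_vec b r \<in> ?D" if "r \<in> R" for b r
  proof -
    let ?x = "\<lambda>k. if k = Some (b, r) then root_vec b r else 0"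
    have "weight_family ?x" unfolding weight_family_def
    proof (intro conjI allI ballI)
      show "?x None \<in> HC" using complex.subspace_0[OF subspace_HC] by simp
      show "\<exists>c. ?x (Some (b', r')) = cs c (root_vec b' r')" for b' r'
        by (rule exI[of _ "if (b', r') = (b, r) then 1 else 0"]) simp
    qed
    moreover have "root_vec b r = (\<Sum>k\<in>weight_labels. ?x k)" using finite_weight_labels that by (simp add: sum.delta weight_labels_def image_iff)
    ultimately show ?thesis by blast
  qed
  have "(x, 0) \<in> ?D" for x
  proof -
    have "x \<in> span (H \<union> p ` R \<union> q ` R)" using spanning by simp
    then show ?thesis
    proof (induction rule: span_induct_alt)
      case base
      show ?case using complex.subspace_0[OF sub] by (simp add: zero_prod_def)
    next
      case (step c x y)
      have "(x, 0) \<in> ?D"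
      proof -
        consider "x \<in> H" | r where "r \<in> R" "x = p r" | r where "r \<in> R" "x = q r" using step by blast
        then show ?thesis
        proof cases
          case 1 then show ?thesis using subspace_0[OF subspace_H] by (intro hD) auto
        next
          case 2
          then have "(x, 0) = cs (1/2) (root_vec True r + root_vec False r)"
            by (simp add: root_vec_def complexified_scale_def scaleR_half_double)
          also have "\<dots> \<in> ?D"
            by (intro complex.subspace_scale[OF sub] complex.subspace_add[OF sub] eD 2)
          finally show ?thesis .
        next
          case 3
          then have "(x, 0) = cs (- \<i>/2) (root_vec False r - root_vec True r)"
            by (simp add: root_vec_def complexified_scale_def scaleR_half_double)
          also have "\<dots> \<in> ?D"
            by (intro complex.subspace_scale[OF sub] complex.subspace_diff[OF sub] eD 3)
          finally show ?thesis .
        qed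
      qed
      from complex.subspace_add[OF sub complex.subspace_scale[OF sub this, of "of_real c"] step.IH]
      show ?case by (simp add: complexified_scale_def)
    qed
  qed
  note D = this
  have "z = (fst z, 0) + cs \<i> (snd z, 0)" by (simp add: complexified_scale_def)
  also have "\<dots> \<in> ?D" by (intro complex.subspace_add[OF sub] complex.subspace_scale[OF sub] D)
  finally show ?thesis by simp
qed

text \<open>Indeed \<open>h \<bullet> [\<rho> r, x] = [h, \<rho> r] \<bullet> x = 0\<close>, and \<open>p r\<close>, \<open>q r\<close> are multiples of such brackets.\<close>

lemma inner_H_p_q:
  assumes "r \<in> R" "h \<in> H" shows "h \<bullet> p r = 0" "h \<bullet> q r = 0"
proof -
  let ?c = "\<rho> r \<bullet> \<rho> r"
  have c: "?c \<noteq> 0" using rho_nz assms by simp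
  have "br h (\<rho> r) = 0" using assms by (simp add: abelian_H rho_H)
  then have "h \<bullet> br (\<rho> r) x = 0" for x using br_invariant[of h "\<rho> r" x] by simp
  from this[of "q r"] this[of "p r"] show "h \<bullet> p r = 0" "h \<bullet> q r = 0"
    using c assms by (simp_all add: br_H_p br_H_q rho_H)
qed

text \<open>By the Jacobi identity the bracket commutes with \<open>H\<close>, so by invariance it is orthogonal to all the
  planes; its inner products with \<open>H\<close> follow from invariance as well. Thus the action of \<open>H\<close> alone
  determines the coroots.\<close>

lemma br_p_q:
  assumes r: "r \<in> R" shows "br (p r) (q r) = (p r \<bullet> p r) *\<^sub>R \<rho> r"
proof -
  let ?z = "br (p r) (q r)"
  have comm: "br h ?z = 0" if "h \<in> H" for h
  proof -
    have 1: "br (q r) h = (\<rho> r \<bullet> h) *\<^sub>R p r" "br h (p r) = (\<rho> r \<bullet> h) *\<^sub>R q r"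
      unfolding br_swap[of "q r" h] using r that by (simp_all add: br_H_q br_H_p)
    show ?thesis using br_jacobi[of h "p r" "q r"] unfolding 1 by (simp add: br_simps br_self)
  qed
  have H: "?z \<bullet> h = ((p r \<bullet> p r) *\<^sub>R \<rho> r) \<bullet> h" if "h \<in> H" for h
  proof -
    have "?z \<bullet> h = - (p r \<bullet> br h (q r))" unfolding br_invariant br_swap[of "q r" h] by simp
    then show ?thesis using r that by (simp add: br_H_q)
  qed
  have PQ: "?z \<bullet> br (\<rho> s) x = 0" if "s \<in> R" for s x
    unfolding br_invariant[symmetric] br_swap[of ?z "\<rho> s"] comm[OF rho_H[OF that]] by simp
  have "(?z - (p r \<bullet> p r) *\<^sub>R \<rho> r) \<bullet> x = 0" if x: "x \<in> H \<union> p ` R \<union> q ` R" for x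
  proof -
    consider "x \<in> H" | s where "s \<in> R" "x = p s" | s where "s \<in> R" "x = q s" using x by blast
    then show ?thesis
    proof cases
      case 1 show ?thesis unfolding inner_diff_left H[OF 1] by simp
    next
      case 2
      have "?z \<bullet> p s = 0" using PQ[OF 2(1), of "q s"] rho_nz[OF 2(1)]
        unfolding br_H_q[OF 2(1) rho_H[OF 2(1)]] by simp
      then show ?thesis using inner_H_p_q[OF 2(1) rho_H[OF r]] 2(2) by (simp add: inner_diff_left)
    next
      case 3
      have "?z \<bullet> q s = 0" using PQ[OF 3(1), of "p s"] rho_nz[OF 3(1)]
        unfolding br_H_p[OF 3(1) rho_H[OF 3(1)]] by simp
      then show ?thesis using inner_H_p_q[OF 3(1) rho_H[OF r]] 3(2) by (simp add: inner_diff_left)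
    qed
  qed
  then have "orthogonal (?z - (p r \<bullet> p r) *\<^sub>R \<rho> r) y" if "y \<in> span (H \<union> p ` R \<union> q ` R)" for y
    unfolding orthogonal_def[symmetric] by (rule orthogonal_to_span[OF that])
  from this[of "?z - (p r \<bullet> p r) *\<^sub>R \<rho> r"] show ?thesis
    unfolding spanning orthogonal_self by simp
qed

lemma cb_opposite:
  assumes "r \<in> R"
  shows "cb (root_vec True r) (root_vec False r) = cs (2 * (p r \<bullet> p r)) (0, \<rho> r)"
  using br_p_q[OF assms] br_swap[of "q r" "p r"]
  by (simp add: root_vec_def complexified_bracket_def complexified_scale_def br_self br_simps flip: scaleR_2)

definition coroot :: "'r \<Rightarrow> 'a \<times> 'a" where
  "coroot r = cs (of_real (- 2 / (\<rho> r \<bullet> \<rho> r))) (0, \<rho> r)"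

lemma weight_root_space: "r \<in> R \<Longrightarrow> root_vec b r \<in> complex.root_space HC (weight b r)"
  by (simp add: complex.root_space_def cb_root_vec)

lemma is_coroot: 
  assumes "r \<in> R" shows "complex.is_coroot HC (weight True r) (coroot r)"
  unfolding complex.is_coroot_def
proof
  have eq: "coroot r = cs (of_real (- 1 / ((\<rho> r \<bullet> \<rho> r) * (p r \<bullet> p r)))) (cb (root_vec True r) (root_vec False r))"
    using p_nz[OF assms] by (simp add: cb_opposite[OF assms] coroot_def)
  show "coroot r \<in> complex.bracket_span (complex.root_space HC (weight True r))
      (complex.root_space HC (\<lambda>x. - weight True r x))"
    unfolding complex.bracket_span_def eq weight_uminus
    by (intro complex.span_scale complex.span_base CollectI exI[of _ "root_vec True r"] exI[of _ "root_vec False r"]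
        conjI refl)
      (use weight_root_space[OF assms, of True] weight_root_space[OF assms, of False] in auto)
  show "weight True r (coroot r) = 2"
    using rho_nz[OF assms] rho_H[OF assms] subspace_H
    by (simp add: weight_def coroot_def complexified_scale_def subspace_0 subspace_scale subspace_neg complex_eq_iff)
qed

lemma weight_coroot:
  assumes "i \<in> I" "j \<in> I" shows "weight True (\<iota> j) (coroot (\<iota> i)) = of_int (A i j)"
proof -
  have "2 * (\<rho> (\<iota> j) \<bullet> \<rho> (\<iota> i)) / (\<rho> (\<iota> i) \<bullet> \<rho> (\<iota> i)) = of_int (A i j)"
    using cartan_ints[OF assms] rho_nz[OF simple_R[OF assms(1)]]
    by (simp add: divide_eq_eq inner_commute)
  then show ?thesis
    using rho_H[OF simple_R[OF assms(1)]] subspace_H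
    by (simp add: weight_def coroot_def complexified_scale_def subspace_0 subspace_scale subspace_neg complex_eq_iff)
qed

lemma weight_dual_space: "weight b r \<in> complex.dual_space HC"
  unfolding complex.dual_space_def using subspace_H
  by (auto simp: weight_def complexified_scale_def subspace_add subspace_diff subspace_scale
      complex_eq_iff inner_simps)

lemma weight_root: "r \<in> R \<Longrightarrow> weight b r \<in> complex.roots HC"
  unfolding complex.roots_def using weight_root_space[of r b] root_vec_nz[of r b] weight_nz[of r b] weight_dual_space
  by fastforce

text \<open>A vector of weight \<open>\<beta>\<close> has no component of another weight, so \<open>\<beta>\<close> is the weight of any of its nonzero
  components.\<close>

lemma root_is_weight:
  assumes "\<beta> \<in> complex.roots HC" shows "\<exists>b. \<exists>r\<in>R. \<beta> = weight b r"
proof -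
  have dual: "\<beta> \<in> complex.dual_space HC" and nz: "\<beta> \<noteq> (\<lambda>_. 0)"
    using assms by (auto simp: complex.roots_def)
  have "0 \<in> complex.root_space HC \<beta>"
    by (simp add: complex.root_space_def complex.bracket_zero_right)
  then obtain z where z: "z \<in> complex.root_space HC \<beta>" "z \<noteq> 0"
    using assms by (auto simp: complex.roots_def)
  obtain x where x: "weight_family x" "z = (\<Sum>k\<in>weight_labels. x k)" using ex_decomposition by blast
  have *: "cs (weight_of k h - \<beta> h) (x k) = 0" if h: "h \<in> HC" and k: "k \<in> weight_labels" for h k
  proof -
    let ?y = "\<lambda>k. cs (weight_of k h - \<beta> h) (x k)"
    have y: "cb h' (?y k) = cs (weight_of k h') (?y k)" if "k \<in> weight_labels" "h' \<in> HC" for k h'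
      using weight_family_eigen[OF x(1) that] by (simp add: complex.bracket_scale_right mult.commute)
    have "cb h z = cs (\<beta> h) z" using z h unfolding complex.root_space_def by blast
    moreover have "cb h z = (\<Sum>k\<in>weight_labels. cs (weight_of k h) (x k))"
      unfolding x complex.bracket_sum_right
      by (rule sum.cong) (use weight_family_eigen[OF x(1) _ h] in auto)
    ultimately have "(\<Sum>k\<in>weight_labels. ?y k) = 0"
      by (simp add: x complex.scale_left_diff_distrib sum_subtractf complex.scale_sum_right)
    then have "?y k \<in> {0}"
      by (intro complex.weight_components_in_subspace[where H=HC and w=weight_of and K=weight_labels and x="?y", OF finite_weight_labels _ _ weight_of_distinct y _ k])
        (auto simp: complex.bracket_zero_right)
    then show ?thesis by simp
  qed
  obtain k where k: "k \<in> weight_labels" "x k \<noteq> 0" using x z by (metis sum.neutral)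
  have eq: "\<beta> h = weight_of k h" if "h \<in> HC" for h
    using *[OF that k(1)] k(2) by (simp add: cs_nz)
  have outside: "\<beta> h = 0" if "h \<notin> HC" for h
    using dual that unfolding complex.dual_space_def by blast
  show ?thesis
  proof (cases k)
    case None
    then have "\<beta> = (\<lambda>_. 0)" using eq outside by (auto simp: weight_of_def fun_eq_iff)
    then show ?thesis using nz by simp
  next
    case (Some a)
    then obtain b r where "k = Some (b, r)" "r \<in> R" using k by (auto simp: weight_labels_def)
    then have "\<beta> = weight b r" using eq outside by (auto simp: weight_of_def weight_def fun_eq_iff)
    then show ?thesis using \<open>r \<in> R\<close> by blast
  qed
qed

text \<open>If \<open>z\<close> normalizes \<open>H \<times> H\<close>, then \<open>[h, z]\<close> lies in \<open>H \<times> H\<close>, and so do its components of nonzero weight;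
  being killed by \<open>H \<times> H\<close> there, they are zero.\<close>

lemma cartan_HC: "complex.cartan_subalgebra HC"
  unfolding complex.cartan_subalgebra_def complex.lie_subalgebra_def
proof (intro conjI ballI)
  show "complex.subspace HC" by (rule subspace_HC)
  show "cb x y \<in> HC" if "x \<in> HC" "y \<in> HC" for x y
    unfolding HC_comm[OF that] by (rule complex.subspace_0[OF subspace_HC])
  have "{cb x y |x y. x \<in> HC \<and> y \<in> HC} \<subseteq> {0}" using HC_comm by auto
  then have "complex.bracket_span HC HC \<subseteq> {0}"
    unfolding complex.bracket_span_def by (rule complex.span_minimal) (rule complex.subspace_single_0)
  moreover have "0 \<in> complex.bracket_span HC HC"
    unfolding complex.bracket_span_def by (rule complex.span_zero)
  ultimately have "complex.lower_central HC 1 = {0}" by auto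
  then show "\<exists>n. complex.lower_central HC n = {0}" by blast
  show "complex.normalizer HC = HC"
  proof
    show "HC \<subseteq> complex.normalizer HC"
      unfolding complex.normalizer_def
    proof (intro subsetI CollectI ballI)
      show "cb x y \<in> HC" if "x \<in> HC" "y \<in> HC" for x y
        unfolding HC_comm[OF that] by (rule complex.subspace_0[OF subspace_HC])
    qed
    show "complex.normalizer HC \<subseteq> HC"
    proof
      fix z assume z: "z \<in> complex.normalizer HC"
      obtain x where x: "weight_family x" "z = (\<Sum>k\<in>weight_labels. x k)" using ex_decomposition by blast
      have zero: "x (Some (b, r)) = 0" if r: "r \<in> R" for b r
      proof -
        let ?k = "Some (b, r)"
        have k: "?k \<in> weight_labels" using r by (simp add: weight_labels_def)
        obtain h where h: "h \<in> HC" "weight b r h \<noteq> 0" using weight_nz[OF r] by blast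
        let ?y = "\<lambda>k. cs (weight_of k h) (x k)"
        have y: "cb h' (?y k) = cs (weight_of k h') (?y k)" if "k \<in> weight_labels" "h' \<in> HC" for k h'
          using weight_family_eigen[OF x(1) that] by (simp add: complex.bracket_scale_right mult.commute)
        have "cb h z = - cb z h" by (rule complex.bracket_swap)
        also have "\<dots> \<in> HC"
          using z h(1) unfolding complex.normalizer_def by (intro complex.subspace_neg[OF subspace_HC]) blast
        also have "cb h z = (\<Sum>k\<in>weight_labels. ?y k)"
          unfolding x complex.bracket_sum_right
          by (rule sum.cong) (use weight_family_eigen[OF x(1) _ h(1)] in auto)
        finally have sum: "(\<Sum>k\<in>weight_labels. ?y k) \<in> HC" .
        have stable: "cb h x \<in> HC" if "h \<in> HC" "x \<in> HC" for h x
          unfolding HC_comm[OF that] by (rule complex.subspace_0[OF subspace_HC])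
        have "?y ?k \<in> HC"
          by (rule complex.weight_components_in_subspace[where H=HC and w=weight_of and K=weight_labels and x="?y",
                OF finite_weight_labels subspace_HC stable weight_of_distinct y sum k])
        then have "cb h (?y ?k) = 0" by (rule HC_comm[OF h(1)])
        then have "cs (weight_of ?k h) (?y ?k) = 0" unfolding y[OF k h(1)] .
        then show ?thesis using h(2) by (simp add: weight_of_def cs_nz)
      qed
      have "(\<Sum>k\<in>Some ` (UNIV \<times> R). x k) = 0" by (rule sum.neutral) (use zero in blast)
      then have "z = x None" unfolding x(2) weight_labels_def using finite_R by (subst sum.insert) auto
      then show "z \<in> HC" using x by (simp add: weight_family_def)
    qed
  qed
qed

lemma root_base: "complex.root_base HC I (\<lambda>i. weight True (\<iota> i))"
  unfolding complex.root_base_def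
proof (intro conjI ballI allI impI)
  show "finite I" by (rule finite_I)
  show "weight True (\<iota> i) \<in> complex.roots HC" if "i \<in> I" for i using that by (intro weight_root simple_R)
next
  fix c i assume *: "\<forall>h\<in>HC. (\<Sum>i\<in>I. c i * weight True (\<iota> i) h) = 0" and i: "i \<in> I"
  have *: "(\<Sum>i\<in>I. c i * Complex 0 (\<rho> (\<iota> i) \<bullet> h)) = 0" if "h \<in> H" for h
    using bspec[OF *, of "(h, 0)"] that subspace_0[OF subspace_H] by (simp add: weight_def)
  have **: "(\<Sum>i\<in>I. f i *\<^sub>R \<rho> (\<iota> i)) = 0" if f: "\<And>h. h \<in> H \<Longrightarrow> (\<Sum>i\<in>I. f i * (\<rho> (\<iota> i) \<bullet> h)) = 0" for f
  proof -
    let ?x = "\<Sum>i\<in>I. f i *\<^sub>R \<rho> (\<iota> i)"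
    have "?x \<in> H" by (intro subspace_sum[OF subspace_H] subspace_scale[OF subspace_H] rho_H simple_R)
    from f[OF this] have "?x \<bullet> ?x = 0" unfolding inner_sum_left[of _ I ?x] by simp
    then show ?thesis by simp
  qed
  have "Re (c i) = 0"
  proof (rule simple_indep[OF ** i])
    fix h assume "h \<in> H" from *[OF this] show "(\<Sum>i\<in>I. Re (c i) * (\<rho> (\<iota> i) \<bullet> h)) = 0"
      by (simp add: complex_eq_iff)
  qed
  moreover have "Im (c i) = 0"
  proof (rule simple_indep[OF ** i])
    fix h assume "h \<in> H" from *[OF this] show "(\<Sum>i\<in>I. Im (c i) * (\<rho> (\<iota> i) \<bullet> h)) = 0"
      by (simp add: complex_eq_iff sum_negf)
  qed
  ultimately show "c i = 0" by (simp add: complex_eq_iff)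
next
  fix \<beta> assume "\<beta> \<in> complex.roots HC"
  then obtain b r where r: "r \<in> R" "\<beta> = weight b r" using root_is_weight by blast
  have *: "weight True r = (\<lambda>h. \<Sum>i\<in>I. of_nat (n r i) * weight True (\<iota> i) h)"
  proof
    fix h
    have "\<rho> r \<bullet> v = (\<Sum>i\<in>I. real (n r i) * (\<rho> (\<iota> i) \<bullet> v))" for v
      by (subst rho_comb[OF r(1)]) (simp add: inner_sum_left)
    then show "weight True r h = (\<Sum>i\<in>I. of_nat (n r i) * weight True (\<iota> i) h)"
      by (cases "h \<in> HC") (simp_all add: weight_def complex_eq_iff sum_negf)
  qed
  have "\<beta> = (\<lambda>h. \<Sum>i\<in>I. of_nat (n r i) * weight True (\<iota> i) h) \<or> \<beta> = (\<lambda>h. - (\<Sum>i\<in>I. of_nat (n r i) * weight True (\<iota> i) h))"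
  proof (cases b)
    case True then show ?thesis unfolding r(2) *[symmetric] by simp
  next
    case False
    then have "\<beta> = (\<lambda>h. - weight True r h)" unfolding r(2) weight_uminus by simp
    then show ?thesis unfolding * by (rule disjI2)
  qed
  then show "\<exists>m :: 'i \<Rightarrow> nat. \<beta> = (\<lambda>h. \<Sum>i\<in>I. of_nat (m i) * weight True (\<iota> i) h) \<or> \<beta> = (\<lambda>h. - (\<Sum>i\<in>I. of_nat (m i) * weight True (\<iota> i) h))"
    by (rule exI[of _ "n r"])
qed

theorem has_cartan_matrix: "complex.has_cartan_matrix I A"
  unfolding complex.has_cartan_matrix_def
proof (rule exI[of _ HC], rule exI[of _ "\<lambda>i. weight True (\<iota> i)"], rule exI[of _ "\<lambda>i. coroot (\<iota> i)"],
    intro conjI ballI)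
  show "complex.cartan_subalgebra HC" by (rule cartan_HC)
  show "complex.root_base HC I (\<lambda>i. weight True (\<iota> i))" by (rule root_base)
  show "complex.is_coroot HC (weight True (\<iota> i)) (coroot (\<iota> i))" if "i \<in> I" for i
    by (rule is_coroot[OF simple_R[OF that]])
  show "weight True (\<iota> j) (coroot (\<iota> i)) = of_int (A i j)" if "i \<in> I" "j \<in> I" for i j
    by (rule weight_coroot[OF that])
qed

lemma not_orthogonal_simple:
  assumes "x \<in> H" "x \<noteq> 0" shows "\<exists>i\<in>I. \<rho> (\<iota> i) \<bullet> x \<noteq> 0"
proof (rule ccontr)
  assume "\<not> ?thesis"
  then have "orthogonal x y" if "y \<in> (\<lambda>i. \<rho> (\<iota> i)) ` I" for y
    using that by (auto simp: orthogonal_def inner_commute[of x])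
  moreover have "x \<in> span ((\<lambda>i. \<rho> (\<iota> i)) ` I)" using H_span assms(1) by blast
  ultimately have "orthogonal x x" by (intro orthogonal_to_span[of x])
  then show False using assms by (simp add: orthogonal_self)
qed

text \<open>A nonzero ideal is the sum of its weight components and contains a root vector. It then contains the
  coroot and all root vectors of roots not orthogonal to it, and connectedness of the Dynkin diagram
  carries this to all simple roots.\<close>

theorem simple_complexification: "simple_lie_algebra cs cb"
proof unfold_locales
  obtain i where i: "i \<in> I" using I_ne by blast
  let ?r = "\<iota> i"
  have "cb (root_vec True ?r) (root_vec False ?r) \<noteq> 0"
    using simple_R[OF i] rho_nz p_nz
    by (simp add: cb_opposite complexified_scale_def zero_prod_def)
  then show "\<exists>x y. cb x y \<noteq> 0" by blast
next
  fix S assume S: "complex.lie_ideal S"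
  then have sub: "complex.subspace S" and br: "\<And>x y. y \<in> S \<Longrightarrow> cb x y \<in> S"
    by (auto simp: complex.lie_ideal_def)
  have br': "cb x y \<in> S" if "x \<in> S" for x y
    using complex.subspace_neg[OF sub br[OF that, of y]] complex.bracket_swap[of x y] by simp
  have scale: "x \<in> S" if "cs c x \<in> S" "c \<noteq> 0" for c x
    using complex.subspace_scale[OF sub that(1), of "inverse c"] that(2) by simp
  \<comment> \<open>One root vector in the ideal puts its coroot into it, and the coroot acts invertibly on every
    root vector whose root is not orthogonal to the given one.\<close>
  have rho: "(0, \<rho> r) \<in> S" if "r \<in> R" "root_vec b r \<in> S" for r b
  proof -
    have "cb (root_vec True r) (root_vec False r) \<in> S" using that br br' by (cases b) auto
    then have "cs (2 * (p r \<bullet> p r)) (0, \<rho> r) \<in> S" using that by (simp add: cb_opposite)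
    then show ?thesis by (rule scale) (use that p_nz in simp)
  qed
  have spread: "root_vec c s \<in> S" if "r \<in> R" "root_vec b r \<in> S" "s \<in> R" "\<rho> r \<bullet> \<rho> s \<noteq> 0" for r b s c
  proof -
    have z: "(0, \<rho> r) \<in> HC" using rho_H that subspace_0[OF subspace_H] by simp
    have "cs (weight c s (0, \<rho> r)) (root_vec c s) \<in> S"
      using br'[OF rho[OF that(1,2)], of "root_vec c s"] cb_root_vec[OF that(3) z] by simp
    then show ?thesis by (rule scale) (use that z in \<open>simp add: weight_def complex_eq_iff inner_commute\<close>)
  qed
  have all: "S = UNIV" if r: "r \<in> R" "root_vec b r \<in> S" for r b
  proof -
    let ?J = "{i \<in> I. root_vec True (\<iota> i) \<in> S}"
    have "?J = I"
    proof (rule ccontr)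
      assume "?J \<noteq> I"
      moreover have "?J \<noteq> {}"
      proof -
        obtain i where i: "i \<in> I" "\<rho> r \<bullet> \<rho> (\<iota> i) \<noteq> 0"
          using not_orthogonal_simple[OF rho_H rho_nz, OF r(1) r(1)] inner_commute by metis
        from spread[OF r simple_R[OF i(1)] i(2)] i(1) show ?thesis by blast
      qed
      moreover have "?J \<subseteq> I" by blast
      ultimately obtain i j where ij: "i \<in> ?J" "j \<in> I - ?J" "A i j \<noteq> 0"
        using connected[of ?J] by blast
      then have I: "i \<in> I" "j \<in> I" "root_vec True (\<iota> i) \<in> S" "root_vec True (\<iota> j) \<notin> S" by blast+
      have "\<rho> (\<iota> i) \<bullet> \<rho> (\<iota> j) \<noteq> 0"
        using cartan_ints[OF I(1,2)] rho_nz[OF simple_R[OF I(1)]] ij(3) by auto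
      from spread[OF simple_R[OF I(1)] I(3) simple_R[OF I(2)] this] I(4) show False by blast
    qed
    then have simple: "root_vec True (\<iota> i) \<in> S" if "i \<in> I" for i using that by blast
    have ES: "root_vec c s \<in> S" if s: "s \<in> R" for c s
    proof -
      obtain i where "i \<in> I" "\<rho> (\<iota> i) \<bullet> \<rho> s \<noteq> 0"
        using not_orthogonal_simple[OF rho_H rho_nz, OF s s] by blast
      then show ?thesis using spread[OF simple_R simple s] by blast
    qed
    have H0: "(x, 0) \<in> S" if "x \<in> H" for x
    proof -
      have "x \<in> span ((\<lambda>i. \<rho> (\<iota> i)) ` I)" using H_span that by blast
      then show ?thesis
      proof (induction rule: span_induct_alt)
        case base show ?case using complex.subspace_0[OF sub] by (simp add: zero_prod_def)
      next
        case (step c x y)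
        then obtain i where i: "i \<in> I" "x = \<rho> (\<iota> i)" by blast
        have "(0, x) \<in> S" unfolding i(2) by (rule rho[OF simple_R simple]) (rule i(1))+
        from complex.subspace_add[OF sub complex.subspace_scale[OF sub this, of "- \<i> * of_real c"] step.IH]
        show ?case by (simp add: complexified_scale_def)
      qed
    qed
    have HS: "z \<in> S" if "z \<in> HC" for z
    proof -
      have "z = (fst z, 0) + cs \<i> (snd z, 0)" by (simp add: complexified_scale_def)
      also have "\<dots> \<in> S"
        using that by (intro complex.subspace_add[OF sub] complex.subspace_scale[OF sub] H0) auto
      finally show ?thesis .
    qed
    have "z \<in> S" for z
    proof -
      obtain x where x: "weight_family x" "z = (\<Sum>k\<in>weight_labels. x k)" using ex_decomposition by blast
      have "x k \<in> S" if k: "k \<in> weight_labels" for k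
      proof (cases k)
        case None then show ?thesis using x HS by (auto simp: weight_family_def)
      next
        case (Some a)
        then obtain b r where "k = Some (b, r)" "r \<in> R" using k by (auto simp: weight_labels_def)
        moreover from this obtain c where "x k = cs c (root_vec b r)" using x by (auto simp: weight_family_def)
        ultimately show ?thesis using complex.subspace_scale[OF sub ES] by simp
      qed
      then show ?thesis unfolding x by (rule complex.subspace_sum[OF sub])
    qed
    then show ?thesis by blast
  qed
  show "S = {0} \<or> S = UNIV"
  proof (cases "S = {0}")
    case False
    then obtain z where z: "z \<in> S" "z \<noteq> 0" using complex.subspace_0[OF sub] by blast
    obtain x where x: "weight_family x" "z = (\<Sum>k\<in>weight_labels. x k)" using ex_decomposition by blast
    have xS: "x k \<in> S" if "k \<in> weight_labels" for k
      by (rule components_in_subspace[OF x(1) sub br z(1)[unfolded x(2)] that])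
    obtain k where k: "k \<in> weight_labels" "x k \<noteq> 0" using x z by (metis sum.neutral)
    show ?thesis
    proof (cases k)
      case None
      then have h: "x None \<in> HC" "x None \<noteq> 0" "x None \<in> S" using k x xS by (auto simp: weight_family_def)
      then have "fst (x None) \<in> H" "snd (x None) \<in> H" "fst (x None) \<noteq> 0 \<or> snd (x None) \<noteq> 0"
        by (auto simp: prod_eq_iff)
      then obtain i where i: "i \<in> I" "\<rho> (\<iota> i) \<bullet> fst (x None) \<noteq> 0 \<or> \<rho> (\<iota> i) \<bullet> snd (x None) \<noteq> 0"
        using not_orthogonal_simple by blast
      then have i: "i \<in> I" "weight True (\<iota> i) (x None) \<noteq> 0"
        using h(1) by (auto simp: weight_def complex_eq_iff)
      have "cs (weight True (\<iota> i) (x None)) (root_vec True (\<iota> i)) \<in> S"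
        using br'[OF h(3), of "root_vec True (\<iota> i)"] cb_root_vec[OF simple_R[OF i(1)] h(1)] by simp
      then have "root_vec True (\<iota> i) \<in> S" using i(2) by (rule scale)
      then show ?thesis using all[OF simple_R[OF i(1)]] by blast
    next
      case (Some a)
      then obtain b r where r: "k = Some (b, r)" "r \<in> R" using k by (auto simp: weight_labels_def)
      then obtain c where c: "x k = cs c (root_vec b r)" using x by (auto simp: weight_family_def)
      have "root_vec b r \<in> S" by (rule scale[of c]) (use xS[OF k(1)] k(2) c in auto)
      then show ?thesis using all[OF r(2)] by blast
    qed
  qed simp
qed

lemma finite_span: "\<exists>B. finite B \<and> complex.span B = UNIV"
proof (intro exI conjI)
  let ?B = "(\<lambda>b. (b, 0)) ` (Basis :: 'a set)"
  show "finite ?B" by simp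
  have "z \<in> complex.span ?B" for z
  proof -
    have "z = (\<Sum>b\<in>Basis. cs (Complex (fst z \<bullet> b) (snd z \<bullet> b)) (b, 0))"
      by (simp add: complexified_scale_def prod_eq_iff fst_sum snd_sum euclidean_representation)
    also have "\<dots> \<in> complex.span ?B"
      by (intro complex.span_sum complex.span_scale complex.span_base) auto
    finally show ?thesis .
  qed
  then show "complex.span ?B = UNIV" by blast
qed

end

section \<open>The space and the generators in coordinates\<close>

lemma UNIV_13: "(UNIV :: 13 set) = {0, 1, 2, 3, 4, 5, 6, 7, 8, 9, 10, 11, 12}"
  by (rule sym, rule card_subset_eq) simp_all

lemma forall_13: "(\<forall>t::13. P t) \<longleftrightarrow> P 0 \<and> P 1 \<and> P 2 \<and> P 3 \<and> P 4 \<and> P 5 \<and> P 6 \<and> P 7 \<and> P 8 \<and> P 9 \<and> P 10 \<and> P 11 \<and> P 12"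
  using UNIV_13 by (metis (mono_tags, lifting) UNIV_I insertE singletonD)

lemma mod_13: "(13::13) = 0" "(14::13) = 1" "(15::13) = 2" "(16::13) = 3" "(17::13) = 4" "(18::13) = 5"
  "(19::13) = 6" "(20::13) = 7" "(21::13) = 8" "(22::13) = 9" "(23::13) = 10" "(24::13) = 11" "(25::13) = 12"
  "(26::13) = 0" "(27::13) = 1" "(30::13) = 4" "(33::13) = 7" "(36::13) = 10" "(28::13) = 2"
  by simp_all

lemma omega_eq: "\<omega> = Complex (-1/2) (sqrt 3 / 2)"
proof -
  have "\<omega> = cis (2 * pi / 3)"
    unfolding \<omega>_def cis_conv_exp by (rule arg_cong[where f=exp]) (simp add: field_simps)
  then show ?thesis by (simp add: complex_eq_iff cos_120 sin_120)
qed

lemma cnj_omega: "cnj \<omega> = - 1 - \<omega>"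
  by (simp add: omega_eq complex_eq_iff)

lemma omega_sq: "\<omega> * \<omega> = - 1 - \<omega>"
  by (simp add: omega_eq complex_eq_iff)

lemma omega_sq': "\<omega> * (\<omega> * x) = - x - \<omega> * x"
  by (simp add: omega_sq left_diff_distrib flip: mult.assoc)

lemma theta_eq: "\<theta> = 1 + 2 * \<omega>"
  by (simp add: \<theta>_def cnj_omega)

text \<open>Rewriting with these equations brings polynomials in \<open>\<omega>\<close> to the form \<open>p + q * \<omega>\<close>, in which
  identities between cube roots of unity become linear arithmetic.\<close>

lemmas omega_simps = theta_eq cnj_omega omega_sq omega_sq'

lemma complex_omega_basis: "\<exists>p q :: real. z = of_real p + of_real q * \<omega>"
  by (rule exI[of _ "Re z + Im z / sqrt 3"], rule exI[of _ "2 * Im z / sqrt 3"])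
    (simp add: omega_eq complex_eq_iff)

lemma vec3_eq_iff: "(v :: complex ^ 3) = w \<longleftrightarrow> v $ 1 = w $ 1 \<and> v $ 2 = w $ 2 \<and> v $ 3 = w $ 3"
  by (simp add: vec_eq_iff forall_3)

lemma vec3_collapse: "vec3 (v $ 1) (v $ 2) (v $ 3) = v"
  by (simp add: vec3_eq_iff)

lemma vec3_algebra:
  "vec3 a b c + vec3 x y z = vec3 (a + x) (b + y) (c + z)"
  "vec3 a b c - vec3 x y z = vec3 (a - x) (b - y) (c - z)"
  "- vec3 x y z = vec3 (- x) (- y) (- z)"
  "r *\<^sub>R vec3 x y z = vec3 (r *\<^sub>R x) (r *\<^sub>R y) (r *\<^sub>R z)"
  "l *s vec3 x y z = vec3 (l * x) (l * y) (l * z)"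
  "cnj_vec (vec3 x y z) = vec3 (cnj x) (cnj y) (cnj z)"
  "(0 :: complex ^ 3) = vec3 0 0 0"
  by (simp_all add: vec3_eq_iff cnj_vec_def)

lemma vec3_inner: "vec3 a b c \<bullet> vec3 x y z = Re (a * cnj x + b * cnj y + c * cnj z)"
  by (simp add: inner_vec_def sum_3 inner_complex_def)

lemma axis_algebra:
  fixes v w :: "complex ^ 3"
  shows "axis t v + axis t w = axis t (v + w)" "axis t v - axis t w = axis t (v - w)"
    "- axis t v = axis t (- v)" "r *\<^sub>R axis t v = axis t (r *\<^sub>R v)" "axis t 0 = 0"
  by (simp_all add: vec_eq_iff axis_def)

lemma sum_delta_13: "(\<Sum>t\<in>(UNIV :: 13 set). if s = t then f t else (0 :: 'a::comm_monoid_add)) = f s"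
  unfolding sum.delta'[OF finite_class.finite_UNIV] by (rule if_P) (rule UNIV_I)

lemma axis_sum: "(u :: V78) = (\<Sum>t\<in>UNIV. axis t (u $ t))"
proof (rule vec_eq_iff[THEN iffD2], rule allI)
  fix s :: 13
  have "(\<Sum>t\<in>UNIV. axis t (u $ t)) $ s = (\<Sum>t\<in>UNIV. axis t (u $ t) $ s)"
    by (rule sum_component)
  also have "\<dots> = (\<Sum>t\<in>UNIV. if s = t then u $ t else 0)"
    by (simp only: axis_def vec_lambda_beta)
  also have "\<dots> = u $ s" by (rule sum_delta_13)
  finally show "u $ s = (\<Sum>t\<in>UNIV. axis t (u $ t)) $ s" by (rule sym)
qed

lemma axis_nth: "axis t v $ s = (if t = s then v else 0)"
  by (simp only: axis_def vec_lambda_beta eq_commute[of s t])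

lemma from_summands_axis:
  assumes "\<And>s. F s 0 = 0" shows "from_summands F (axis t v) = F t v"
proof -
  have "F s (axis t v $ s) = (if t = s then F s v else 0)" for s
    using assms by (cases "t = s") (simp_all add: axis_nth)
  then show ?thesis by (simp only: from_summands_def sum_delta_13)
qed

lemma linear_from_summands:
  assumes "\<And>t. linear (F t)" shows "linear (from_summands F)"
  by (rule linearI)
    (simp_all add: from_summands_def linear_add[OF assms] linear_scale[OF assms] sum.distrib scaleR_sum_right)

lemma gen_a_axis: "gen_a (axis t v) = axis (t + 1) v"
  unfolding gen_a_def by (rule from_summands_axis) (simp add: axis_algebra(5))

lemma vec3_0: "vec3 0 0 0 = 0"
  by (simp add: vec3_eq_iff)

lemma gen_b_axis: "gen_b (axis t (vec3 x y z)) = axis (3 * t) (vec3 (\<omega> * x) (\<omega>' * y) (\<omega>' * z))"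
  unfolding gen_b_def by (subst from_summands_axis) (simp_all add: vec3_0 axis_algebra(5))

lemma gen_d_axis: "gen_d (axis t v) = axis t (delta t *s v)"
  unfolding gen_d_def by (subst from_summands_axis) (simp_all add: axis_algebra(5))

lemma linear_axis: "linear f \<Longrightarrow> linear (\<lambda>v :: complex ^ 3. axis t (f v :: complex ^ 3))"
  by (rule linearI) (simp_all add: linear_add linear_scale axis_algebra)

lemma linear_cnj_vec: "linear cnj_vec"
  by (rule linearI) (simp_all add: vec3_eq_iff cnj_vec_def)

lemma linear_vmult: "linear (\<lambda>v :: complex ^ 3. v v* (M :: complex ^ 3 ^ 3))"
  by (rule linearI) (simp_all add: vec3_eq_iff vector_matrix_mult_def sum_3 algebra_simps)

lemma linear_cnj_vmult: "linear (\<lambda>v. cnj_vec v v* (M :: complex ^ 3 ^ 3))"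
  using linear_compose[OF linear_cnj_vec linear_vmult] by (simp add: o_def)

lemma linear_gen_a: "linear gen_a"
  unfolding gen_a_def by (intro linear_from_summands linear_axis linear_id[unfolded id_def])

lemma linear_gen_b: "linear gen_b"
  unfolding gen_b_def
  by (rule linear_from_summands, rule linear_axis, rule linearI) (simp_all add: vec3_eq_iff algebra_simps)

lemma linear_gen_d: "linear gen_d"
  unfolding gen_d_def
  by (rule linear_from_summands, rule linear_axis, rule linearI) (simp_all add: vec3_eq_iff algebra_simps)

lemma linear_gen_e: "linear gen_e"
  unfolding gen_e_def Let_def
  by (rule linear_from_summands, rule linear_axis, rule linearI) (auto simp: vec3_eq_iff algebra_simps)

lemma linear_if: "(b \<Longrightarrow> linear f) \<Longrightarrow> (\<not> b \<Longrightarrow> linear g) \<Longrightarrow> linear (\<lambda>v. if b then f v else g v)"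
  by (cases b) simp_all

lemma linear_gen_c: "linear gen_c"
  unfolding gen_c_def Let_def
  by (rule linear_from_summands)
    (intro linear_if linear_compose_neg linear_axis linear_cnj_vec linear_cnj_vmult;
      rule linearI; simp add: vec3_eq_iff algebra_simps)

lemma vec3_mult: "vec3 x y z v* theta_third_matrix (vec3 a b c) (vec3 d e f) (vec3 g h i) =
    vec3 (\<theta> / 3 * (a * x + d * y + g * z)) (\<theta> / 3 * (b * x + e * y + h * z)) (\<theta> / 3 * (c * x + f * y + i * z))"
  by (simp add: vec3_eq_iff theta_third_matrix_def vector_matrix_mult_def sum_3 algebra_simps)

lemma transpose_theta_third: "transpose (theta_third_matrix (vec3 a b c) (vec3 d e f) (vec3 g h i)) =
    theta_third_matrix (vec3 a d g) (vec3 b e h) (vec3 c f i)"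
  by (simp add: vec_eq_iff forall_3 transpose_def theta_third_matrix_def)

lemma gen_c_axis_raw: "gen_c (axis t v) = (let x = v $ 1; y = v $ 2; z = v $ 3 in
     if t = 0 then - axis 0 (vec3 (cnj x) (cnj z) (cnj y))
     else if t = 1 then - axis 1 (vec3 x z y)
     else if t = 3 then - axis 9 (vec3 (\<omega> * x) (\<omega>' * z) (\<omega>' * y))
     else if t = 9 then - axis 3 (vec3 (\<omega>' * x) (\<omega> * z) (\<omega> * y))
     else if t = 4 then axis 10 (cnj_vec v)
     else if t = 10 then axis 4 (cnj_vec v)
     else if t = 12 then axis 12 (cnj_vec v)
     else if t = 2 then axis 2 (cnj_vec v v* M1)
     else if t = 8 then axis 8 (cnj_vec v v* M2)
     else if t = 5 then axis 6 (cnj_vec v v* M3)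
     else if t = 6 then axis 5 (cnj_vec v v* transpose M3)
     else if t = 7 then axis 11 (cnj_vec v v* M4)
     else axis 7 (cnj_vec v v* transpose M4))"
  unfolding gen_c_def
  by (subst from_summands_axis)
    (simp_all add: Let_def vec3_0 axis_algebra(5) linear_0[OF linear_cnj_vec] linear_0[OF linear_cnj_vmult])

lemma gen_c_axis:
  "gen_c (axis 0 (vec3 x y z)) = axis 0 (vec3 (- cnj x) (- cnj z) (- cnj y))"
  "gen_c (axis 1 (vec3 x y z)) = axis 1 (vec3 (- x) (- z) (- y))"
  "gen_c (axis 3 (vec3 x y z)) = axis 9 (vec3 (- \<omega> * x) (- \<omega>' * z) (- \<omega>' * y))"
  "gen_c (axis 9 (vec3 x y z)) = axis 3 (vec3 (- \<omega>' * x) (- \<omega> * z) (- \<omega> * y))"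
  "gen_c (axis 4 (vec3 x y z)) = axis 10 (vec3 (cnj x) (cnj y) (cnj z))"
  "gen_c (axis 10 (vec3 x y z)) = axis 4 (vec3 (cnj x) (cnj y) (cnj z))"
  "gen_c (axis 12 (vec3 x y z)) = axis 12 (vec3 (cnj x) (cnj y) (cnj z))"
  "gen_c (axis 2 (vec3 x y z)) = axis 2 (vec3 (cnj x) (cnj y) (cnj z) v* M1)"
  "gen_c (axis 8 (vec3 x y z)) = axis 8 (vec3 (cnj x) (cnj y) (cnj z) v* M2)"
  "gen_c (axis 5 (vec3 x y z)) = axis 6 (vec3 (cnj x) (cnj y) (cnj z) v* M3)"
  "gen_c (axis 6 (vec3 x y z)) = axis 5 (vec3 (cnj x) (cnj y) (cnj z) v* transpose M3)"
  "gen_c (axis 7 (vec3 x y z)) = axis 11 (vec3 (cnj x) (cnj y) (cnj z) v* M4)"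
  "gen_c (axis 11 (vec3 x y z)) = axis 7 (vec3 (cnj x) (cnj y) (cnj z) v* transpose M4)"
  by (simp_all add: gen_c_axis_raw Let_def axis_algebra(3) vec3_algebra(3,6))

lemmas M_mult = M1_def M2_def M3_def M4_def transpose_theta_third vec3_mult

lemma gen_e_axis_raw: "gen_e (axis t v) = (let x = v $ 1; y = v $ 2; z = v $ 3 in
     axis t
      (if t = 0 then vec3 x y z
       else if t \<in> {1, 11} then vec3 z x y
       else if t = 2 then vec3 (\<omega>' * y) z (\<omega> * x)
       else if t \<in> {3, 7} then vec3 (\<omega>' * z) (\<omega> * x) y
       else if t \<in> {4, 10, 12} then vec3 x (\<omega> * y) (\<omega>' * z)
       else if t = 5 then vec3 y z x
       else if t = 6 then vec3 (\<omega> * y) z (\<omega>' * x)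
       else vec3 (\<omega> * z) (\<omega>' * x) y))"
  unfolding gen_e_def
  by (subst from_summands_axis)
    (simp_all add: Let_def vec3_0 axis_algebra(5))

section \<open>Frames adapted to the lines\<close>

text \<open>The coefficients of \<open>x\<close>, \<open>y\<close>, \<open>z\<close> are three orthogonal vectors of squared norm 3 in the summand at the
  point \<open>i\<close> of the line \<open>{0, 1, 3, 9}\<close>. The first vectors at the four points together span one copy
  of \<open>su(3)\<close>, and so do the second and the third ones.\<close>

definition frame :: "13 \<Rightarrow> complex \<Rightarrow> complex \<Rightarrow> complex \<Rightarrow> complex ^ 3" where
  "frame i x y z =
    (if i = 0 then vec3 (\<theta> * x) (\<theta> * y) (\<theta> * z)
     else if i = 1 then vec3 (x + \<omega>' * y + \<omega>' * z) (x + y + \<omega> * z) (x + \<omega> * y + z)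
     else if i = 3 then vec3 (\<omega>' * (x + y + z)) (x + \<omega> * y + \<omega>' * z) (x + \<omega>' * y + \<omega> * z)
     else vec3 (x + y + z) (\<omega>' * x + y + \<omega> * z) (\<omega>' * x + \<omega> * y + z))"

definition line_vec :: "13 \<Rightarrow> 13 \<Rightarrow> complex \<Rightarrow> complex \<Rightarrow> complex \<Rightarrow> V78" where
  "line_vec i k x y z = axis (k + i) (frame i x y z)"

lemma line_vec_zero: "line_vec i k 0 0 0 = 0"
  by (auto simp: line_vec_def frame_def vec3_0 axis_algebra(5))

lemma line_vec_add: "line_vec i k x1 x2 x3 + line_vec i k y1 y2 y3 = line_vec i k (x1 + y1) (x2 + y2) (x3 + y3)"
  by (auto simp: line_vec_def frame_def axis_algebra vec3_algebra algebra_simps)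

lemma line_vec_minus: "- line_vec i k x1 x2 x3 = line_vec i k (- x1) (- x2) (- x3)"
  by (auto simp: line_vec_def frame_def axis_algebra vec3_algebra algebra_simps)

lemma line_vec_scaleR: "r *\<^sub>R line_vec i k x1 x2 x3 = line_vec i k (of_real r * x1) (of_real r * x2) (of_real r * x3)"
  by (auto simp: line_vec_def frame_def axis_algebra vec3_algebra scaleR_conv_of_real[where 'a=complex] algebra_simps)

lemma V78_eqI: "(\<And>t. u $ t = v $ t) \<Longrightarrow> u = (v :: V78)"
  by (simp add: vec_eq_iff)

text \<open>The map \<open>frame_rotation\<close> permutes the three copies of \<open>su(3)\<close> cyclically; \<open>twist\<close> multiplies \<open>V\<^sub>0\<close> by \<open>\<omega>\<close>
  and fixes \<open>V\<^sub>1\<close>; the words \<open>shifted_c m n\<close> used below preserve the line \<open>{0, 1, 3, 9}\<close>.\<close>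

definition "frame_rotation = (gen_a ^^ 12) \<circ> gen_e \<circ> gen_a"
definition "shifted_c m n = (gen_a ^^ n) \<circ> gen_c \<circ> (gen_a ^^ m)"
definition "twist = (gen_a ^^ 2) \<circ> gen_d \<circ> (gen_a ^^ 11)"

lemma gen_a_pow: "(gen_a ^^ n) (axis t v) = axis (t + of_nat n) v"
  by (induction n) (simp_all add: gen_a_axis algebra_simps)

lemma axis_eqI: "s = t \<Longrightarrow> v = w \<Longrightarrow> axis s v = axis t w"
  by simp

lemma frame_rotation_line_vec: 
  "frame_rotation (line_vec 0 0 x y z) = line_vec 0 0 z x y" "frame_rotation (line_vec 1 0 x y z) = line_vec 1 0 z x y"
  "frame_rotation (line_vec 3 0 x y z) = line_vec 3 0 z x y" "frame_rotation (line_vec 9 0 x y z) = line_vec 9 0 z x y"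
  by (simp_all add: frame_rotation_def line_vec_def frame_def gen_a_axis gen_a_pow gen_e_axis_raw mod_13 Let_def)
    (intro axis_eqI; simp add: vec3_eq_iff omega_simps algebra_simps)+

text \<open>An automorphism that preserves the line permutes the three copies of \<open>su(3)\<close> on it. In the adapted
  frames it is therefore monomial, although the matrices of \<open>gen_c\<close> are not.\<close>

lemma shifted_c_line_vec:
  "shifted_c 5 8 (line_vec 0 0 x y z) = line_vec 1 0 (\<omega> * cnj x) (cnj z) (cnj y)"
  "shifted_c 5 8 (line_vec 1 0 x y z) = line_vec 0 0 (\<omega> * cnj x) (cnj z) (cnj y)"
  "shifted_c 5 8 (line_vec 3 0 x y z) = line_vec 3 0 (\<omega>' * cnj x) (cnj z) (cnj y)"
  "shifted_c 5 8 (line_vec 9 0 x y z) = line_vec 9 0 (- x) (- z) (- y)"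
  "shifted_c 6 11 (line_vec 0 0 x y z) = line_vec 3 0 (\<omega>' * cnj x) (\<omega>' * cnj z) (\<omega>' * cnj y)"
  "shifted_c 6 11 (line_vec 1 0 x y z) = line_vec 9 0 (cnj x) (\<omega>' * cnj z) (\<omega>' * cnj y)"
  "shifted_c 6 11 (line_vec 3 0 x y z) = line_vec 1 0 (- \<omega> * x) (- \<omega>' * z) (- \<omega>' * y)"
  "shifted_c 6 11 (line_vec 9 0 x y z) = line_vec 0 0 (\<omega> * cnj x) (cnj z) (cnj y)"
  "shifted_c 2 7 (line_vec 0 0 x y z) = line_vec 9 0 (\<omega> * cnj x) (cnj z) (cnj y)"
  "shifted_c 2 7 (line_vec 1 0 x y z) = line_vec 3 0 (- \<omega>' * x) (- \<omega> * z) (- \<omega> * y)"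
  "shifted_c 2 7 (line_vec 3 0 x y z) = line_vec 0 0 (\<omega>' * cnj x) (\<omega>' * cnj z) (\<omega>' * cnj y)"
  "shifted_c 2 7 (line_vec 9 0 x y z) = line_vec 1 0 (cnj x) (\<omega>' * cnj z) (\<omega>' * cnj y)"
  by (simp_all add: shifted_c_def line_vec_def frame_def gen_a_pow mod_13 gen_c_axis M_mult)
    (intro axis_eqI; simp add: vec3_eq_iff omega_simps field_simps)+

lemma gen_b_line_vec:
  "gen_b (line_vec 0 0 x y z) = line_vec 0 0 (\<omega> * x) (\<omega>' * y) (\<omega>' * z)"
  "gen_b (line_vec 1 0 x y z) = line_vec 3 0 (\<omega>' * x) (\<omega> * y) (\<omega> * z)"
  "gen_b (line_vec 3 0 x y z) = line_vec 9 0 x y z"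
  "gen_b (line_vec 9 0 x y z) = line_vec 1 0 (\<omega> * x) (\<omega>' * y) (\<omega>' * z)"
  by (simp_all add: line_vec_def frame_def gen_b_axis mod_13)
    (intro axis_eqI; simp add: vec3_eq_iff omega_simps algebra_simps)+

lemma gen_a_line_vec: "(gen_a ^^ n) (line_vec i 0 x y z) = line_vec i (of_nat n) x y z"
  by (simp add: line_vec_def gen_a_pow add.commute)

lemma ex_of_nat_13: "\<exists>n. k = (of_nat n :: 13)"
proof -
  have "\<forall>k::13. k = of_nat 0 \<or> k = of_nat 1 \<or> k = of_nat 2 \<or> k = of_nat 3 \<or> k = of_nat 4 \<or> k = of_nat 5 \<or> k = of_nat 6 \<or> k = of_nat 7 \<or> k = of_nat 8 \<or> k = of_nat 9 \<or> k = of_nat 10 \<or> k = of_nat 11 \<or> k = of_nat 12"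
    unfolding forall_13 by simp
  then show ?thesis by blast
qed

lemma omega_ne_1: "\<omega> \<noteq> 1" "cnj \<omega> \<noteq> 1"
  by (simp_all add: omega_eq complex_eq_iff)

lemma theta_nz: "\<theta> \<noteq> 0"
  by (simp add: theta_eq omega_eq complex_eq_iff)

section \<open>The product on a line\<close>

locale G_product =
  fixes br :: "V78 \<Rightarrow> V78 \<Rightarrow> V78"
  assumes bilinear_br: "bilinear br"
    and G_invariant: "G_invariant br"
    and br_value: "br (axis 0 (vec3 1 0 0)) (axis 1 (vec3 1 0 0)) = axis 3 (vec3 \<omega>' 1 1) - axis 9 (vec3 1 \<omega>' \<omega>')"
begin

lemmas br_simps = bilinear_ladd[OF bilinear_br] bilinear_radd[OF bilinear_br]
  bilinear_lmul[OF bilinear_br] bilinear_rmul[OF bilinear_br]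
  bilinear_lneg[OF bilinear_br] bilinear_rneg[OF bilinear_br]
  bilinear_lsub[OF bilinear_br] bilinear_rsub[OF bilinear_br]
  bilinear_lzero[OF bilinear_br] bilinear_rzero[OF bilinear_br]

definition automorphism :: "(V78 \<Rightarrow> V78) \<Rightarrow> bool" where
  "automorphism g \<longleftrightarrow> linear g \<and> (\<forall>u v. br (g u) (g v) = g (br u v))"

lemma automorphism_br: "automorphism g \<Longrightarrow> br (g u) (g v) = g (br u v)"
  and automorphism_linear: "automorphism g \<Longrightarrow> linear g"
  by (simp_all add: automorphism_def)

lemma automorphism_gens: "automorphism gen_a" "automorphism gen_b" "automorphism gen_c" "automorphism gen_d" "automorphism gen_e"
  using G_invariant linear_gen_a linear_gen_b linear_gen_c linear_gen_d linear_gen_e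
  by (auto simp: automorphism_def G_invariant_def group_G_def intro!: generate.incl)

lemma automorphism_comp: "automorphism f \<Longrightarrow> automorphism g \<Longrightarrow> automorphism (f \<circ> g)"
  by (simp add: automorphism_def linear_compose)

lemma automorphism_pow: "automorphism f \<Longrightarrow> automorphism (f ^^ n)"
  by (induction n) (simp_all add: automorphism_comp, simp add: automorphism_def linear_id)

lemma automorphism_words: "automorphism frame_rotation" "automorphism (shifted_c m n)" "automorphism twist"
  unfolding frame_rotation_def shifted_c_def twist_def by (intro automorphism_comp automorphism_pow automorphism_gens)+

text \<open>Since \<open>twist\<close> multiplies \<open>V\<^sub>0\<close> by \<open>\<omega>\<close> and fixes \<open>V\<^sub>1\<close>, while \<open>gen_d\<close> does the converse, the given value
  determines the products of \<open>\<omega>\<close>-multiples; and \<open>1\<close>, \<open>\<omega>\<close> form a real basis of \<open>\<complex>\<close>.\<close>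

lemma br_01_e1_e1:
  "br (axis 0 (vec3 x 0 0)) (axis 1 (vec3 y 0 0)) =
    axis 3 (vec3 (\<omega>' * x * y) (x * y) (x * y)) + axis 9 (vec3 (- cnj x * y) (- \<omega>' * cnj x * y) (- \<omega>' * cnj x * y))"
proof -
  let ?A = "\<lambda>x. axis 0 (vec3 x 0 0) :: V78" and ?B = "\<lambda>y. axis 1 (vec3 y 0 0) :: V78"
  have t: "twist (?A x) = ?A (\<omega> * x)" "twist (?B y) = ?B y" for x y
    by (simp_all add: twist_def gen_a_pow gen_d_axis mod_13 delta_def vec3_algebra)
  have d: "gen_d (?A x) = ?A x" "gen_d (?B y) = ?B (\<omega> * y)" for x y
    by (simp_all add: gen_d_axis delta_def vec3_algebra)
  note lin = linear_diff[OF automorphism_linear[OF automorphism_words(3)]] linear_diff[OF automorphism_linear[OF automorphism_gens(4)]]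
  have 1: "br (?A \<omega>) (?B 1) = axis 3 (vec3 (\<omega> * \<omega>') \<omega> \<omega>) - axis 9 (vec3 \<omega>' (\<omega>' * \<omega>') (\<omega>' * \<omega>'))"
    using automorphism_br[OF automorphism_words(3), of "?A 1" "?B 1"] unfolding t br_value lin
    by (simp add: twist_def gen_a_pow gen_d_axis mod_13 delta_def vec3_algebra)
  have 2: "br (?A 1) (?B \<omega>) = axis 3 (vec3 (\<omega> * \<omega>') \<omega> \<omega>) - axis 9 (vec3 \<omega> (\<omega> * \<omega>') (\<omega> * \<omega>'))"
    using automorphism_br[OF automorphism_gens(4), of "?A 1" "?B 1"] unfolding d br_value lin
    by (simp add: gen_d_axis delta_def vec3_algebra)
  have 3: "br (?A \<omega>) (?B \<omega>) = axis 3 (vec3 (\<omega> * (\<omega> * \<omega>')) (\<omega> * \<omega>) (\<omega> * \<omega>)) - axis 9 (vec3 (\<omega> * \<omega>') (\<omega> * (\<omega>' * \<omega>')) (\<omega> * (\<omega>' * \<omega>')))"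
    using automorphism_br[OF automorphism_gens(4), of "?A \<omega>" "?B 1"] unfolding d 1 lin
    by (simp add: gen_d_axis delta_def vec3_algebra)
  obtain p q where x: "x = of_real p + of_real q * \<omega>" using complex_omega_basis by blast
  obtain r s where y: "y = of_real r + of_real s * \<omega>" using complex_omega_basis by blast
  have "?A x = p *\<^sub>R ?A 1 + q *\<^sub>R ?A \<omega>" "?B y = r *\<^sub>R ?B 1 + s *\<^sub>R ?B \<omega>"
    by (simp_all add: x y axis_algebra vec3_algebra scaleR_conv_of_real[where 'a=complex])
  then have "br (?A x) (?B y) = (p * r) *\<^sub>R br (?A 1) (?B 1) + (p * s) *\<^sub>R br (?A 1) (?B \<omega>)
    + (q * r) *\<^sub>R br (?A \<omega>) (?B 1) + (q * s) *\<^sub>R br (?A \<omega>) (?B \<omega>)"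
    by (simp add: br_simps algebra_simps)
  then show ?thesis unfolding 1 2 3 br_value
    by (intro V78_eqI, simp add: axis_nth)
      (auto simp: x y vec3_eq_iff omega_simps scaleR_conv_of_real[where 'a=complex] algebra_simps)
qed

text \<open>The map \<open>gen_e\<close> fixes \<open>V\<^sub>0\<close> pointwise, permutes the coordinates of \<open>V\<^sub>1\<close> cyclically and fixes the values
  found in the previous lemma.\<close>

lemma br_01_e1:
  "br (axis 0 (vec3 x 0 0)) (axis 1 (vec3 y1 y2 y3)) =
    axis 3 (vec3 (\<omega>' * x * (y1 + y2 + y3)) (x * (y1 + y2 + y3)) (x * (y1 + y2 + y3)))
    + axis 9 (vec3 (- cnj x * (y1 + y2 + y3)) (- \<omega>' * cnj x * (y1 + y2 + y3)) (- \<omega>' * cnj x * (y1 + y2 + y3)))"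
proof -
  let ?A = "axis 0 (vec3 x 0 0) :: V78" and ?B = "\<lambda>y. axis 1 (vec3 y 0 0) :: V78"
  have e: "gen_e ?A = ?A" "gen_e (axis 3 (vec3 (\<omega>' * x * y) (x * y) (x * y))) = axis 3 (vec3 (\<omega>' * x * y) (x * y) (x * y))"
    "gen_e (axis 9 (vec3 (- cnj x * y) (- \<omega>' * cnj x * y) (- \<omega>' * cnj x * y))) =
      axis 9 (vec3 (- cnj x * y) (- \<omega>' * cnj x * y) (- \<omega>' * cnj x * y))"
    "axis 1 (vec3 y1 y2 y3) = ?B y1 + gen_e (?B y2) + gen_e (gen_e (?B y3))" for y
    by (simp_all add: gen_e_axis_raw Let_def vec3_eq_iff axis_algebra vec3_algebra)
      (simp_all add: omega_simps algebra_simps)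
  note lin = linear_add[OF automorphism_linear[OF automorphism_gens(5)]]
  have 1: "br ?A (gen_e (?B y)) = br ?A (?B y)" for y
    using automorphism_br[OF automorphism_gens(5), of ?A "?B y"] unfolding e(1) br_01_e1_e1 lin e(2,3) .
  have 2: "br ?A (gen_e (gen_e (?B y))) = br ?A (?B y)" for y
    using automorphism_br[OF automorphism_gens(5), of ?A "gen_e (?B y)"] unfolding e(1) 1 br_01_e1_e1 lin e(2,3) .
  show ?thesis unfolding e(4) br_simps 1 2 br_01_e1_e1
    by (intro V78_eqI, simp add: axis_nth) (auto simp: vec3_eq_iff algebra_simps)
qed

lemma br_01_first: "br (line_vec 0 0 x 0 0) (line_vec 1 0 y1 y2 y3) = line_vec 3 0 (3 * \<theta> * x * y1) 0 0 + line_vec 9 0 (3 * \<theta> * cnj x * y1) 0 0"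
  unfolding line_vec_def frame_def
  by (simp add: br_01_e1, intro arg_cong2[where f="(+)"] axis_eqI)
    (simp_all add: vec3_eq_iff omega_simps algebra_simps)

lemma br_01_base:
  "br (line_vec 0 0 x1 x2 x3) (line_vec 1 0 y1 y2 y3) = line_vec 3 0 (3 * \<theta> * x1 * y1) (3 * \<theta> * x2 * y2) (3 * \<theta> * x3 * y3)
    + line_vec 9 0 (3 * \<theta> * cnj x1 * y1) (3 * \<theta> * cnj x2 * y2) (3 * \<theta> * cnj x3 * y3)"
proof -
  note lin = linear_add[OF automorphism_linear[OF automorphism_words(1)]]
  have 1: "br (line_vec 0 0 0 x 0) (line_vec 1 0 y1 y2 y3) = line_vec 3 0 0 (3 * \<theta> * x * y2) 0 + line_vec 9 0 0 (3 * \<theta> * cnj x * y2) 0" for x y1 y2 y3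
    using automorphism_br[OF automorphism_words(1), of "line_vec 0 0 x 0 0" "line_vec 1 0 y2 y3 y1"]
    unfolding br_01_first lin frame_rotation_line_vec .
  have 2: "br (line_vec 0 0 0 0 x) (line_vec 1 0 y1 y2 y3) = line_vec 3 0 0 0 (3 * \<theta> * x * y3) + line_vec 9 0 0 0 (3 * \<theta> * cnj x * y3)" for x y1 y2 y3
    using automorphism_br[OF automorphism_words(1), of "line_vec 0 0 0 x 0" "line_vec 1 0 y2 y3 y1"]
    unfolding 1 lin frame_rotation_line_vec .
  have s: "line_vec 0 0 x1 x2 x3 = line_vec 0 0 x1 0 0 + line_vec 0 0 0 x2 0 + line_vec 0 0 0 0 x3" by (simp add: line_vec_add)
  have r: "(a + b) + (c + d) + (e + f) = (a + c + e) + (b + d + f)" for a b c d e f :: V78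
    by (simp add: algebra_simps)
  show ?thesis unfolding s br_simps br_01_first 1 2 r by (simp add: line_vec_add)
qed

text \<open>The map \<open>shifted_c 5 8\<close> interchanges the points 0 and 1. In the same way \<open>shifted_c 6 11\<close> and
  \<open>shifted_c 2 7\<close> move the pair \<open>(0, 1)\<close> to \<open>(3, 9)\<close> and \<open>(9, 3)\<close>. From these, \<open>gen_b\<close>, which permutes 1, 3, 9
  cyclically, reaches all twelve ordered pairs.\<close>

lemma br_10_base:
  "br (line_vec 1 0 x1 x2 x3) (line_vec 0 0 y1 y2 y3) = line_vec 3 0 (- (3 * \<theta> * x1 * y1)) (- (3 * \<theta> * x2 * y2)) (- (3 * \<theta> * x3 * y3))
    + line_vec 9 0 (- (3 * \<theta> * x1 * cnj y1)) (- (3 * \<theta> * x2 * cnj y2)) (- (3 * \<theta> * x3 * cnj y3))"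
  using automorphism_br[OF automorphism_words(2)[of 5 8], of "line_vec 0 0 (\<omega> * cnj x1) (cnj x3) (cnj x2)" "line_vec 1 0 (\<omega> * cnj y1) (cnj y3) (cnj y2)"]
  unfolding br_01_base linear_add[OF automorphism_linear[OF automorphism_words(2)]] shifted_c_line_vec
  by (simp add: omega_simps algebra_simps)

lemma br_39_base:
  "br (line_vec 3 0 x1 x2 x3) (line_vec 9 0 y1 y2 y3) =
    line_vec 0 0 (- (3 * \<theta> * cnj x1 * y1)) (- (3 * \<theta> * cnj x2 * y2)) (- (3 * \<theta> * cnj x3 * y3)) + line_vec 1 0 (- (3 * \<theta> * cnj x1 * cnj y1)) (- (3 * \<theta> * cnj x2 * cnj y2)) (- (3 * \<theta> * cnj x3 * cnj y3))"
  using automorphism_br[OF automorphism_words(2)[of 6 11], of "line_vec 0 0 (cnj (\<omega> * x1)) (cnj (\<omega> * x3)) (cnj (\<omega> * x2))" "line_vec 1 0 (cnj y1) (cnj (\<omega> * y3)) (cnj (\<omega> * y2))"]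
  unfolding br_01_base linear_add[OF automorphism_linear[OF automorphism_words(2)]] shifted_c_line_vec
  by (simp add: omega_simps algebra_simps)

lemma br_93_base:
  "br (line_vec 9 0 x1 x2 x3) (line_vec 3 0 y1 y2 y3) =
    line_vec 0 0 ((3 * \<theta> * x1 * cnj y1)) ((3 * \<theta> * x2 * cnj y2)) ((3 * \<theta> * x3 * cnj y3)) + line_vec 1 0 ((3 * \<theta> * cnj x1 * cnj y1)) ((3 * \<theta> * cnj x2 * cnj y2)) ((3 * \<theta> * cnj x3 * cnj y3))"
  using automorphism_br[OF automorphism_words(2)[of 2 7], of "line_vec 0 0 (cnj (\<omega>' * x1)) (cnj x3) (cnj x2)" "line_vec 1 0 (- \<omega> * y1) (- \<omega>' * y3) (- \<omega>' * y2)"]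
  unfolding br_01_base linear_add[OF automorphism_linear[OF automorphism_words(2)]] shifted_c_line_vec
  by (simp add: omega_simps algebra_simps)

lemma br_03_base:
  "br (line_vec 0 0 x1 x2 x3) (line_vec 3 0 y1 y2 y3) =
    line_vec 9 0 ((3 * \<theta> * x1 * y1)) ((3 * \<theta> * x2 * y2)) ((3 * \<theta> * x3 * y3)) + line_vec 1 0 ((3 * \<theta> * cnj x1 * y1)) ((3 * \<theta> * cnj x2 * y2)) ((3 * \<theta> * cnj x3 * y3))"
  using automorphism_br[OF automorphism_gens(2), of "line_vec 0 0 (\<omega>' * x1) (\<omega> * x2) (\<omega> * x3)" "line_vec 1 0 (\<omega> * y1) (\<omega>' * y2) (\<omega>' * y3)"]
  unfolding br_01_base linear_add[OF automorphism_linear[OF automorphism_gens(2)]] gen_b_line_vec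
  by (simp add: omega_simps algebra_simps)

lemma br_09_base:
  "br (line_vec 0 0 x1 x2 x3) (line_vec 9 0 y1 y2 y3) =
    line_vec 1 0 ((3 * \<theta> * x1 * y1)) ((3 * \<theta> * x2 * y2)) ((3 * \<theta> * x3 * y3)) + line_vec 3 0 ((3 * \<theta> * cnj x1 * y1)) ((3 * \<theta> * cnj x2 * y2)) ((3 * \<theta> * cnj x3 * y3))"
  using automorphism_br[OF automorphism_gens(2), of "line_vec 0 0 (\<omega>' * x1) (\<omega> * x2) (\<omega> * x3)" "line_vec 3 0 y1 y2 y3"]
  unfolding br_03_base linear_add[OF automorphism_linear[OF automorphism_gens(2)]] gen_b_line_vec
  by (simp add: omega_simps algebra_simps)

lemma br_30_base:
  "br (line_vec 3 0 x1 x2 x3) (line_vec 0 0 y1 y2 y3) =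
    line_vec 9 0 (- (3 * \<theta> * x1 * y1)) (- (3 * \<theta> * x2 * y2)) (- (3 * \<theta> * x3 * y3)) + line_vec 1 0 (- (3 * \<theta> * x1 * cnj y1)) (- (3 * \<theta> * x2 * cnj y2)) (- (3 * \<theta> * x3 * cnj y3))"
  using automorphism_br[OF automorphism_gens(2), of "line_vec 1 0 (\<omega> * x1) (\<omega>' * x2) (\<omega>' * x3)" "line_vec 0 0 (\<omega>' * y1) (\<omega> * y2) (\<omega> * y3)"]
  unfolding br_10_base linear_add[OF automorphism_linear[OF automorphism_gens(2)]] gen_b_line_vec
  by (simp add: omega_simps algebra_simps)

lemma br_90_base:
  "br (line_vec 9 0 x1 x2 x3) (line_vec 0 0 y1 y2 y3) =
    line_vec 1 0 (- (3 * \<theta> * x1 * y1)) (- (3 * \<theta> * x2 * y2)) (- (3 * \<theta> * x3 * y3)) + line_vec 3 0 (- (3 * \<theta> * x1 * cnj y1)) (- (3 * \<theta> * x2 * cnj y2)) (- (3 * \<theta> * x3 * cnj y3))"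
  using automorphism_br[OF automorphism_gens(2), of "line_vec 3 0 x1 x2 x3" "line_vec 0 0 (\<omega>' * y1) (\<omega> * y2) (\<omega> * y3)"]
  unfolding br_30_base linear_add[OF automorphism_linear[OF automorphism_gens(2)]] gen_b_line_vec
  by (simp add: omega_simps algebra_simps)

lemma br_91_base:
  "br (line_vec 9 0 x1 x2 x3) (line_vec 1 0 y1 y2 y3) =
    line_vec 0 0 (- (3 * \<theta> * cnj x1 * y1)) (- (3 * \<theta> * cnj x2 * y2)) (- (3 * \<theta> * cnj x3 * y3)) + line_vec 3 0 (- (3 * \<theta> * cnj x1 * cnj y1)) (- (3 * \<theta> * cnj x2 * cnj y2)) (- (3 * \<theta> * cnj x3 * cnj y3))"
  using automorphism_br[OF automorphism_gens(2), of "line_vec 3 0 x1 x2 x3" "line_vec 9 0 (\<omega>' * y1) (\<omega> * y2) (\<omega> * y3)"]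
  unfolding br_39_base linear_add[OF automorphism_linear[OF automorphism_gens(2)]] gen_b_line_vec
  by (simp add: omega_simps algebra_simps)

lemma br_13_base:
  "br (line_vec 1 0 x1 x2 x3) (line_vec 3 0 y1 y2 y3) =
    line_vec 0 0 (- (3 * \<theta> * cnj x1 * y1)) (- (3 * \<theta> * cnj x2 * y2)) (- (3 * \<theta> * cnj x3 * y3)) + line_vec 9 0 (- (3 * \<theta> * cnj x1 * cnj y1)) (- (3 * \<theta> * cnj x2 * cnj y2)) (- (3 * \<theta> * cnj x3 * cnj y3))"
  using automorphism_br[OF automorphism_gens(2), of "line_vec 9 0 (\<omega>' * x1) (\<omega> * x2) (\<omega> * x3)" "line_vec 1 0 (\<omega> * y1) (\<omega>' * y2) (\<omega>' * y3)"]
  unfolding br_91_base linear_add[OF automorphism_linear[OF automorphism_gens(2)]] gen_b_line_vec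
  by (simp add: omega_simps algebra_simps)

lemma br_19_base:
  "br (line_vec 1 0 x1 x2 x3) (line_vec 9 0 y1 y2 y3) =
    line_vec 0 0 ((3 * \<theta> * x1 * cnj y1)) ((3 * \<theta> * x2 * cnj y2)) ((3 * \<theta> * x3 * cnj y3)) + line_vec 3 0 ((3 * \<theta> * cnj x1 * cnj y1)) ((3 * \<theta> * cnj x2 * cnj y2)) ((3 * \<theta> * cnj x3 * cnj y3))"
  using automorphism_br[OF automorphism_gens(2), of "line_vec 9 0 (\<omega>' * x1) (\<omega> * x2) (\<omega> * x3)" "line_vec 3 0 y1 y2 y3"]
  unfolding br_93_base linear_add[OF automorphism_linear[OF automorphism_gens(2)]] gen_b_line_vec
  by (simp add: omega_simps algebra_simps)

lemma br_31_base:
  "br (line_vec 3 0 x1 x2 x3) (line_vec 1 0 y1 y2 y3) =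
    line_vec 0 0 ((3 * \<theta> * x1 * cnj y1)) ((3 * \<theta> * x2 * cnj y2)) ((3 * \<theta> * x3 * cnj y3)) + line_vec 9 0 ((3 * \<theta> * cnj x1 * cnj y1)) ((3 * \<theta> * cnj x2 * cnj y2)) ((3 * \<theta> * cnj x3 * cnj y3))"
  using automorphism_br[OF automorphism_gens(2), of "line_vec 1 0 (\<omega> * x1) (\<omega>' * x2) (\<omega>' * x3)" "line_vec 9 0 (\<omega>' * y1) (\<omega> * y2) (\<omega> * y3)"]
  unfolding br_19_base linear_add[OF automorphism_linear[OF automorphism_gens(2)]] gen_b_line_vec
  by (simp add: omega_simps algebra_simps)

lemma br_line_vec_shift:
  assumes "br (line_vec i 0 x1 x2 x3) (line_vec j 0 y1 y2 y3) = line_vec l 0 z1 z2 z3 + line_vec m 0 w1 w2 w3"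
  shows "br (line_vec i k x1 x2 x3) (line_vec j k y1 y2 y3) = line_vec l k z1 z2 z3 + line_vec m k w1 w2 w3"
proof -
  obtain n where k: "k = of_nat n" using ex_of_nat_13 by blast
  show ?thesis
    using automorphism_br[OF automorphism_pow[OF automorphism_gens(1)], of n "line_vec i 0 x1 x2 x3" "line_vec j 0 y1 y2 y3"]
    unfolding assms linear_add[OF automorphism_linear[OF automorphism_pow[OF automorphism_gens(1)]]] gen_a_line_vec k .
qed

text \<open>The table of \<open>su(3)\<close>. Attach to the points 0, 1, 3, 9 the vectors \<open>(1, 0)\<close>, \<open>(0, 1)\<close>, \<open>(1, 1)\<close>, \<open>(-1, 1)\<close>
  modulo 3, and let a coordinate \<open>x\<close> at a point with vector \<open>p\<close> mean the coefficients \<open>x\<close> at \<open>p\<close> and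
  \<open>- cnj x\<close> at \<open>- p\<close>. Then coefficients \<open>x\<close> at \<open>p\<close> and \<open>y\<close> at \<open>q\<close> contribute \<open>3 * \<theta> * \<langle>p, q\<rangle> * x * y\<close> at
  \<open>p + q\<close>.\<close>

lemmas br_line_vec =
  br_01_base[THEN br_line_vec_shift]
  br_03_base[THEN br_line_vec_shift]
  br_09_base[THEN br_line_vec_shift]
  br_10_base[THEN br_line_vec_shift]
  br_30_base[THEN br_line_vec_shift]
  br_90_base[THEN br_line_vec_shift]
  br_13_base[THEN br_line_vec_shift]
  br_39_base[THEN br_line_vec_shift]
  br_91_base[THEN br_line_vec_shift]
  br_31_base[THEN br_line_vec_shift]
  br_93_base[THEN br_line_vec_shift]
  br_19_base[THEN br_line_vec_shift]

lemma diagonal_nth: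
  fixes g :: "V78 \<Rightarrow> V78"
  assumes "linear g" and "\<And>t v. g (axis t v) = axis t (f t v)" shows "g w $ s = f s (w $ s)"
proof -
  have "g w = g (\<Sum>t\<in>UNIV. axis t (w $ t))" using axis_sum[of w] by (rule arg_cong)
  also have "\<dots> = (\<Sum>t\<in>UNIV. axis t (f t (w $ t)))" by (simp only: linear_sum[OF assms(1)] assms(2))
  also have "\<dots> $ s = (\<Sum>t\<in>UNIV. if s = t then f t (w $ t) else 0)"
    by (simp only: sum_component axis_nth eq_commute[of s])
  also have "\<dots> = f s (w $ s)" by (rule sum_delta_13)
  finally show ?thesis .
qed

text \<open>Both \<open>gen_d\<close> and its conjugate under a translation fix \<open>V\<^sub>0\<close> pointwise, and for each \<open>t \<noteq> 0\<close> one of the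
  two multiplies \<open>V\<^sub>t\<close> by a primitive cube root of unity.\<close>

lemma br_00_in: "\<exists>x y z. br (line_vec 0 0 u1 u2 u3) (line_vec 0 0 v1 v2 v3) = line_vec 0 0 x y z"
proof -
  let ?u = "line_vec 0 0 u1 u2 u3" and ?v = "line_vec 0 0 v1 v2 v3"
  let ?w = "br ?u ?v" and ?g = "(gen_a ^^ 1) \<circ> gen_d \<circ> (gen_a ^^ 12)"
  have sym: "automorphism ?g" by (intro automorphism_comp automorphism_pow automorphism_gens)
  have g: "?g (axis t v) = axis t (delta (t + 12) *s v)" for t v
    by (simp add: gen_a_axis gen_a_pow gen_d_axis mod_13)
  have fixed: "gen_d ?u = ?u" "gen_d ?v = ?v" "?g ?u = ?u" "?g ?v = ?v"
    unfolding line_vec_def g gen_d_axis by (simp_all add: delta_def)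
  have d: "?w $ t = delta t *s (?w $ t)" for t
    using automorphism_br[OF automorphism_gens(4), of ?u ?v] diagonal_nth[OF linear_gen_d gen_d_axis, of ?w t]
    unfolding fixed by simp
  have e: "?w $ t = delta (t + 12) *s (?w $ t)" for t
    using automorphism_br[OF sym, of ?u ?v] diagonal_nth[OF automorphism_linear[OF sym] g, of ?w t]
    unfolding fixed by simp
  have nz: "v = 0" if "v = c *s v" "c \<noteq> 1" for v :: "complex ^ 3" and c
    using that by (auto simp: vec3_eq_iff)
  have "\<forall>t. t \<noteq> 0 \<longrightarrow> ?w $ t = 0"
    unfolding forall_13
    by (intro conjI impI)
      ((rule notE, assumption, rule refl) |
       (rule nz[OF d], simp add: delta_def omega_ne_1; fail) | (rule nz[OF e], simp add: delta_def mod_13 omega_ne_1; fail))+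
  then have "?w = axis 0 (?w $ 0)" by (intro V78_eqI) (simp add: axis_nth)
  also have "\<dots> = axis 0 (vec3 (?w $ 0 $ 1) (?w $ 0 $ 2) (?w $ 0 $ 3))" by (simp only: vec3_collapse)
  also have "\<dots> = line_vec 0 0 (?w $ 0 $ 1 / \<theta>) (?w $ 0 $ 2 / \<theta>) (?w $ 0 $ 3 / \<theta>)"
    using theta_nz by (simp add: line_vec_def frame_def)
  finally show ?thesis by blast
qed

lemma line_vec0_eq_iff: "line_vec 0 k x1 x2 x3 = line_vec 0 k y1 y2 y3 \<longleftrightarrow> x1 = y1 \<and> x2 = y2 \<and> x3 = y3"
  using theta_nz by (auto simp: line_vec_def frame_def axis_eq_axis vec3_eq_iff)

text \<open>A real bilinear map is a sum of four parts, each linear or antilinear in either argument. They are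
  multiplied by \<open>\<omega>\<^sup>2\<close>, \<open>1\<close>, \<open>1\<close>, \<open>\<omega>\<close> when both arguments are multiplied by \<open>\<omega>\<close>, so \<open>f\<close> is antilinear in
  both.\<close>

lemma omega_equivariant_phase:
  assumes eq: "\<And>x y. f (\<omega> * x) (\<omega> * y) = \<omega> * (f x y :: complex)"
    and add: "\<And>x x' y. f (x + x') y = f x y + f x' y" "\<And>x y y'. f x (y + y') = f x y + f x y'"
    and minus: "\<And>x y. f (- x) y = - f x y" "\<And>x y. f x (- y) = - f x y"
  shows "f (\<omega> * x) (\<omega>' * y) = f x y"
proof -
  have 1: "\<omega> * (\<omega> * z) = - z + - (\<omega> * z)" for z by (simp add: omega_sq')
  have A: "\<omega> * f (\<omega> * x) y = - f x (\<omega> * y) + - (\<omega> * f x y)"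
    using eq[of "\<omega> * x" y] unfolding 1 add minus eq by (rule sym)
  have B: "\<omega> * f x (\<omega> * y) = - f (\<omega> * x) y + - (\<omega> * f x y)"
    using eq[of x "\<omega> * y"] unfolding 1 add minus eq by (rule sym)
  have 2: "\<omega>' * y = - y + - (\<omega> * y)" by (simp add: cnj_omega algebra_simps)
  have C: "f (\<omega> * x) (\<omega>' * y) = - f (\<omega> * x) y - \<omega> * f x y"
    unfolding 2 add minus eq by simp
  have "(\<omega> - 1) * (\<omega> * f x (\<omega> * y) - f x y) = 0"
    using A B omega_sq by algebra
  moreover have "\<omega> - 1 \<noteq> 0" by (simp add: omega_eq complex_eq_iff)
  ultimately have "\<omega> * f x (\<omega> * y) = f x y" by simp
  then show ?thesis using C B by simp
qed

lemma line_vec0_nth: "line_vec 0 0 x y z $ 0 $ 1 = \<theta> * x" "line_vec 0 0 x y z $ 0 $ 2 = \<theta> * y" "line_vec 0 0 x y z $ 0 $ 3 = \<theta> * z"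
  by (simp_all add: line_vec_def frame_def axis_nth)

lemma twist_line_vec: "twist (line_vec 0 0 x y z) = line_vec 0 0 (\<omega> * x) (\<omega> * y) (\<omega> * z)"
  by (simp add: twist_def line_vec_def frame_def gen_a_pow gen_d_axis mod_13 delta_def vec3_algebra algebra_simps)

lemma br_00_omega:
  assumes "br (line_vec 0 0 a1 a2 a3) (line_vec 0 0 b1 b2 b3) = line_vec 0 0 x y z"
  shows "br (line_vec 0 0 (\<omega> * a1) (\<omega> * a2) (\<omega> * a3)) (line_vec 0 0 (\<omega> * b1) (\<omega> * b2) (\<omega> * b3))
    = line_vec 0 0 (\<omega> * x) (\<omega> * y) (\<omega> * z)"
  using automorphism_br[OF automorphism_words(3), of "line_vec 0 0 a1 a2 a3" "line_vec 0 0 b1 b2 b3"] unfolding assms twist_line_vec .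

lemma br_00_phase:
  "br (line_vec 0 0 (\<omega> * a1) (\<omega> * a2) (\<omega> * a3)) (line_vec 0 0 (\<omega>' * b1) (\<omega>' * b2) (\<omega>' * b3))
    = br (line_vec 0 0 a1 a2 a3) (line_vec 0 0 b1 b2 b3)"
proof -
  let ?G = "\<lambda>x y. br (line_vec 0 0 (x * a1) (x * a2) (x * a3)) (line_vec 0 0 (y * b1) (y * b2) (y * b3))"
  have m: "?G \<omega> \<omega>' $ 0 $ m = ?G 1 1 $ 0 $ m" for m :: 3
  proof -
    have "?G (\<omega> * 1) (\<omega>' * 1) $ 0 $ m = ?G 1 1 $ 0 $ m"
    proof (rule omega_equivariant_phase)
      fix x y
      obtain p q r where 1: "?G x y = line_vec 0 0 p q r" using br_00_in by blast
      have 2: "?G (\<omega> * x) (\<omega> * y) = line_vec 0 0 (\<omega> * p) (\<omega> * q) (\<omega> * r)"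
        using br_00_omega[OF 1] by (simp only: mult.assoc)
      show "?G (\<omega> * x) (\<omega> * y) $ 0 $ m = \<omega> * (?G x y $ 0 $ m)"
        unfolding 1 2 using exhaust_3[of m] by (auto simp: line_vec0_nth)
    qed (simp_all add: distrib_right line_vec_add[symmetric] line_vec_minus[symmetric] br_simps)
    then show ?thesis by simp
  qed
  obtain p q r where 1: "?G 1 1 = line_vec 0 0 p q r" using br_00_in by blast
  obtain p' q' r' where 2: "?G \<omega> \<omega>' = line_vec 0 0 p' q' r'" using br_00_in by blast
  have "line_vec 0 0 p' q' r' = line_vec 0 0 p q r"
    using m[of 1] m[of 2] m[of 3] theta_nz unfolding 1 2 line_vec0_nth by simp
  then show ?thesis using 1 2 by simp
qed

text \<open>The map \<open>gen_b\<close> multiplies the two coordinates involved by \<open>\<omega>\<close> and \<open>\<omega>'\<close>, which leaves the product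
  unchanged; but \<open>gen_b\<close> has no nonzero fixed vector in \<open>V\<^sub>0\<close>.\<close>

lemma br_00_off_diagonal:
  "br (line_vec 0 0 x 0 0) (line_vec 0 0 0 y 0) = 0" "br (line_vec 0 0 0 y 0) (line_vec 0 0 x 0 0) = 0"
proof -
  have zero: "line_vec 0 0 p q r = 0" if "gen_b (line_vec 0 0 p q r) = line_vec 0 0 p q r" for p q r
    using that unfolding gen_b_line_vec line_vec0_eq_iff
    by (simp add: omega_ne_1 line_vec_zero)
  show "br (line_vec 0 0 x 0 0) (line_vec 0 0 0 y 0) = 0"
  proof -
    obtain p q r where 1: "br (line_vec 0 0 x 0 0) (line_vec 0 0 0 y 0) = line_vec 0 0 p q r" using br_00_in by blast
    show ?thesis unfolding 1
      using automorphism_br[OF automorphism_gens(2), of "line_vec 0 0 x 0 0" "line_vec 0 0 0 y 0"] br_00_phase[of x 0 0 0 y 0]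
      unfolding 1 by (intro zero) (simp add: gen_b_line_vec)
  qed
  show "br (line_vec 0 0 0 y 0) (line_vec 0 0 x 0 0) = 0"
  proof -
    obtain p q r where 1: "br (line_vec 0 0 0 y 0) (line_vec 0 0 x 0 0) = line_vec 0 0 p q r" using br_00_in by blast
    have w: "\<omega> * (\<omega>' * z) = z" "\<omega>' * (\<omega> * z) = z" "\<omega>' * (\<omega>' * z) = \<omega> * z" for z
      by (simp_all add: omega_simps algebra_simps)
    have 2: "br (line_vec 0 0 0 (\<omega>' * y) 0) (line_vec 0 0 (\<omega> * x) 0 0) = line_vec 0 0 p q r"
      using br_00_phase[of 0 "\<omega>' * y" 0 "\<omega> * x" 0 0] br_00_omega[OF 1]
        br_00_phase[of 0 "\<omega> * y" 0 "\<omega>' * x" 0 0]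
        br_00_phase[of 0 y 0 x 0 0] 1
      by (simp add: w)
    have "gen_b (line_vec 0 0 p q r) = br (gen_b (line_vec 0 0 0 y 0)) (gen_b (line_vec 0 0 x 0 0))"
      unfolding automorphism_br[OF automorphism_gens(2)] 1 ..
    also have "\<dots> = line_vec 0 0 p q r"
      unfolding gen_b_line_vec(1)[of 0 y 0] gen_b_line_vec(1)[of x 0 0] mult_zero_right by (rule 2)
    finally show ?thesis unfolding 1 by (rule zero)
  qed
qed

text \<open>Under \<open>gen_b\<close> only the first coordinate of the product can survive, and the automorphism
  \<open>shifted_c 1 12\<close> negates first coordinates, hence must both negate and preserve the product.\<close>

lemma br_00_diagonal: "br (line_vec 0 0 x 0 0) (line_vec 0 0 y 0 0) = 0"
proof -
  obtain p q r where 1: "br (line_vec 0 0 x 0 0) (line_vec 0 0 y 0 0) = line_vec 0 0 p q r" using br_00_in by blast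
  have "line_vec 0 0 (\<omega> * p) (\<omega>' * q) (\<omega>' * r) = line_vec 0 0 (\<omega> * p) (\<omega> * q) (\<omega> * r)"
    using automorphism_br[OF automorphism_gens(2), of "line_vec 0 0 x 0 0" "line_vec 0 0 y 0 0"] br_00_omega[OF 1]
    unfolding 1 gen_b_line_vec by simp
  then have qr: "q = 0" "r = 0" unfolding line_vec0_eq_iff by (auto simp: omega_eq complex_eq_iff)
  have s: "shifted_c 1 12 (line_vec 0 0 x y z) = line_vec 0 0 (- x) (- z) (- y)" for x y z
    by (simp add: shifted_c_def line_vec_def frame_def gen_a_axis gen_a_pow mod_13 gen_c_axis)
  have "br (line_vec 0 0 (- x) 0 0) (line_vec 0 0 (- y) 0 0) = br (line_vec 0 0 x 0 0) (line_vec 0 0 y 0 0)"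
    unfolding line_vec_minus[of 0 0 x 0 0, unfolded minus_zero, symmetric]
      line_vec_minus[of 0 0 y 0 0, unfolded minus_zero, symmetric] by (simp add: br_simps)
  then have "line_vec 0 0 (- p) 0 0 = line_vec 0 0 p 0 0"
    using automorphism_br[OF automorphism_words(2)[of 1 12], of "line_vec 0 0 x 0 0" "line_vec 0 0 y 0 0"]
    unfolding 1 qr s by simp
  then have "p = 0" unfolding line_vec0_eq_iff by simp
  then show ?thesis unfolding 1 qr by (simp add: line_vec_zero)
qed

lemma br_00: "br (line_vec 0 0 x1 x2 x3) (line_vec 0 0 y1 y2 y3) = 0"
proof -
  note sym = automorphism_br[OF automorphism_words(1)] and lin = linear_0[OF automorphism_linear[OF automorphism_words(1)]]
  have diag: "br (line_vec 0 0 x 0 0) (line_vec 0 0 y 0 0) = 0" "br (line_vec 0 0 0 x 0) (line_vec 0 0 0 y 0) = 0" 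
    "br (line_vec 0 0 0 0 x) (line_vec 0 0 0 0 y) = 0" for x y
    using br_00_diagonal[of x y] sym[of "line_vec 0 0 x 0 0" "line_vec 0 0 y 0 0"] sym[of "line_vec 0 0 0 x 0" "line_vec 0 0 0 y 0"]
    by (simp_all add: frame_rotation_line_vec lin)
  have off: "br (line_vec 0 0 x 0 0) (line_vec 0 0 0 y 0) = 0" "br (line_vec 0 0 0 x 0) (line_vec 0 0 0 0 y) = 0" 
    "br (line_vec 0 0 0 0 x) (line_vec 0 0 y 0 0) = 0" for x y
    using br_00_off_diagonal(1)[of x y] sym[of "line_vec 0 0 x 0 0" "line_vec 0 0 0 y 0"] sym[of "line_vec 0 0 0 x 0" "line_vec 0 0 0 0 y"]
    by (simp_all add: frame_rotation_line_vec lin)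
  have off': "br (line_vec 0 0 0 x 0) (line_vec 0 0 y 0 0) = 0" "br (line_vec 0 0 0 0 x) (line_vec 0 0 0 y 0) = 0" 
    "br (line_vec 0 0 x 0 0) (line_vec 0 0 0 0 y) = 0" for x y
    using br_00_off_diagonal(2)[of x y] sym[of "line_vec 0 0 0 x 0" "line_vec 0 0 y 0 0"] sym[of "line_vec 0 0 0 0 x" "line_vec 0 0 0 y 0"]
    by (simp_all add: frame_rotation_line_vec lin)
  have s: "line_vec 0 0 x y z = line_vec 0 0 x 0 0 + line_vec 0 0 0 y 0 + line_vec 0 0 0 0 z" for x y z by (simp add: line_vec_add)
  show ?thesis unfolding s[of x1 x2 x3] s[of y1 y2 y3] by (simp add: br_simps diag off off')
qed

lemma br_same: "br (axis t u) (axis t v) = 0"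
proof -
  have z: "br (axis 0 u) (axis 0 v) = 0" for u v
  proof -
    have a: "axis 0 u = line_vec 0 0 (u $ 1 / \<theta>) (u $ 2 / \<theta>) (u $ 3 / \<theta>)" for u
      using theta_nz by (simp add: line_vec_def frame_def vec3_collapse)
    show ?thesis unfolding a by (rule br_00)
  qed
  obtain n where "t = of_nat n" using ex_of_nat_13 by blast
  then show ?thesis
    using automorphism_br[OF automorphism_pow[OF automorphism_gens(1)], of n "axis 0 u" "axis 0 v"]
    by (simp add: gen_a_pow z linear_0[OF automorphism_linear[OF automorphism_pow[OF automorphism_gens(1)]]])
qed

end

section \<open>The Jacobi identity on one triangle\<close>

lemma axis_line_vec:
  "axis k (vec3 x y z) = line_vec 0 k (x / \<theta>) (y / \<theta>) (z / \<theta>)"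
  "axis (k + 1) (vec3 x y z) = line_vec 1 k ((x + y + z) / 3) ((\<omega> * x + y + \<omega>' * z) / 3) ((\<omega> * x + \<omega>' * y + z) / 3)"
  "axis (k + 3) (vec3 x y z) = line_vec 3 k ((\<omega> * x + y + z) / 3) ((\<omega> * x + \<omega>' * y + \<omega> * z) / 3) ((\<omega> * x + \<omega> * y + \<omega>' * z) / 3)"
  "axis (k + 9) (vec3 x y z) = line_vec 9 k ((x + \<omega> * y + \<omega> * z) / 3) ((x + y + \<omega>' * z) / 3) ((x + \<omega>' * y + z) / 3)"
  using theta_nz
  by (simp_all add: line_vec_def frame_def axis_eq_axis vec3_eq_iff)
    (simp_all add: omega_simps field_simps)

lemma inverse_theta: "x / \<theta> = - (\<theta> * x) / 3"
proof -
  have "\<theta> * \<theta> = - 3" by (simp add: omega_simps algebra_simps)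
  then have "\<theta> * (\<theta> * x) = - 3 * x" by (simp flip: mult.assoc)
  then show ?thesis using theta_nz by (simp add: field_simps)
qed

context G_product begin

text \<open>The lines through a point have different frames there, so brackets along a triangle are iterated in
  standard coordinates. The triangle 0, 1, 2 involves five of the twelve types of pairs.\<close>

lemma br_01_axis:
  "br (axis k (vec3 x1 x2 x3)) (axis (k + 1) (vec3 y1 y2 y3)) =
    axis (k + 3) (vec3
      (x1 * (\<omega>' * y1 + \<omega>' * y2 + \<omega>' * y3) + x2 * (y1 + \<omega>' * y2 + \<omega> * y3) + x3 * (y1 + \<omega> * y2 + \<omega>' * y3))
      (x1 * (y1 + y2 + y3) + x2 * (\<omega>' * y1 + \<omega> * y2 + y3) + x3 * (y1 + \<omega> * y2 + \<omega>' * y3))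
      (x1 * (y1 + y2 + y3) + x2 * (y1 + \<omega>' * y2 + \<omega> * y3) + x3 * (\<omega>' * y1 + y2 + \<omega> * y3))) +
    axis (k + 9) (vec3
      (cnj x1 * (- y1 - y2 - y3) + cnj x2 * (- \<omega> * y1 - y2 - \<omega>' * y3) + cnj x3 * (- \<omega> * y1 - \<omega>' * y2 - y3))
      (cnj x1 * (- \<omega>' * y1 - \<omega>' * y2 - \<omega>' * y3) + cnj x2 * (- \<omega> * y1 - y2 - \<omega>' * y3) + cnj x3 * (- \<omega>' * y1 - y2 - \<omega> * y3))
      (cnj x1 * (- \<omega>' * y1 - \<omega>' * y2 - \<omega>' * y3) + cnj x2 * (- \<omega>' * y1 - \<omega> * y2 - y3) + cnj x3 * (- \<omega> * y1 - \<omega>' * y2 - y3)))"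
  unfolding axis_line_vec[of k] br_line_vec inverse_theta
  unfolding line_vec_def frame_def
  by (simp, intro arg_cong2[where f="(+)"] axis_eqI refl; simp add: vec3_eq_iff; simp add: omega_simps field_simps)

lemma br_30_axis:
  "br (axis (k + 3) (vec3 x1 x2 x3)) (axis k (vec3 y1 y2 y3)) =
    axis (k + 9) (vec3
      (x1 * (- \<omega> * y1 - \<omega> * y2 - \<omega> * y3) + x2 * (- y1 - \<omega>' * y2 - \<omega> * y3) + x3 * (- y1 - \<omega> * y2 - \<omega>' * y3))
      (x1 * (- y1 - \<omega> * y2 - \<omega>' * y3) + x2 * (- \<omega>' * y1 - \<omega>' * y2 - \<omega>' * y3) + x3 * (- \<omega>' * y1 - \<omega> * y2 - y3))
      (x1 * (- y1 - \<omega>' * y2 - \<omega> * y3) + x2 * (- \<omega>' * y1 - y2 - \<omega> * y3) + x3 * (- \<omega>' * y1 - \<omega>' * y2 - \<omega>' * y3))) +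
    axis (k + 1) (vec3
      (x1 * (\<omega> * cnj y1 + cnj y2 + cnj y3) + x2 * (cnj y1 + \<omega> * cnj y2 + cnj y3) + x3 * (cnj y1 + cnj y2 + \<omega> * cnj y3))
      (x1 * (\<omega> * cnj y1 + \<omega> * cnj y2 + \<omega>' * cnj y3) + x2 * (cnj y1 + \<omega>' * cnj y2 + \<omega>' * cnj y3) + x3 * (cnj y1 + \<omega> * cnj y2 + cnj y3))
      (x1 * (\<omega> * cnj y1 + \<omega>' * cnj y2 + \<omega> * cnj y3) + x2 * (cnj y1 + cnj y2 + \<omega> * cnj y3) + x3 * (cnj y1 + \<omega>' * cnj y2 + \<omega>' * cnj y3)))"
  unfolding axis_line_vec[of k] br_line_vec inverse_theta
  unfolding line_vec_def frame_def
  by (simp, intro arg_cong2[where f="(+)"] axis_eqI refl; simp add: vec3_eq_iff; simp add: omega_simps field_simps)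

lemma br_90_axis:
  "br (axis (k + 9) (vec3 x1 x2 x3)) (axis k (vec3 y1 y2 y3)) =
    axis (k + 1) (vec3
      (x1 * (- y1 - \<omega>' * y2 - \<omega>' * y3) + x2 * (- \<omega> * y1 - \<omega>' * y2 - \<omega> * y3) + x3 * (- \<omega> * y1 - \<omega> * y2 - \<omega>' * y3))
      (x1 * (- y1 - y2 - \<omega> * y3) + x2 * (- \<omega> * y1 - y2 - y3) + x3 * (- \<omega> * y1 - \<omega>' * y2 - \<omega> * y3))
      (x1 * (- y1 - \<omega> * y2 - y3) + x2 * (- \<omega> * y1 - \<omega> * y2 - \<omega>' * y3) + x3 * (- \<omega> * y1 - y2 - y3))) +
    axis (k + 3) (vec3
      (x1 * (\<omega>' * cnj y1 + \<omega>' * cnj y2 + \<omega>' * cnj y3) + x2 * (cnj y1 + \<omega>' * cnj y2 + \<omega> * cnj y3) + x3 * (cnj y1 + \<omega> * cnj y2 + \<omega>' * cnj y3))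
      (x1 * (cnj y1 + \<omega> * cnj y2 + \<omega>' * cnj y3) + x2 * (\<omega> * cnj y1 + \<omega> * cnj y2 + \<omega> * cnj y3) + x3 * (\<omega> * cnj y1 + cnj y2 + \<omega>' * cnj y3))
      (x1 * (cnj y1 + \<omega>' * cnj y2 + \<omega> * cnj y3) + x2 * (\<omega> * cnj y1 + \<omega>' * cnj y2 + cnj y3) + x3 * (\<omega> * cnj y1 + \<omega> * cnj y2 + \<omega> * cnj y3)))"
  unfolding axis_line_vec[of k] br_line_vec inverse_theta
  unfolding line_vec_def frame_def
  by (simp, intro arg_cong2[where f="(+)"] axis_eqI refl; simp add: vec3_eq_iff; simp add: omega_simps field_simps)

lemma br_31_axis:
  "br (axis (k + 3) (vec3 x1 x2 x3)) (axis (k + 1) (vec3 y1 y2 y3)) =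
    axis (k) (vec3
      (x1 * (- \<omega> * cnj y1 - \<omega> * cnj y2 - \<omega> * cnj y3) + x2 * (- cnj y1 - cnj y2 - cnj y3) + x3 * (- cnj y1 - cnj y2 - cnj y3))
      (x1 * (- cnj y1 - \<omega> * cnj y2 - \<omega>' * cnj y3) + x2 * (- \<omega> * cnj y1 - \<omega>' * cnj y2 - cnj y3) + x3 * (- cnj y1 - \<omega> * cnj y2 - \<omega>' * cnj y3))
      (x1 * (- cnj y1 - \<omega>' * cnj y2 - \<omega> * cnj y3) + x2 * (- cnj y1 - \<omega>' * cnj y2 - \<omega> * cnj y3) + x3 * (- \<omega> * cnj y1 - cnj y2 - \<omega>' * cnj y3))) +
    axis (k + 9) (vec3
      (cnj x1 * (\<omega>' * cnj y1 + cnj y2 + cnj y3) + cnj x2 * (\<omega> * cnj y1 + \<omega> * cnj y2 + cnj y3) + cnj x3 * (\<omega> * cnj y1 + cnj y2 + \<omega> * cnj y3))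
      (cnj x1 * (\<omega>' * cnj y1 + \<omega>' * cnj y2 + \<omega> * cnj y3) + cnj x2 * (cnj y1 + \<omega>' * cnj y2 + cnj y3) + cnj x3 * (\<omega>' * cnj y1 + cnj y2 + cnj y3))
      (cnj x1 * (\<omega>' * cnj y1 + \<omega> * cnj y2 + \<omega>' * cnj y3) + cnj x2 * (\<omega>' * cnj y1 + cnj y2 + cnj y3) + cnj x3 * (cnj y1 + cnj y2 + \<omega>' * cnj y3)))"
  unfolding axis_line_vec[of k] br_line_vec inverse_theta
  unfolding line_vec_def frame_def
  by (simp, intro arg_cong2[where f="(+)"] axis_eqI refl; simp add: vec3_eq_iff; simp add: omega_simps field_simps)

lemma br_93_axis:
  "br (axis (k + 9) (vec3 x1 x2 x3)) (axis (k + 3) (vec3 y1 y2 y3)) =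
    axis (k) (vec3
      (x1 * (- \<omega>' * cnj y1 - cnj y2 - cnj y3) + x2 * (- cnj y1 - \<omega> * cnj y2 - \<omega> * cnj y3) + x3 * (- cnj y1 - \<omega> * cnj y2 - \<omega> * cnj y3))
      (x1 * (- \<omega>' * cnj y1 - \<omega> * cnj y2 - \<omega>' * cnj y3) + x2 * (- \<omega>' * cnj y1 - \<omega> * cnj y2 - \<omega>' * cnj y3) + x3 * (- \<omega> * cnj y1 - cnj y2 - \<omega> * cnj y3))
      (x1 * (- \<omega>' * cnj y1 - \<omega>' * cnj y2 - \<omega> * cnj y3) + x2 * (- \<omega> * cnj y1 - \<omega> * cnj y2 - cnj y3) + x3 * (- \<omega>' * cnj y1 - \<omega>' * cnj y2 - \<omega> * cnj y3))) +
    axis (k + 1) (vec3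
      (cnj x1 * (\<omega>' * cnj y1 + \<omega> * cnj y2 + \<omega> * cnj y3) + cnj x2 * (\<omega>' * cnj y1 + cnj y2 + \<omega>' * cnj y3) + cnj x3 * (\<omega>' * cnj y1 + \<omega>' * cnj y2 + cnj y3))
      (cnj x1 * (cnj y1 + \<omega> * cnj y2 + cnj y3) + cnj x2 * (\<omega>' * cnj y1 + \<omega>' * cnj y2 + cnj y3) + cnj x3 * (\<omega> * cnj y1 + cnj y2 + cnj y3))
      (cnj x1 * (cnj y1 + cnj y2 + \<omega> * cnj y3) + cnj x2 * (\<omega> * cnj y1 + cnj y2 + cnj y3) + cnj x3 * (\<omega>' * cnj y1 + cnj y2 + \<omega>' * cnj y3)))"
  unfolding axis_line_vec[of k] br_line_vec inverse_theta
  unfolding line_vec_def frame_def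
  by (simp, intro arg_cong2[where f="(+)"] axis_eqI refl; simp add: vec3_eq_iff; simp add: omega_simps field_simps)

lemma add_13:
  "(1::13) + 1 = 2" "(1::13) + 3 = 4" "(1::13) + 9 = 10" "(4::13) + 9 = 0" "(4::13) + 1 = 5" "(4::13) + 3 = 7"
  "(10::13) + 3 = 0" "(10::13) + 1 = 11" "(10::13) + 9 = 6" "(12::13) + 3 = 2" "(12::13) + 1 = 0" "(12::13) + 9 = 8"
  "(11::13) + 3 = 1" "(11::13) + 1 = 12" "(11::13) + 9 = 7" "(5::13) + 9 = 1" "(5::13) + 3 = 8" "(5::13) + 1 = 6"
  "(0::13) + 1 = 1" "(0::13) + 3 = 3" "(0::13) + 9 = 9" "(2::13) + 1 = 3" "(2::13) + 3 = 5" "(2::13) + 9 = 11"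
  "(6::13) + 9 = 2" "(6::13) + 3 = 9" "(6::13) + 1 = 7"
  by simp_all

lemma sum_axes_zero:
  assumes "a = vec3 0 0 0" "b = vec3 0 0 0" "c = vec3 0 0 0" "d = vec3 0 0 0"
  shows "axis p a + axis q b + axis r c + axis s d = 0"
  by (simp add: assms vec3_0 axis_algebra(5))

lemma vec3_cong: "a = a' \<Longrightarrow> b = b' \<Longrightarrow> c = c' \<Longrightarrow> vec3 a b c = vec3 a' b' c'"
  by simp

text \<open>Each of the three double brackets has one component at each of the points 5, 7, 11, 6.\<close>

lemma jacobi_012:
  "br (axis 0 (vec3 u1 u2 u3)) (br (axis 1 (vec3 v1 v2 v3)) (axis 2 (vec3 w1 w2 w3)))
  + br (axis 1 (vec3 v1 v2 v3)) (br (axis 2 (vec3 w1 w2 w3)) (axis 0 (vec3 u1 u2 u3)))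
  + br (axis 2 (vec3 w1 w2 w3)) (br (axis 0 (vec3 u1 u2 u3)) (axis 1 (vec3 v1 v2 v3))) = 0"
  (is "?J = 0")
proof -
  note first = br_01_axis[of 1, unfolded add_13] br_31_axis[of 12, unfolded add_13] br_01_axis[of 0, unfolded add_13]
  note second = br_90_axis[of 4, unfolded add_13] br_30_axis[of 10, unfolded add_13]
     br_31_axis[of 11, unfolded add_13] br_93_axis[of 5, unfolded add_13]
     br_01_axis[of 2, unfolded add_13] br_93_axis[of 6, unfolded add_13]
  have collect: "((axis 5 a1 + axis 7 b1) + (axis 6 d1 + axis 11 c1)) + ((axis 11 c2 + axis 7 b2) + (axis 5 a2 + axis 6 d2))
      + ((axis 5 a3 + axis 11 c3) + (axis 6 d3 + axis 7 b3))
    = axis 5 (a1 + a2 + a3) + axis 7 (b1 + b2 + b3) + axis 11 (c1 + c2 + c3) + axis 6 (d1 + d2 + d3)"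
    for a1 a2 a3 b1 b2 b3 c1 c2 c3 d1 d2 d3 :: "complex ^ 3"
    by (simp add: axis_algebra(1)[symmetric] add_ac)
  show ?thesis
    unfolding first br_simps(2) second collect vec3_algebra
    by (rule sum_axes_zero; rule vec3_cong; simp add: omega_simps algebra_simps)
qed
end

section \<open>The Jacobi identity on all triples\<close>

definition c_perm :: "13 \<Rightarrow> 13" where
  "c_perm t = (if t = 3 then 9 else if t = 9 then 3 else if t = 4 then 10 else if t = 10 then 4
     else if t = 5 then 6 else if t = 6 then 5 else if t = 7 then 11 else if t = 11 then 7 else t)"

lemma gen_c_point: "\<exists>w. gen_c (axis t v) = axis (c_perm t) w"
proof -
  have "\<forall>t. \<exists>w. gen_c (axis t (vec3 (v $ 1) (v $ 2) (v $ 3))) = axis (c_perm t) w"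
    unfolding forall_13 by (simp add: gen_c_axis c_perm_def axis_eq_axis) (intro conjI; blast)
  then show ?thesis by (simp add: vec3_collapse)
qed

lemma c_perm_c_perm: "c_perm (c_perm t) = t"
  by (simp add: c_perm_def)

lemma gen_c_involution: "gen_c (gen_c (axis t v)) = axis t v"
proof -
  have "\<forall>t. gen_c (gen_c (axis t (vec3 (v $ 1) (v $ 2) (v $ 3)))) = axis t (vec3 (v $ 1) (v $ 2) (v $ 3))"
    unfolding forall_13
    by (intro conjI; simp only: gen_c_axis M_mult; rule axis_eqI[OF refl])
      (simp_all add: vec3_eq_iff, simp_all add: omega_simps field_simps)
  then show ?thesis by (simp add: vec3_collapse)
qed

text \<open>The pairs \<open>(x, y)\<close> for which \<open>(0, x, y)\<close> arises from \<open>(0, s, t)\<close> by translations, permutations and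
  multiplication by 3.\<close>

definition triple_orbit :: "13 \<Rightarrow> 13 \<Rightarrow> (13 \<times> 13) set" where
  "triple_orbit s t = (\<Union>m\<in>{1, 3, 9}. {(m * s, m * t), (m * t, m * s), (m * (t - s), - m * s), (- m * s, m * (t - s)),
     (- m * t, m * (s - t)), (m * (s - t), - m * t)})"

text \<open>The set \<open>{0, 1, 3, 9}\<close> is a perfect difference set modulo 13.\<close>

lemma line_pair:
  assumes "s \<noteq> t"
  obtains k i j where "(i, j) \<in> {(0, 1), (0, 3), (0, 9), (1, 0), (3, 0), (9, 0), (1, 3), (3, 9), (9, 1), (3, 1), (9, 3), (1, 9)}"
    "s = k + i" "t = k + (j :: 13)"
proof -
  let ?P = "{(0, 1), (0, 3), (0, 9), (1, 0), (3, 0), (9, 0), (1, 3), (3, 9), (9, 1), (3, 1), (9, 3), (1, 9)} :: (13 \<times> 13) set"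
  have "\<forall>d::13. d = 0 \<or> (\<exists>(i, j)\<in>?P. d = j - i)"
    unfolding forall_13 by simp
  then have "t - s = 0 \<or> (\<exists>(i, j)\<in>?P. t - s = j - i)" by blast
  moreover have "t - s \<noteq> 0" using assms by simp
  ultimately obtain x where x: "x \<in> ?P" "case x of (i, j) \<Rightarrow> t - s = j - i" by blast
  obtain i j where ij: "x = (i, j)" by (cases x)
  have "t = s + (t - s)" by simp
  also have "\<dots> = (s - i) + j" using x(2) unfolding ij by simp
  finally have t: "t = (s - i) + j" .
  have s: "s = (s - i) + i" by simp
  show ?thesis using x(1) unfolding ij by (rule that[OF _ s t])
qed

lemma linear_zero_on_axes:
  fixes f :: "V78 \<Rightarrow> 'a::real_vector"
  assumes "linear f" "\<And>t v. f (axis t v) = 0" shows "f u = 0"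
proof -
  have "f u = f (\<Sum>t\<in>UNIV. axis t (u $ t))" using axis_sum[of u] by (rule arg_cong)
  then show ?thesis by (simp only: linear_sum[OF assms(1)] assms(2) sum.neutral_const)
qed

lemma axis_line_vec_ex: "i \<in> {0, 1, 3, 9} \<Longrightarrow> \<exists>x y z. axis (k + i) v = line_vec i k x y z"
proof -
  note a = axis_line_vec[of k "v $ 1" "v $ 2" "v $ 3", unfolded vec3_collapse]
  have "\<exists>x y z. axis (k + 0) v = line_vec 0 k x y z" "\<exists>x y z. axis (k + 1) v = line_vec 1 k x y z"
    "\<exists>x y z. axis (k + 3) v = line_vec 3 k x y z" "\<exists>x y z. axis (k + 9) v = line_vec 9 k x y z"
    unfolding a add_0_right by blast+
  then show "i \<in> {0, 1, 3, 9} \<Longrightarrow> ?thesis" by (elim insertE emptyE) (simp_all only:)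
qed

lemma line_vec_nth: "line_vec i k x y z $ r = (if r - k = i then frame i x y z else 0)"
proof -
  have "k + i = r \<longleftrightarrow> r - k = i" by (auto simp: algebra_simps)
  then show ?thesis by (simp add: line_vec_def axis_nth)
qed

lemma cnj_theta: "cnj \<theta> = - \<theta>"
  by (simp add: omega_simps)

lemma axis_line_vec_0: "\<exists>x y z. axis 0 v = line_vec 0 0 x y z" "\<exists>x y z. axis 1 v = line_vec 1 0 x y z"
  "\<exists>x y z. axis 3 v = line_vec 3 0 x y z"
  using axis_line_vec_ex[of 0 0 v] axis_line_vec_ex[of 1 0 v] axis_line_vec_ex[of 3 0 v] by simp_all

lemma line_vec_inner: "line_vec i k x1 x2 x3 \<bullet> line_vec i k y1 y2 y3 = 3 * Re (x1 * cnj y1 + x2 * cnj y2 + x3 * cnj y3)"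
proof -
  have "frame i x1 x2 x3 \<bullet> frame i y1 y2 y3 = Re (3 * (x1 * cnj y1 + x2 * cnj y2 + x3 * cnj y3))"
    by (simp only: frame_def vec3_inner split: if_split)
      (intro conjI impI arg_cong[where f=Re]; simp add: omega_simps algebra_simps)
  then show ?thesis by (simp add: line_vec_def inner_axis_axis)
qed

lemma line_vec_inner_other: "i \<noteq> j \<Longrightarrow> line_vec i k x1 x2 x3 \<bullet> line_vec j k y1 y2 y3 = 0"
  by (simp add: line_vec_def inner_axis_axis)

context G_product begin

lemma br_line_vec_same: "br (line_vec i k x1 x2 x3) (line_vec i k y1 y2 y3) = 0"
  by (simp add: line_vec_def br_same)

lemma br_swap_axis: "br (axis s u) (axis t v) = - br (axis t v) (axis s u)"
proof (cases "s = t")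
  case True then show ?thesis by (simp add: br_same)
next
  case False
  then obtain k i j where ij: "(i, j) \<in> {(0, 1), (0, 3), (0, 9), (1, 0), (3, 0), (9, 0), (1, 3), (3, 9), (9, 1), (3, 1), (9, 3), (1, 9)}"
    "s = k + i" "t = k + j" by (rule line_pair)
  then have "i \<in> {0, 1, 3, 9}" "j \<in> {0, 1, 3, 9}" by auto
  then obtain x1 x2 x3 y1 y2 y3 where "axis s u = line_vec i k x1 x2 x3" "axis t v = line_vec j k y1 y2 y3"
    unfolding ij using axis_line_vec_ex by metis
  then show ?thesis using ij(1) by (auto simp: br_line_vec line_vec_minus mult_ac)
qed

lemma br_swap: "br u v = - br v u"
proof -
  have "br u v + br v u = 0"
  proof (rule linear_zero_on_axes[of "\<lambda>u. br u v + br v u"])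
    show "linear (\<lambda>u. br u v + br v u)" by (rule linearI) (simp_all add: br_simps algebra_simps)
    show "br (axis t w) v + br v (axis t w) = 0" for t w
    proof (rule linear_zero_on_axes[of "\<lambda>v. br (axis t w) v + br v (axis t w)"])
      show "linear (\<lambda>v. br (axis t w) v + br v (axis t w))" by (rule linearI) (simp_all add: br_simps algebra_simps)
      show "br (axis t w) (axis s x) + br (axis s x) (axis t w) = 0" for s x
        using br_swap_axis[of t w s x] by simp
    qed
  qed
  then show ?thesis by (simp add: eq_neg_iff_add_eq_0)
qed

definition jacobiator :: "V78 \<Rightarrow> V78 \<Rightarrow> V78 \<Rightarrow> V78" where
  "jacobiator u v w = br u (br v w) + br v (br w u) + br w (br u v)"

definition jacobi_on :: "13 \<Rightarrow> 13 \<Rightarrow> 13 \<Rightarrow> bool" where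
  "jacobi_on r s t \<longleftrightarrow> (\<forall>u v w. jacobiator (axis r u) (axis s v) (axis t w) = 0)"

lemma jacobiator_automorphism: "automorphism g \<Longrightarrow> jacobiator (g u) (g v) (g w) = g (jacobiator u v w)"
  by (simp add: jacobiator_def automorphism_br linear_add[OF automorphism_linear])

lemma jacobi_on_transport:
  assumes "automorphism g" "jacobi_on r s t" "\<And>t v. \<exists>w. axis (f t) v = g (axis t w)"
  shows "jacobi_on (f r) (f s) (f t)"
  unfolding jacobi_on_def
proof (intro allI)
  fix u v w
  obtain u' v' w' where "axis (f r) u = g (axis r u')" "axis (f s) v = g (axis s v')" "axis (f t) w = g (axis t w')"
    using assms(3) by metis
  then show "jacobiator (axis (f r) u) (axis (f s) v) (axis (f t) w) = 0"
    using assms(2) by (simp add: jacobiator_automorphism[OF assms(1)] jacobi_on_def linear_0[OF automorphism_linear[OF assms(1)]])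
qed

lemma jacobi_on_shift: assumes "jacobi_on r s t" shows "jacobi_on (r + k) (s + k) (t + k)"
proof -
  obtain n where k: "k = of_nat n" using ex_of_nat_13 by blast
  show ?thesis
    by (rule jacobi_on_transport[OF automorphism_pow[OF automorphism_gens(1), of n] assms, of "\<lambda>t. t + k"]) (auto simp: gen_a_pow k)
qed

lemma jacobi_on_triple: assumes "jacobi_on r s t" shows "jacobi_on (3 * r) (3 * s) (3 * t)"
proof (rule jacobi_on_transport[OF automorphism_gens(2) assms])
  fix t v
  have "axis (3 * t) v = gen_b (axis t (vec3 (\<omega>' * v $ 1) (\<omega> * v $ 2) (\<omega> * v $ 3)))"
    unfolding gen_b_axis by (rule axis_eqI[OF refl]) (simp add: vec3_eq_iff omega_simps algebra_simps)
  then show "\<exists>w. axis (3 * t) v = gen_b (axis t w)" ..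
qed

lemma jacobi_on_c_perm: assumes "jacobi_on r s t" shows "jacobi_on (c_perm r) (c_perm s) (c_perm t)"
proof (rule jacobi_on_transport[OF automorphism_gens(3) assms])
  fix t v
  have "c_perm (c_perm t) = t" by (simp add: c_perm_def)
  then obtain w where "gen_c (axis (c_perm t) v) = axis t w" using gen_c_point[of "c_perm t" v] by auto
  then have "axis (c_perm t) v = gen_c (axis t w)" using gen_c_involution[of "c_perm t" v] by simp
  then show "\<exists>w. axis (c_perm t) v = gen_c (axis t w)" ..
qed

lemma jacobi_on_cycle: "jacobi_on r s t \<Longrightarrow> jacobi_on s t r"
  by (simp add: jacobi_on_def jacobiator_def add_ac)

lemma jacobi_on_swap: assumes "jacobi_on r s t" shows "jacobi_on r t s"
  unfolding jacobi_on_def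
proof (intro allI)
  fix u v w
  have "jacobiator (axis r u) (axis t v) (axis s w) = - jacobiator (axis r u) (axis s w) (axis t v)"
    unfolding jacobiator_def br_swap[of "axis t v" "axis s w"] br_swap[of "axis s w" "axis r u"] br_swap[of "axis r u" "axis t v"]
    by (simp add: br_simps algebra_simps)
  then show "jacobiator (axis r u) (axis t v) (axis s w) = 0" using assms by (simp add: jacobi_on_def)
qed

lemma jacobi_on_triple_orbit: assumes "jacobi_on 0 s t" "(x, y) \<in> triple_orbit s t" shows "jacobi_on 0 x y"
proof -
  have 1: "jacobi_on 0 t' s'" if "jacobi_on 0 s' t'" for s' t' using that by (rule jacobi_on_swap)
  have 2: "jacobi_on 0 (t' - s') (- s')" if "jacobi_on 0 s' t'" for s' t'
    using jacobi_on_shift[OF jacobi_on_cycle[OF that], of "- s'"] by simp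
  have 3: "jacobi_on 0 (- s') (t' - s')" if "jacobi_on 0 s' t'" for s' t' using 1[OF 2[OF that]] .
  have 6: "jacobi_on 0 (- t') (s' - t') \<and> jacobi_on 0 (s' - t') (- t')" if "jacobi_on 0 s' t'" for s' t'
    using 3[OF 1[OF that]] 2[OF 1[OF that]] by blast
  have m: "jacobi_on 0 (3 * s') (3 * t')" if "jacobi_on 0 s' t'" for s' t' using jacobi_on_triple[OF that] by simp
  obtain m where m': "m \<in> {1, 3, 9}" and xy: "(x, y) \<in> {(m * s, m * t), (m * t, m * s), (m * (t - s), - m * s),
      (- m * s, m * (t - s)), (- m * t, m * (s - t)), (m * (s - t), - m * t)}"
    using assms(2) unfolding triple_orbit_def by blast
  have b: "jacobi_on 0 (m * s) (m * t)"
    using m' m[OF assms(1)] m[OF m[OF assms(1)]] assms(1) by auto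
  show ?thesis using xy b 1[OF b] 2[OF b] 3[OF b] 6[OF b]
    by (elim insertE emptyE) (simp_all add: right_diff_distrib)
qed

text \<open>Translate by \<open>k\<close>, apply \<open>gen_c\<close> and translate back.\<close>

lemma jacobi_on_link: assumes "jacobi_on 0 s t" shows "jacobi_on 0 (c_perm (k + s) - c_perm k) (c_perm (k + t) - c_perm k)"
  using jacobi_on_shift[OF jacobi_on_c_perm[OF jacobi_on_shift[OF assms, of k]], of "- c_perm k"] by (simp add: add.commute)

lemma jacobi_on_012: "jacobi_on 0 1 2"
  unfolding jacobi_on_def
proof (intro allI)
  fix u v w
  show "jacobiator (axis 0 u) (axis 1 v) (axis 2 w) = 0"
    using jacobi_012[of "u $ 1" "u $ 2" "u $ 3" "v $ 1" "v $ 2" "v $ 3" "w $ 1" "w $ 2" "w $ 3"]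
    unfolding vec3_collapse jacobiator_def .
qed

lemma jacobi_on_013: "jacobi_on 0 1 3"
proof -
  have "jacobiator (line_vec 0 0 x1 x2 x3) (line_vec 1 0 y1 y2 y3) (line_vec 3 0 z1 z2 z3) = 0" for x1 x2 x3 y1 y2 y3 z1 z2 z3
    unfolding jacobiator_def
    by (simp add: br_line_vec br_simps br_line_vec_same add_ac)
       (simp add: line_vec_minus[symmetric] algebra_simps cnj_theta)
  then show ?thesis unfolding jacobi_on_def using axis_line_vec_0 by metis
qed

lemma jacobi_on_001: "jacobi_on 0 0 1"
proof -
  have "jacobiator (line_vec 0 0 x1 x2 x3) (line_vec 0 0 y1 y2 y3) (line_vec 1 0 z1 z2 z3) = 0" for x1 x2 x3 y1 y2 y3 z1 z2 z3
    unfolding jacobiator_def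
    by (simp add: br_line_vec br_simps br_line_vec_same add_ac)
       (simp add: line_vec_minus[symmetric] algebra_simps cnj_theta)
  then show ?thesis unfolding jacobi_on_def using axis_line_vec_0 by metis
qed

lemma jacobi_on_000: "jacobi_on 0 0 0"
  by (simp add: jacobi_on_def jacobiator_def br_same br_simps)

text \<open>Each use of \<open>gen_c\<close> below leads to a new orbit of triples under the maps behind \<open>triple_orbit\<close>.\<close>

lemma jacobi_on_01: "jacobi_on 0 1 t"
proof -
  have a: "jacobi_on 0 10 8" using jacobi_on_link[OF jacobi_on_triple_orbit[OF jacobi_on_012, of 4 8], of 0] by (simp add: c_perm_def triple_orbit_def)
  have b: "jacobi_on 0 9 10" using jacobi_on_link[OF jacobi_on_triple_orbit[OF jacobi_on_012, of 3 6], of 1] by (simp add: c_perm_def triple_orbit_def)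
  have c: "jacobi_on 0 9 6" using jacobi_on_link[OF jacobi_on_triple_orbit[OF jacobi_on_012, of 3 10], of 1] by (simp add: c_perm_def triple_orbit_def)
  have d: "jacobi_on 0 5 3" using jacobi_on_link[OF jacobi_on_triple_orbit[OF jacobi_on_012, of 4 9], of 1] by (simp add: c_perm_def triple_orbit_def)
  have e: "jacobi_on 0 4 3" using jacobi_on_link[OF jacobi_on_triple_orbit[OF jacobi_on_012, of 5 9], of 1] by (simp add: c_perm_def triple_orbit_def)
  have f: "jacobi_on 0 9 11" using jacobi_on_link[OF jacobi_on_triple_orbit[OF a, of 3 11], of 1] by (simp add: c_perm_def triple_orbit_def)
  have neg_1: "- (1 :: 13) = 12" by simp
  have g: "jacobi_on 0 0 12" using jacobi_on_link[OF jacobi_on_001, of 5] by (simp add: c_perm_def neg_1 mod_13)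
  have "\<forall>t. jacobi_on 0 1 t"
    unfolding forall_13
    by (intro conjI)
      ((rule jacobi_on_triple_orbit[OF jacobi_on_001] jacobi_on_triple_orbit[OF g] jacobi_on_triple_orbit[OF jacobi_on_012] jacobi_on_triple_orbit[OF jacobi_on_013] jacobi_on_triple_orbit[OF a] jacobi_on_triple_orbit[OF b] jacobi_on_triple_orbit[OF c] 
          jacobi_on_triple_orbit[OF d] jacobi_on_triple_orbit[OF e] jacobi_on_triple_orbit[OF f]), simp add: triple_orbit_def; fail)+
  then show ?thesis ..
qed

text \<open>The group is transitive on pairs of distinct points; these three moves suffice to reach every pair
  \<open>(0, s)\<close> from \<open>(0, 1)\<close>.\<close>

lemma jacobi_on_move_second:
  assumes "\<And>t. jacobi_on 0 s t"
  shows "jacobi_on 0 (3 * s) t" "jacobi_on 0 (- s) t" "jacobi_on 0 (c_perm (s + k) - c_perm k) t"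
proof -
  have "3 * (9 * t) = (27 :: 13) * t" by simp
  then have "3 * (9 * t) = t" by (simp only: mod_13 mult_1)
  then show "jacobi_on 0 (3 * s) t" using jacobi_on_triple[OF assms[of "9 * t"]] by (simp only: mult_zero_right)
  have "jacobi_on s 0 (t + s)" by (rule jacobi_on_cycle[OF jacobi_on_cycle[OF jacobi_on_swap[OF assms]]])
  then show "jacobi_on 0 (- s) t" using jacobi_on_shift[of s 0 "t + s" "- s"] by simp
  show "jacobi_on 0 (c_perm (s + k) - c_perm k) t"
    using jacobi_on_shift[OF jacobi_on_c_perm[OF jacobi_on_shift[OF assms[of "c_perm (t + c_perm k) - k"], of k]], of "- c_perm k"] by (simp add: c_perm_c_perm)
qed

lemma jacobi_on_all: "jacobi_on r s t"
proof -
  have 1: "\<forall>t. jacobi_on 0 1 t" using jacobi_on_01 by blast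
  have m3: "\<forall>t. jacobi_on 0 s t \<Longrightarrow> s' = 3 * s \<Longrightarrow> \<forall>t. jacobi_on 0 s' t" for s s' using jacobi_on_move_second(1) by blast
  have neg: "\<forall>t. jacobi_on 0 s t \<Longrightarrow> s' = - s \<Longrightarrow> \<forall>t. jacobi_on 0 s' t" for s s' using jacobi_on_move_second(2) by blast
  have 3: "\<forall>t. jacobi_on 0 3 t" by (rule m3[OF 1]) simp
  have 9: "\<forall>t. jacobi_on 0 9 t" by (rule m3[OF 3]) simp
  have 12: "\<forall>t. jacobi_on 0 12 t" by (rule neg[OF 1]) simp
  have 10: "\<forall>t. jacobi_on 0 10 t" by (rule neg[OF 3]) simp
  have 4: "\<forall>t. jacobi_on 0 4 t" by (rule neg[OF 9]) simp
  have 7: "\<forall>t. jacobi_on 0 7 t" using jacobi_on_move_second(3)[of 1 2] 1 by (simp add: c_perm_def)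
  have 8: "\<forall>t. jacobi_on 0 8 t" by (rule m3[OF 7]) simp
  have 11: "\<forall>t. jacobi_on 0 11 t" by (rule m3[OF 8]) simp
  have 6: "\<forall>t. jacobi_on 0 6 t" by (rule neg[OF 7]) simp
  have 5: "\<forall>t. jacobi_on 0 5 t" by (rule neg[OF 8]) simp
  have 2: "\<forall>t. jacobi_on 0 2 t" by (rule neg[OF 11]) simp
  have nz: "\<forall>s. s \<noteq> 0 \<longrightarrow> (\<forall>t. jacobi_on 0 s t)"
    unfolding forall_13[of "\<lambda>s. s \<noteq> 0 \<longrightarrow> (\<forall>t. jacobi_on 0 s t)"] using 1 2 3 4 5 6 7 8 9 10 11 12 by blast
  have "jacobi_on 0 x y" for x y
  proof (cases "x = 0")
    case True
    show ?thesis
    proof (cases "y = 0")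
      case True then show ?thesis using jacobi_on_000 \<open>x = 0\<close> by simp
    next
      case False then show ?thesis using jacobi_on_swap[of 0 y 0] nz \<open>x = 0\<close> by simp
    qed
  next
    case False then show ?thesis using nz by blast
  qed
  from jacobi_on_shift[OF this[of "s - r" "t - r"], of r] show ?thesis by simp
qed

lemma linear_jacobiator: "linear (\<lambda>u. jacobiator u v w)" "linear (\<lambda>v. jacobiator u v w)" "linear (jacobiator u v)"
  by (rule linearI; simp add: jacobiator_def br_simps algebra_simps)+

theorem jacobi: "br u (br v w) + br v (br w u) + br w (br u v) = 0"
proof -
  have 3: "jacobiator (axis r x) (axis s y) w = 0" for r x s y w
    by (rule linear_zero_on_axes[OF linear_jacobiator(3)]) (use jacobi_on_all in \<open>simp add: jacobi_on_def\<close>)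
  have 2: "jacobiator (axis r x) v w = 0" for r x v w
    by (rule linear_zero_on_axes[OF linear_jacobiator(2)]) (rule 3)
  have "jacobiator u v w = 0"
    by (rule linear_zero_on_axes[OF linear_jacobiator(1)]) (rule 2)
  then show ?thesis by (simp only: jacobiator_def)
qed

section \<open>Invariance of the inner product\<close>

definition line_triples :: "(13 \<times> 13 \<times> 13) set" where
  "line_triples = {(i, j, l). i \<in> {0, 1, 3, 9} \<and> j \<in> {0, 1, 3, 9} \<and> l \<in> {0, 1, 3, 9} \<and> i \<noteq> j \<and> j \<noteq> l \<and> l \<noteq> i}"

definition collinear :: "13 \<Rightarrow> 13 \<Rightarrow> 13 \<Rightarrow> bool" where
  "collinear r s t \<longleftrightarrow> (\<exists>k. (r - k, s - k, t - k) \<in> line_triples)"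

lemma collinear_cycle: "collinear r s t \<Longrightarrow> collinear s t r"
  by (auto simp: collinear_def line_triples_def)

lemma br_axis_nth_eq_0: assumes "\<not> collinear s t r" shows "br (axis s u) (axis t v) $ r = 0"
proof (cases "s = t")
  case True then show ?thesis by (simp add: br_same)
next
  case False
  then obtain k i j where ij: "(i, j) \<in> {(0, 1), (0, 3), (0, 9), (1, 0), (3, 0), (9, 0), (1, 3), (3, 9), (9, 1), (3, 1), (9, 3), (1, 9)}"
    "s = k + i" "t = k + j" by (rule line_pair)
  then have "i \<in> {0, 1, 3, 9}" "j \<in> {0, 1, 3, 9}" by auto
  then obtain x1 x2 x3 y1 y2 y3 where line_vec: "axis s u = line_vec i k x1 x2 x3" "axis t v = line_vec j k y1 y2 y3"
    unfolding ij using axis_line_vec_ex by metis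
  have "s - k = i" "t - k = j" unfolding ij by simp_all
  then have n: "(i, j, r - k) \<notin> line_triples" using assms unfolding collinear_def by blast
  show ?thesis
    unfolding line_vec using ij(1)
  proof (elim insertE emptyE)
  qed (use n in \<open>auto simp: br_line_vec line_vec_nth line_triples_def\<close>)
qed

text \<open>Off the lines both sides vanish. On a line they are real parts of \<open>9 * \<theta>\<close> times products of conjugated
  coordinates; as \<open>\<theta>\<close> is purely imaginary, conjugation changes the sign as the table requires.\<close>

lemma br_invariant_axis: "br (axis r u) (axis s v) \<bullet> axis t w = axis r u \<bullet> br (axis s v) (axis t w)"
proof (cases "collinear r s t")
  case False
  then have "\<not> collinear s t r" using collinear_cycle by blast
  then show ?thesis using False by (simp add: inner_axis inner_commute[of "axis r u"] br_axis_nth_eq_0)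
next
  case True
  then obtain k where k: "(r - k, s - k, t - k) \<in> line_triples" by (auto simp: collinear_def)
  define i j l where ijl: "i = r - k" "j = s - k" "l = t - k"
  then have "i \<in> {0, 1, 3, 9}" "j \<in> {0, 1, 3, 9}" "l \<in> {0, 1, 3, 9}" using k by (auto simp: line_triples_def)
  moreover have rst: "r = k + i" "s = k + j" "t = k + l" by (simp_all add: ijl)
  ultimately obtain x1 x2 x3 y1 y2 y3 z1 z2 z3 where line_vec: "axis r u = line_vec i k x1 x2 x3" "axis s v = line_vec j k y1 y2 y3" "axis t w = line_vec l k z1 z2 z3"
    using axis_line_vec_ex by metis
  have "Re \<theta> = 0" by (simp add: theta_eq omega_eq)
  then show ?thesis unfolding line_vec using k unfolding ijl[symmetric] line_triples_def
    by (auto simp: br_line_vec inner_add_left inner_add_right line_vec_inner line_vec_inner_other algebra_simps)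
qed

theorem invariant: "br u v \<bullet> w = u \<bullet> br v w"
proof -
  let ?D = "\<lambda>u v w. br u v \<bullet> w - u \<bullet> br v w"
  have lin: "linear (\<lambda>u. ?D u v w)" "linear (\<lambda>v. ?D u v w)" "linear (?D u v)" for u v w
    by (rule linearI; simp add: br_simps inner_simps algebra_simps)+
  have 3: "?D (axis r x) (axis s y) w = 0" for r x s y w
    by (rule linear_zero_on_axes[OF lin(3)]) (simp add: br_invariant_axis)
  have 2: "?D (axis r x) v w = 0" for r x v w
    by (rule linear_zero_on_axes[OF lin(2)]) (rule 3)
  have "?D u v w = 0"
    by (rule linear_zero_on_axes[OF lin(1)]) (rule 2)
  then show ?thesis by simp
qed

end

section \<open>The 36 rotation planes\<close>

definition coord_vec :: "13 \<Rightarrow> 13 \<Rightarrow> nat \<Rightarrow> complex \<Rightarrow> V78" where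
  "coord_vec i k m x = line_vec i k (if m = 1 then x else 0) (if m = 2 then x else 0) (if m = 3 then x else 0)"

definition next_pt :: "13 \<Rightarrow> 13" where
  "next_pt i = (if i = 1 then 3 else if i = 3 then 9 else 1)"

text \<open>Let 0 have position \<open>i\<close> on a line and character \<open>p\<close>. The characters \<open>q\<close>, \<open>q + p\<close>, \<open>q + 2p\<close> with
  \<open>\<langle>p, q\<rangle> = 1\<close> represent the other three points, and on their coefficients an element of \<open>V\<^sub>0\<close> acts by a
  circulant matrix, with eigenvectors \<open>(1, \<zeta>, \<zeta>\<^sup>2)\<close> for \<open>\<zeta>\<^sup>3 = 1\<close>. For \<open>i \<noteq> 0\<close> two of these characters are
  the negatives of the vectors attached to the points, which accounts for the terms \<open>- cnj\<close>.\<close>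

definition plane_vec :: "13 \<Rightarrow> nat \<Rightarrow> complex \<Rightarrow> complex \<Rightarrow> V78" where
  "plane_vec i m \<zeta> \<eta> =
    (if i = 0 then coord_vec 1 0 m \<eta> + coord_vec 3 0 m (\<zeta> * \<eta>) + coord_vec 9 0 m (\<zeta> * \<zeta> * \<eta>)
     else coord_vec 0 (- i) m (- cnj \<eta>) + coord_vec (next_pt (next_pt i)) (- i) m (\<zeta> * \<eta>)
       + coord_vec (next_pt i) (- i) m (- cnj (\<zeta> * \<zeta> * \<eta>)))"

type_synonym root_label = "13 \<times> nat \<times> nat \<times> bool \<times> nat list"

text \<open>An entry \<open>(i, m, a, b, cs)\<close> names the line on which 0 has position \<open>i\<close>, the copy \<open>m\<close> of \<open>su(3)\<close> on it and
  the eigenvector with \<open>\<zeta> = \<omega> ^ a\<close>. If \<open>b\<close> is false, the root is replaced by its negative, so that the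
  list \<open>cs\<close> of coordinates in the simple roots, in Bourbaki's order, has no negative entries.\<close>

definition root_table :: "root_label list" where
  "root_table =
    [(0, 1, 0, True, [1, 2, 2, 3, 2, 1]),
     (0, 1, 1, False, [1, 1, 2, 3, 2, 1]),
     (0, 1, 2, False, [0, 1, 0, 0, 0, 0]),
     (0, 2, 0, True, [0, 0, 1, 0, 0, 0]),
     (0, 2, 1, False, [1, 0, 1, 0, 0, 0]),
     (0, 2, 2, True, [1, 0, 0, 0, 0, 0]),
     (0, 3, 0, True, [0, 0, 0, 0, 1, 0]),
     (0, 3, 1, False, [0, 0, 0, 0, 1, 1]),
     (0, 3, 2, True, [0, 0, 0, 0, 0, 1]),
     (1, 1, 0, True, [1, 0, 1, 1, 1, 1]),
     (1, 1, 1, True, [0, 1, 1, 1, 1, 0]),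
     (1, 1, 2, False, [1, 1, 2, 2, 2, 1]),
     (1, 2, 0, False, [0, 1, 1, 2, 1, 1]),
     (1, 2, 1, True, [0, 0, 1, 1, 0, 0]),
     (1, 2, 2, True, [0, 1, 0, 1, 1, 1]),
     (1, 3, 0, False, [1, 1, 1, 2, 1, 0]),
     (1, 3, 1, True, [0, 0, 0, 1, 1, 0]),
     (1, 3, 2, True, [1, 1, 1, 1, 0, 0]),
     (3, 1, 0, False, [0, 1, 1, 2, 1, 0]),
     (3, 1, 1, True, [0, 0, 1, 1, 1, 0]),
     (3, 1, 2, True, [0, 1, 0, 1, 0, 0]),
     (3, 2, 0, False, [1, 1, 1, 2, 2, 1]),
     (3, 2, 1, True, [0, 0, 0, 1, 1, 1]),
     (3, 2, 2, True, [1, 1, 1, 1, 1, 0]),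
     (3, 3, 0, False, [1, 1, 2, 2, 1, 1]),
     (3, 3, 1, True, [1, 0, 1, 1, 0, 0]),
     (3, 3, 2, True, [0, 1, 1, 1, 1, 1]),
     (9, 1, 0, True, [0, 0, 0, 1, 0, 0]),
     (9, 1, 1, True, [1, 1, 1, 1, 1, 1]),
     (9, 1, 2, False, [1, 1, 1, 2, 1, 1]),
     (9, 2, 0, True, [1, 0, 1, 1, 1, 0]),
     (9, 2, 1, True, [0, 1, 1, 1, 0, 0]),
     (9, 2, 2, False, [1, 1, 2, 2, 1, 0]),
     (9, 3, 0, True, [0, 0, 1, 1, 1, 1]),
     (9, 3, 1, True, [0, 1, 0, 1, 1, 0]),
     (9, 3, 2, False, [0, 1, 1, 2, 2, 1])]"

text \<open>The factor \<open>2 * sqrt 3\<close> makes the inner product with an element of \<open>V\<^sub>0\<close> equal to the speed of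
  rotation found in \<open>plane_vec_eigen\<close>.\<close>

fun root_dual :: "root_label \<Rightarrow> V78" where
  "root_dual (i, m, a, b, cs) = (if b then 1 else - 1) *\<^sub>R coord_vec i (- i) m (of_real (2 * sqrt 3) * \<omega> ^ a)"

text \<open>Reversing the sign of a root exchanges the two spanning vectors of its plane.\<close>

fun plane_1 :: "root_label \<Rightarrow> V78" where
  "plane_1 (i, m, a, b, cs) = plane_vec i m (\<omega> ^ a) (if b then 1 else \<i>)"

fun plane_2 :: "root_label \<Rightarrow> V78" where
  "plane_2 (i, m, a, b, cs) = plane_vec i m (\<omega> ^ a) (if b then \<i> else 1)"

fun simple_coeff :: "root_label \<Rightarrow> nat \<Rightarrow> nat" where
  "simple_coeff (i, m, a, b, cs) j = cs ! (j - 1)"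

definition simple_label :: "nat \<Rightarrow> root_label" where
  "simple_label j = [(0, 2, 2, True, [1, 0, 0, 0, 0, 0]), (0, 1, 2, False, [0, 1, 0, 0, 0, 0]),
    (0, 2, 0, True, [0, 0, 1, 0, 0, 0]), (9, 1, 0, True, [0, 0, 0, 1, 0, 0]),
    (0, 3, 0, True, [0, 0, 0, 0, 1, 0]), (0, 3, 2, True, [0, 0, 0, 0, 0, 1])] ! (j - 1)"

lemma atLeastAtMost_1_6: "{1..6::nat} = {1, 2, 3, 4, 5, 6}"
  by auto

lemma omega_power: "\<omega> ^ 0 = 1" "\<omega> ^ 2 = - 1 - \<omega>" "\<omega> ^ 1 = \<omega>" 
  by (simp_all add: power2_eq_square omega_sq)

lemma minus_points: "- (1 :: 13) = 12" "- (3 :: 13) = 10" "- (9 :: 13) = 4"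
  by simp_all

lemma coord_vec_scaleR: "r *\<^sub>R coord_vec i k m x = coord_vec i k m (of_real r * x)"
  by (simp add: coord_vec_def line_vec_scaleR if_distrib[of "(*) (of_real r)"] cong: if_cong)

lemma coord_vec_add: "coord_vec i k m x + coord_vec i k m y = coord_vec i k m (x + y)"
  by (auto simp: coord_vec_def line_vec_add intro!: arg_cong2[where f="line_vec i k _"] arg_cong[where f="line_vec i k _ _"])

lemma coord_vec_minus: "- coord_vec i k m x = coord_vec i k m (- x)"
  by (simp add: coord_vec_def line_vec_minus if_distrib[of uminus] cong: if_cong)

lemma coord_vec_diff: "coord_vec i k m (x - y) = coord_vec i k m x - coord_vec i k m y"
  by (simp only: diff_conv_add_uminus coord_vec_minus coord_vec_add)

lemma plane_vec_add: "plane_vec i m z (x + y) = plane_vec i m z x + plane_vec i m z y"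
  by (simp add: plane_vec_def distrib_left coord_vec_add[symmetric] coord_vec_minus[symmetric] coord_vec_diff)

lemma plane_vec_scaleR: "plane_vec i m z (of_real r * x) = r *\<^sub>R plane_vec i m z x"
  by (simp add: plane_vec_def scaleR_add_right scaleR_diff_right coord_vec_scaleR coord_vec_minus[symmetric] mult_ac)

lemma coord_vec_inner: "m \<in> {1, 2, 3} \<Longrightarrow> coord_vec i k m x \<bullet> line_vec i k c1 c2 c3 = 3 * Re (x * cnj (if m = 1 then c1 else if m = 2 then c2 else c3))"
  by (auto simp: coord_vec_def line_vec_inner)

lemma coord_vec_inner_self: "m \<in> {1, 2, 3} \<Longrightarrow> coord_vec i k m x \<bullet> coord_vec i k m y = 3 * Re (x * cnj y)"
  by (auto simp: coord_vec_def line_vec_inner)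

lemma coord_vec_inner_other: "i \<noteq> j \<Longrightarrow> coord_vec i k m x \<bullet> coord_vec j k m' y = 0"
  by (simp add: coord_vec_def line_vec_inner_other)

lemma root_table_lengths: "\<forall>r\<in>set root_table. (case r of (i, m, a, b, cs) \<Rightarrow> i \<in> {0, 1, 3, 9} \<and> m \<in> {1, 2, 3} \<and> a \<in> {0, 1, 2} \<and> length cs = 6)"
  by (simp add: root_table_def)

lemma root_table_complete:
  "\<forall>i\<in>{0, 1, 3, 9}. \<forall>m\<in>{1, 2, 3}. \<forall>a\<in>{0, 1, 2}. \<exists>b cs. (i, m, a, b, cs) \<in> set root_table"
  by (simp add: root_table_def ex_bool_eq)

lemma root_table_distinct: "distinct (map (\<lambda>(i, m, a, b, cs). cs) root_table)"
  by (simp add: root_table_def)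

lemma simple_label_in: "j \<in> {1..6} \<Longrightarrow> simple_label j \<in> set root_table"
  unfolding atLeastAtMost_1_6 by (elim insertE emptyE) (simp_all add: simple_label_def root_table_def)

lemma root_dual_sum: "\<forall>r\<in>set root_table. root_dual r = (\<Sum>j\<in>{1..6}. real (simple_coeff r j) *\<^sub>R root_dual (simple_label j))"
proof -
  have "\<forall>r\<in>set root_table. root_dual r = (\<Sum>j\<in>{1, 2, 3, 4, 5, 6}. real (simple_coeff r j) *\<^sub>R root_dual (simple_label j))"
    unfolding root_table_def
    by (simp add: simple_label_def coord_vec_def line_vec_def minus_points frame_def mod_13 axis_algebra vec3_algebra)
       (simp add: axis_eq_axis vec3_eq_iff scaleR_conv_of_real[where 'a=complex] omega_power omega_simps algebra_simps)
  then show ?thesis by (simp only: atLeastAtMost_1_6)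
qed

lemma line_vec_split:
  "line_vec i k (a + b) 0 0 = line_vec i k a 0 0 + line_vec i k b 0 0" "line_vec i k 0 (a + b) 0 = line_vec i k 0 a 0 + line_vec i k 0 b 0"
  "line_vec i k 0 0 (a + b) = line_vec i k 0 0 a + line_vec i k 0 0 b"
  "line_vec i k (a - b) 0 0 = line_vec i k a 0 0 - line_vec i k b 0 0" "line_vec i k 0 (a - b) 0 = line_vec i k 0 a 0 - line_vec i k 0 b 0"
  "line_vec i k 0 0 (a - b) = line_vec i k 0 0 a - line_vec i k 0 0 b"
  "line_vec i k (- a) 0 0 = - line_vec i k a 0 0" "line_vec i k 0 (- a) 0 = - line_vec i k 0 a 0" "line_vec i k 0 0 (- a) = - line_vec i k 0 0 a"
  by (simp_all add: line_vec_add line_vec_minus diff_conv_add_uminus del: add_uminus_conv_diff)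

lemma omega_basis_zero: "of_real p + of_real q * \<omega> = 0 \<longleftrightarrow> p = 0 \<and> q = 0"
  by (auto simp: omega_eq complex_eq_iff)

lemma omega_power_unit:
  assumes "a \<in> {0, 1, 2}" shows "\<omega> ^ a * \<omega> ^ a * \<omega> ^ a = 1" "cnj (\<omega> ^ a) = \<omega> ^ a * \<omega> ^ a"
  using assms by (auto simp: power2_eq_square omega_simps algebra_simps)

context G_product begin

text \<open>With \<open>c\<close> the coordinate of the element of \<open>V\<^sub>0\<close>, the eigenvalue of the circulant matrix is
  \<open>3 * \<theta> * (\<zeta> * cnj c + cnj \<zeta> * c)\<close>, which is purely imaginary.\<close>

lemma plane_vec_eigen:
  assumes i: "i \<in> {0, 1, 3, 9}" and m: "m \<in> {1, 2, 3}" and z: "z * z * z = 1" "cnj z = z * z"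
  shows "br (axis 0 u) (plane_vec i m z \<eta>) = plane_vec i m z (\<i> * of_real (coord_vec i (- i) m (of_real (2 * sqrt 3) * z) \<bullet> axis 0 u) * \<eta>)"
proof -
  have z3: "z * (z * z) = 1" "z * (z * (z * x)) = x" for x using z(1) by (simp_all flip: mult.assoc)
  have th: "\<theta> = \<i> * of_real (sqrt 3)" by (simp add: theta_eq omega_eq complex_eq_iff)
  have "\<exists>c1 c2 c3. axis (- i + i) u = line_vec i (- i) c1 c2 c3" using i by (rule axis_line_vec_ex)
  then obtain c1 c2 c3 where c: "axis 0 u = line_vec i (- i) c1 c2 c3" by auto
  define c where "c = (if m = 1 then c1 else if m = 2 then c2 else c3)"
  have pair: "\<i> * of_real (coord_vec i (- i) m (of_real (2 * sqrt 3) * z) \<bullet> axis 0 u) * x = 3 * \<theta> * (z * cnj c + z * z * c) * x" for x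
  proof -
    have 1: "of_real (2 * Re (z * cnj c)) = z * cnj c + z * z * c"
      using complex_add_cnj[of "z * cnj c"] z(2) by (simp add: mult_ac)
    have 2: "coord_vec i (- i) m (of_real (2 * sqrt 3) * z) \<bullet> axis 0 u = 3 * sqrt 3 * (2 * Re (z * cnj c))"
      unfolding c coord_vec_inner[OF m] c_def[symmetric] by (simp add: algebra_simps)
    show ?thesis unfolding 2 of_real_mult[of "3 * sqrt 3"] 1 th by (simp add: algebra_simps)
  qed
  show ?thesis
    unfolding pair unfolding c using i
  proof (elim insertE emptyE)
    assume i: "i = 0"
    show "br (line_vec i (- i) c1 c2 c3) (plane_vec i m z \<eta>) = plane_vec i m z (3 * \<theta> * (z * cnj c + z * z * c) * \<eta>)"
      using m unfolding i c_def
      by (auto simp: plane_vec_def coord_vec_def next_pt_def br_simps br_line_vec)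
         (simp_all add: algebra_simps z3 z(2) cnj_theta line_vec_split)
  next
    assume i: "i = 1"
    show "br (line_vec i (- i) c1 c2 c3) (plane_vec i m z \<eta>) = plane_vec i m z (3 * \<theta> * (z * cnj c + z * z * c) * \<eta>)"
      using m unfolding i c_def
      by (auto simp: plane_vec_def coord_vec_def next_pt_def br_simps br_line_vec)
         (simp_all add: algebra_simps z3 z(2) cnj_theta line_vec_split)
  next
    assume i: "i = 3"
    show "br (line_vec i (- i) c1 c2 c3) (plane_vec i m z \<eta>) = plane_vec i m z (3 * \<theta> * (z * cnj c + z * z * c) * \<eta>)"
      using m unfolding i c_def
      by (auto simp: plane_vec_def coord_vec_def next_pt_def br_simps br_line_vec)
         (simp_all add: algebra_simps z3 z(2) cnj_theta line_vec_split)
  next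
    assume i: "i = 9"
    show "br (line_vec i (- i) c1 c2 c3) (plane_vec i m z \<eta>) = plane_vec i m z (3 * \<theta> * (z * cnj c + z * z * c) * \<eta>)"
      using m unfolding i c_def
      by (auto simp: plane_vec_def coord_vec_def next_pt_def br_simps br_line_vec)
         (simp_all add: algebra_simps z3 z(2) cnj_theta line_vec_split)
  qed
qed

lemma root_plane:
  assumes "r \<in> set root_table"
  shows "br (axis 0 u) (plane_1 r) = (root_dual r \<bullet> axis 0 u) *\<^sub>R plane_2 r"
    "br (axis 0 u) (plane_2 r) = - (root_dual r \<bullet> axis 0 u) *\<^sub>R plane_1 r"
proof -
  obtain i m a b cs where r: "r = (i, m, a, b, cs)" by (cases r)
  have im: "i \<in> {0, 1, 3, 9}" "m \<in> {1, 2, 3}" "a \<in> {0, 1, 2}"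
    using bspec[OF root_table_lengths assms] unfolding r by simp_all
  note e = plane_vec_eigen[OF im(1,2) omega_power_unit[OF im(3)], of u]
  let ?w = "coord_vec i (- i) m (of_real (2 * sqrt 3) * \<omega> ^ a) \<bullet> axis 0 u"
  have i1: "\<i> * of_real w * 1 = of_real w * \<i>" and i2: "\<i> * of_real w * \<i> = of_real (- w) * 1" for w
    by (simp_all add: complex_eq_iff)
  have 1: "br (axis 0 u) (plane_vec i m (\<omega> ^ a) 1) = ?w *\<^sub>R plane_vec i m (\<omega> ^ a) \<i>"
    unfolding e i1 plane_vec_scaleR ..
  have 2: "br (axis 0 u) (plane_vec i m (\<omega> ^ a) \<i>) = - ?w *\<^sub>R plane_vec i m (\<omega> ^ a) 1"
    unfolding e i2 plane_vec_scaleR ..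
  show "br (axis 0 u) (plane_1 r) = (root_dual r \<bullet> axis 0 u) *\<^sub>R plane_2 r"
    "br (axis 0 u) (plane_2 r) = - (root_dual r \<bullet> axis 0 u) *\<^sub>R plane_1 r"
    using 1 2 by (simp_all add: r)
qed

end

lemma plane_vec_nz: 
  assumes "i \<in> {0, 1, 3, 9}" "m \<in> {1, 2, 3}" "\<eta> \<noteq> 0" shows "plane_vec i m z \<eta> \<noteq> 0"
proof
  assume 0: "plane_vec i m z \<eta> = 0"
  \<comment> \<open>the first of the three orthogonal terms of \<open>plane_vec\<close>\<close>
  let ?f = "if i = 0 then coord_vec 1 0 m \<eta> else coord_vec 0 (- i) m (- cnj \<eta>)"
  have "?f \<bullet> plane_vec i m z \<eta> = ?f \<bullet> ?f"
    using assms(1) by (auto simp: plane_vec_def inner_add_right inner_diff_right coord_vec_inner_other next_pt_def)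
  moreover have "?f \<bullet> ?f = 3 * Re (\<eta> * cnj \<eta>)" using assms(2) by (auto simp: coord_vec_inner_self)
  moreover have "Re (\<eta> * cnj \<eta>) = (cmod \<eta>)\<^sup>2" unfolding cmod_power2 by (simp add: power2_eq_square)
  ultimately have "3 * (cmod \<eta>)\<^sup>2 = 0" unfolding 0 by (simp only: inner_zero_right)
  then show False using assms(3) by simp
qed

text \<open>Fourier inversion over the cube roots of unity recovers the single coordinates from the planes.\<close>

lemma plane_vec_sums_0:
  "plane_vec 0 m 1 x + plane_vec 0 m \<omega> x + plane_vec 0 m (\<omega> * \<omega>) x = coord_vec 1 0 m x + coord_vec 1 0 m x + coord_vec 1 0 m x"
  "plane_vec 0 m 1 x + plane_vec 0 m \<omega> (\<omega> * \<omega> * x) + plane_vec 0 m (\<omega> * \<omega>) (\<omega> * x) = coord_vec 3 0 m x + coord_vec 3 0 m x + coord_vec 3 0 m x"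
  "plane_vec 0 m 1 x + plane_vec 0 m \<omega> (\<omega> * x) + plane_vec 0 m (\<omega> * \<omega>) (\<omega> * \<omega> * x) = coord_vec 9 0 m x + coord_vec 9 0 m x + coord_vec 9 0 m x"
  by (simp_all add: plane_vec_def) (simp_all add: omega_simps algebra_simps coord_vec_diff coord_vec_minus[symmetric] coord_vec_add[symmetric])

lemma plane_vec_sums:
  assumes "i \<noteq> 0"
  shows "plane_vec i m 1 x + plane_vec i m \<omega> x + plane_vec i m (\<omega> * \<omega>) x = - (coord_vec 0 (- i) m (cnj x) + coord_vec 0 (- i) m (cnj x) + coord_vec 0 (- i) m (cnj x))"
  "plane_vec i m 1 x + plane_vec i m \<omega> (\<omega> * \<omega> * x) + plane_vec i m (\<omega> * \<omega>) (\<omega> * x)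
    = coord_vec (next_pt (next_pt i)) (- i) m x + coord_vec (next_pt (next_pt i)) (- i) m x + coord_vec (next_pt (next_pt i)) (- i) m x"
  "plane_vec i m 1 x + plane_vec i m \<omega> (\<omega> * x) + plane_vec i m (\<omega> * \<omega>) (\<omega> * \<omega> * x)
    = - (coord_vec (next_pt i) (- i) m (cnj x) + coord_vec (next_pt i) (- i) m (cnj x) + coord_vec (next_pt i) (- i) m (cnj x))"
  using assms
  by (simp_all add: plane_vec_def) (simp_all add: omega_simps algebra_simps coord_vec_diff coord_vec_minus[symmetric] coord_vec_add[symmetric])

lemma root_planes_span: "span (range (axis 0) \<union> plane_1 ` set root_table \<union> plane_2 ` set root_table) = (UNIV :: V78 set)"
proof -
  let ?S = "span (range (axis 0) \<union> plane_1 ` set root_table \<union> plane_2 ` set root_table)"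
  have unit: "plane_vec i m (\<omega> ^ a) 1 \<in> ?S \<and> plane_vec i m (\<omega> ^ a) \<i> \<in> ?S"
    if "i \<in> {0, 1, 3, 9}" "m \<in> {1, 2, 3}" "a \<in> {0, 1, 2}" for i m a
  proof -
    obtain b cs where r: "(i, m, a, b, cs) \<in> set root_table" using root_table_complete \<open>i \<in> _\<close> \<open>m \<in> _\<close> \<open>a \<in> _\<close> by blast
    have "plane_1 (i, m, a, b, cs) \<in> ?S" "plane_2 (i, m, a, b, cs) \<in> ?S"
      using r by (blast intro: span_base)+
    then show ?thesis by (cases b) simp_all
  qed
  have pw: "plane_vec i m (\<omega> ^ a) x \<in> ?S" if "i \<in> {0, 1, 3, 9}" "m \<in> {1, 2, 3}" "a \<in> {0, 1, 2}" for i m a x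
  proof -
    have "x = of_real (Re x) * 1 + of_real (Im x) * \<i>" by (simp add: complex_eq_iff)
    then have "plane_vec i m (\<omega> ^ a) x = Re x *\<^sub>R plane_vec i m (\<omega> ^ a) 1 + Im x *\<^sub>R plane_vec i m (\<omega> ^ a) \<i>"
      by (metis plane_vec_add plane_vec_scaleR)
    then show ?thesis using unit[OF that] by (simp add: span_add span_scale)
  qed
  have P: "plane_vec i m 1 x \<in> ?S" "plane_vec i m \<omega> x \<in> ?S" "plane_vec i m (\<omega> * \<omega>) x \<in> ?S"
    if "i \<in> {0, 1, 3, 9}" "m \<in> {1, 2, 3}" for i m x
    using pw[OF that, of 0 x] pw[OF that, of 1 x] pw[OF that, of 2 x] by (simp_all add: power2_eq_square)
  have third: "y \<in> ?S" if "y + y + y \<in> ?S" for y :: V78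
  proof -
    have "y = (1 / 3) *\<^sub>R (y + y + y)" by (simp add: vec_eq_iff scaleR_conv_of_real[where 'a=complex] algebra_simps)
    then show ?thesis using span_scale[OF that, of "1 / 3"] by simp
  qed
  have neg: "y \<in> ?S" if "- y \<in> ?S" for y :: V78 using span_neg[OF that] by simp
  have pl0: "coord_vec 1 0 m x \<in> ?S" "coord_vec 3 0 m x \<in> ?S" "coord_vec 9 0 m x \<in> ?S" if "m \<in> {1, 2, 3}" for m x
    by (rule third, unfold plane_vec_sums_0[symmetric], intro span_add P; use that in simp)+
  have pln: "coord_vec 0 (- i) m x \<in> ?S" "coord_vec (next_pt (next_pt i)) (- i) m x \<in> ?S" "coord_vec (next_pt i) (- i) m x \<in> ?S"
    if i: "i \<in> {1, 3, 9}" and m: "m \<in> {1, 2, 3}" for i m x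
  proof -
    have i': "i \<noteq> 0" "i \<in> {0, 1, 3, 9}" using i by auto
    note s = plane_vec_sums[OF i'(1), of m "cnj x", unfolded complex_cnj_cnj] plane_vec_sums[OF i'(1), of m x]
    show "coord_vec 0 (- i) m x \<in> ?S"
      by (rule third, rule neg, unfold s(1)[symmetric], intro span_add P i' m)
    show "coord_vec (next_pt (next_pt i)) (- i) m x \<in> ?S"
      by (rule third, unfold s(5)[symmetric], intro span_add P i' m)
    show "coord_vec (next_pt i) (- i) m x \<in> ?S"
      by (rule third, rule neg, unfold s(3)[symmetric], intro span_add P i' m)
  qed
  have lvS: "line_vec j k x y z \<in> ?S" if "\<And>m w. m \<in> {1, 2, 3} \<Longrightarrow> coord_vec j k m w \<in> ?S" for j k x y z
  proof -
    have "line_vec j k x y z = coord_vec j k 1 x + coord_vec j k 2 y + coord_vec j k 3 z" by (simp add: coord_vec_def line_vec_add)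
    also have "\<dots> \<in> ?S" by (intro span_add that) simp_all
    finally show ?thesis .
  qed
  have ax: "axis (k + j) v \<in> ?S" if "j \<in> {0, 1, 3, 9}" "\<And>m w. m \<in> {1, 2, 3} \<Longrightarrow> coord_vec j k m w \<in> ?S" for j k v
    using axis_line_vec_ex[OF that(1), of k v] lvS[OF that(2)] by metis
  note n1 = pln[of 1, unfolded minus_points next_pt_def, simplified]
  note n3 = pln[of 3, unfolded minus_points next_pt_def, simplified]
  note n9 = pln[of 9, unfolded minus_points next_pt_def, simplified]
  have "\<forall>t. \<forall>v. axis t v \<in> ?S"
    unfolding forall_13[of "\<lambda>t. \<forall>v. axis t v \<in> ?S"]
  proof (intro conjI allI)
    show "axis 0 v \<in> ?S" for v by (rule span_base) blast
    show "axis 1 v \<in> ?S" "axis 3 v \<in> ?S" "axis 9 v \<in> ?S" for v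
      using ax[of 1 0 v] ax[of 3 0 v] ax[of 9 0 v] pl0 by simp_all
    show "axis 12 v \<in> ?S" "axis 8 v \<in> ?S" "axis 2 v \<in> ?S" for v
      using ax[of 0 12 v] ax[of 9 12 v] ax[of 3 12 v] n1 by (simp_all add: mod_13)
    show "axis 10 v \<in> ?S" "axis 11 v \<in> ?S" "axis 6 v \<in> ?S" for v
      using ax[of 0 10 v] ax[of 1 10 v] ax[of 9 10 v] n3 by (simp_all add: mod_13)
    show "axis 4 v \<in> ?S" "axis 7 v \<in> ?S" "axis 5 v \<in> ?S" for v
      using ax[of 0 4 v] ax[of 3 4 v] ax[of 1 4 v] n9 by (simp_all add: mod_13)
  qed
  then have "(\<Sum>t\<in>UNIV. axis t (u $ t)) \<in> ?S" for u :: V78 by (intro span_sum) blast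
  then have "u \<in> ?S" for u by (simp only: axis_sum[symmetric])
  then show ?thesis by blast
qed

section \<open>Type E6\<close>

lemma simple_roots:
  "root_dual (simple_label 1) = (2 * sqrt 3) *\<^sub>R axis 0 (vec3 0 (1 - \<omega>) 0)"
  "root_dual (simple_label 2) = (2 * sqrt 3) *\<^sub>R axis 0 (vec3 (\<omega> - 1) 0 0)"
  "root_dual (simple_label 3) = (2 * sqrt 3) *\<^sub>R axis 0 (vec3 0 (1 + 2 * \<omega>) 0)"
  "root_dual (simple_label 4) = (2 * sqrt 3) *\<^sub>R axis 0 (vec3 1 (- 1 - \<omega>) (- 1 - \<omega>))"
  "root_dual (simple_label 5) = (2 * sqrt 3) *\<^sub>R axis 0 (vec3 0 0 (1 + 2 * \<omega>))"
  "root_dual (simple_label 6) = (2 * sqrt 3) *\<^sub>R axis 0 (vec3 0 0 (1 - \<omega>))"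
  by (simp_all add: simple_label_def coord_vec_def line_vec_def minus_points frame_def mod_13 axis_algebra vec3_algebra)
     (simp_all add: axis_eq_axis vec3_eq_iff scaleR_conv_of_real[where 'a=complex] omega_power omega_simps algebra_simps)

lemma sum_simple_roots:
  "(\<Sum>j\<in>{1..6}. c j *\<^sub>R root_dual (simple_label j)) = (2 * sqrt 3) *\<^sub>R axis 0 (vec3
     (of_real (c 4 - c 2) + of_real (c 2) * \<omega>)
     (of_real (c 1 + c 3 - c 4) + of_real (2 * c 3 - c 1 - c 4) * \<omega>)
     (of_real (c 5 + c 6 - c 4) + of_real (2 * c 5 - c 6 - c 4) * \<omega>))"
proof -
  have s: "(\<Sum>j\<in>{1..6::nat}. f j) = f 1 + f 2 + f 3 + f 4 + f 5 + f 6" for f :: "nat \<Rightarrow> V78"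
    unfolding atLeastAtMost_1_6 by (simp add: add_ac)
  show ?thesis unfolding s simple_roots
    by (simp add: axis_algebra vec3_algebra)
       (simp add: axis_eq_axis vec3_eq_iff scaleR_conv_of_real[where 'a=complex] algebra_simps)
qed

lemma simple_roots_independent:
  assumes "(\<Sum>j\<in>{1..6}. c j *\<^sub>R root_dual (simple_label j)) = 0" "j \<in> {1..6}" shows "c j = 0"
proof -
  have "axis 0 (vec3
     (of_real (c 4 - c 2) + of_real (c 2) * \<omega>)
     (of_real (c 1 + c 3 - c 4) + of_real (2 * c 3 - c 1 - c 4) * \<omega>)
     (of_real (c 5 + c 6 - c 4) + of_real (2 * c 5 - c 6 - c 4) * \<omega>)) = (0 :: V78)"
    using assms(1) unfolding sum_simple_roots by simp
  then have "vec3
     (of_real (c 4 - c 2) + of_real (c 2) * \<omega>)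
     (of_real (c 1 + c 3 - c 4) + of_real (2 * c 3 - c 1 - c 4) * \<omega>)
     (of_real (c 5 + c 6 - c 4) + of_real (2 * c 5 - c 6 - c 4) * \<omega>) = 0"
    by (simp only: axis_eq_0_iff)
  then have "(c 4 - c 2 = 0 \<and> c 2 = 0) \<and> (c 1 + c 3 - c 4 = 0 \<and> 2 * c 3 - c 1 - c 4 = 0) \<and>
    c 5 + c 6 - c 4 = 0 \<and> 2 * c 5 - c 6 - c 4 = 0"
    unfolding vec3_eq_iff vector_3 zero_index omega_basis_zero .
  then have "c 4 - c 2 = 0" "c 2 = 0" "c 1 + c 3 - c 4 = 0" "2 * c 3 - c 1 - c 4 = 0"
    "c 5 + c 6 - c 4 = 0" "2 * c 5 - c 6 - c 4 = 0"
    by blast+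
  then have "c 1 = 0" "c 2 = 0" "c 3 = 0" "c 4 = 0" "c 5 = 0" "c 6 = 0" by linarith+
  then show ?thesis using assms(2) unfolding atLeastAtMost_1_6 by (elim insertE emptyE) simp_all
qed

lemma simple_roots_span: "range (axis 0) \<subseteq> span ((\<lambda>j. root_dual (simple_label j)) ` {1..6})"
proof
  fix u :: V78 assume "u \<in> range (axis 0)"
  then obtain v where u: "u = axis 0 v" by blast
  obtain p1 q1 where 1: "v $ 1 = of_real p1 + of_real q1 * \<omega>" using complex_omega_basis by blast
  obtain p2 q2 where 2: "v $ 2 = of_real p2 + of_real q2 * \<omega>" using complex_omega_basis by blast
  obtain p3 q3 where 3: "v $ 3 = of_real p3 + of_real q3 * \<omega>" using complex_omega_basis by blast
  \<comment> \<open>the solution of the linear system given by \<open>sum_simple_roots\<close>\<close>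
  define c where "c = (\<lambda>j::nat. if j = 1 then (2 * p2 - q2 + (p1 + q1)) / 3 else if j = 2 then q1
    else if j = 3 then (p2 + q2 + 2 * (p1 + q1)) / 3 else if j = 4 then p1 + q1
    else if j = 5 then (p3 + q3 + 2 * (p1 + q1)) / 3 else (2 * p3 - q3 + (p1 + q1)) / 3)"
  have e: "c 4 - c 2 = p1" "c 2 = q1" "c 1 + c 3 - c 4 = p2" "2 * c 3 - c 1 - c 4 = q2" 
    "c 5 + c 6 - c 4 = p3" "2 * c 5 - c 6 - c 4 = q3"
    by (simp_all add: c_def field_simps)
  have "(\<Sum>j\<in>{1..6}. c j *\<^sub>R root_dual (simple_label j)) = (2 * sqrt 3) *\<^sub>R axis 0 v"
    unfolding sum_simple_roots unfolding e(1,3-6) unfolding e(2) 1[symmetric] 2[symmetric] 3[symmetric] vec3_collapse ..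
  then have "u = (1 / (2 * sqrt 3)) *\<^sub>R (\<Sum>j\<in>{1..6}. c j *\<^sub>R root_dual (simple_label j))"
    by (simp add: u)
  also have "\<dots> \<in> span ((\<lambda>j. root_dual (simple_label j)) ` {1..6})"
    by (intro span_scale span_sum span_base) blast
  finally show "u \<in> span ((\<lambda>j. root_dual (simple_label j)) ` {1..6})" .
qed

lemma cartan_integers:
  assumes "i \<in> {1..6}" "j \<in> {1..6}"
  shows "2 * (root_dual (simple_label i) \<bullet> root_dual (simple_label j))
    = of_int (cartan_matrix_E6 i j) * (root_dual (simple_label i) \<bullet> root_dual (simple_label i))"
  using assms unfolding atLeastAtMost_1_6
  by (elim insertE emptyE; hypsubst;
      simp only: simple_roots inner_scaleR_left inner_scaleR_right inner_axis_axis if_True refl vec3_inner;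
      simp add: cartan_matrix_E6_def doubleton_eq_iff omega_eq)

lemma connected_E6:
  assumes "J \<subseteq> {1..6}" "J \<noteq> {}" "J \<noteq> {1..6}"
  shows "\<exists>i\<in>J. \<exists>j\<in>{1..6} - J. cartan_matrix_E6 i j \<noteq> 0"
proof (rule ccontr)
  assume "\<not> ?thesis"
  then have *: "i \<in> J \<Longrightarrow> j \<in> {1..6} \<Longrightarrow> cartan_matrix_E6 i j \<noteq> 0 \<Longrightarrow> j \<in> J" for i j by blast
  have edge: "i \<in> J \<longleftrightarrow> j \<in> J" if "{i, j} \<in> {{1, 3}, {3, 4}, {4, 5}, {5, 6}, {2, 4}}" for i j
  proof -
    have ij: "i \<in> {1..6}" "j \<in> {1..6}" using that by (auto simp: doubleton_eq_iff)
    have "cartan_matrix_E6 i j \<noteq> 0" "cartan_matrix_E6 j i \<noteq> 0"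
      using that by (auto simp: cartan_matrix_E6_def insert_commute)
    then show ?thesis using *[of i j] *[of j i] ij by blast
  qed
  have "1 \<in> J \<longleftrightarrow> 3 \<in> J" "3 \<in> J \<longleftrightarrow> 4 \<in> J" "4 \<in> J \<longleftrightarrow> 5 \<in> J" "5 \<in> J \<longleftrightarrow> 6 \<in> J" "2 \<in> J \<longleftrightarrow> 4 \<in> J"
    by (rule edge, blast)+
  then show False using assms unfolding atLeastAtMost_1_6 by blast
qed

lemma coefficients_inj:
  assumes "r \<in> set root_table" "s \<in> set root_table" "\<And>j. j \<in> {1..6} \<Longrightarrow> simple_coeff r j = simple_coeff s j"
  shows "r = s"
proof -
  let ?f = "\<lambda>(i, m, a, b, cs). cs :: nat list"
  have len: "length (?f x) = 6" if "x \<in> set root_table" for x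
    using bspec[OF root_table_lengths that] by (cases x) simp
  have h: "simple_coeff x j = ?f x ! (j - 1)" for x j by (cases x) simp
  have "?f r = ?f s"
  proof (rule nth_equalityI)
    show "length (?f r) = length (?f s)" using len assms by simp
    fix k assume "k < length (?f r)"
    then have "Suc k \<in> {1..6}" using len[OF assms(1)] by simp
    from assms(3)[OF this] show "?f r ! k = ?f s ! k" unfolding h by simp
  qed
  then show ?thesis using root_table_distinct assms(1,2) unfolding distinct_map inj_on_def by blast
qed

lemma root_dual_in: "root_dual r \<in> range (axis 0)"
proof -
  obtain i m a b cs where r: "r = (i, m, a, b, cs)" by (cases r)
  show ?thesis unfolding r root_dual.simps coord_vec_def line_vec_def by (simp add: axis_algebra)
qed

lemma root_dual_nz: assumes "r \<in> set root_table" shows "root_dual r \<noteq> 0"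
proof
  assume 0: "root_dual r = 0"
  obtain i m a b cs where r: "r = (i, m, a, b, cs)" by (cases r)
  have im: "m \<in> {1, 2, 3}" "a \<in> {0, 1, 2}"
    using bspec[OF root_table_lengths assms] unfolding r by simp_all
  let ?x = "of_real (2 * sqrt 3) * \<omega> ^ a"
  have "?x * cnj ?x = of_real (2 * sqrt 3) * of_real (2 * sqrt 3) * (\<omega> ^ a * \<omega> ^ a * \<omega> ^ a)"
    unfolding complex_cnj_mult omega_power_unit(2)[OF im(2)] by (simp add: mult_ac)
  also have "\<dots> = of_real 12" unfolding omega_power_unit(1)[OF im(2)] by (simp flip: of_real_mult)
  finally have n: "?x * cnj ?x = of_real 12" .
  have "coord_vec i (- i) m ?x \<bullet> coord_vec i (- i) m ?x = 36"
    unfolding coord_vec_inner_self[OF im(1)] n Re_complex_of_real by simp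
  moreover have "coord_vec i (- i) m ?x = 0" using 0 unfolding r root_dual.simps by (simp split: if_splits)
  ultimately show False by simp
qed

lemma plane_1_nz: assumes "r \<in> set root_table" shows "plane_1 r \<noteq> 0"
proof -
  obtain i m a b cs where r: "r = (i, m, a, b, cs)" by (cases r)
  have im: "i \<in> {0, 1, 3, 9}" "m \<in> {1, 2, 3}"
    using bspec[OF root_table_lengths assms] unfolding r by simp_all
  show ?thesis unfolding r plane_1.simps by (rule plane_vec_nz[OF im]) simp
qed

lemma (in G_product) root_datum:
  "compact_root_datum br (range (axis 0)) (set root_table) root_dual plane_1 plane_2
    {1..6} simple_label simple_coeff cartan_matrix_E6"
proof (intro compact_root_datum.intro compact_lie_algebra.intro real_lie_algebra.intro
    compact_lie_algebra_axioms.intro compact_root_datum_axioms.intro)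
  show "bilinear br" by (rule bilinear_br)
  show "br x x = 0" for x
    using br_swap[of x x] by (simp add: eq_neg_iff_add_eq_0 flip: scaleR_2)
  show "br x (br y z) + br y (br z x) + br z (br x y) = 0" for x y z by (rule jacobi)
  show "br x y \<bullet> z = x \<bullet> br y z" for x y z by (rule invariant)
  show "subspace (range (axis 0) :: V78 set)"
    by (rule linear_subspace_image[OF linear_axis[OF linear_id[unfolded id_def]] subspace_UNIV])
  show "br h h' = 0" if "h \<in> range (axis 0)" "h' \<in> range (axis 0)" for h h' using that br_same by auto
  show "finite (set root_table)" by simp
  show "root_dual r \<in> range (axis 0)" for r by (rule root_dual_in)
  show "root_dual r \<noteq> 0" if "r \<in> set root_table" for r by (rule root_dual_nz[OF that])
  show "plane_1 r \<noteq> 0" if "r \<in> set root_table" for r by (rule plane_1_nz[OF that])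
  show "br h (plane_1 r) = (root_dual r \<bullet> h) *\<^sub>R plane_2 r" if "r \<in> set root_table" "h \<in> range (axis 0)" for r h
    using root_plane(1)[OF that(1)] that(2) by blast
  show "br h (plane_2 r) = - (root_dual r \<bullet> h) *\<^sub>R plane_1 r" if "r \<in> set root_table" "h \<in> range (axis 0)" for r h
    using root_plane(2)[OF that(1)] that(2) by blast
  show "span (range (axis 0) \<union> plane_1 ` set root_table \<union> plane_2 ` set root_table) = UNIV"
    by (rule root_planes_span)
  show "finite {1..6::nat}" "{1..6::nat} \<noteq> {}" by simp_all
  show "simple_label i \<in> set root_table" if "i \<in> {1..6}" for i by (rule simple_label_in[OF that])
  show "root_dual r = (\<Sum>i\<in>{1..6}. real (simple_coeff r i) *\<^sub>R root_dual (simple_label i))"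
    if "r \<in> set root_table" for r using root_dual_sum that by blast
  show "r = s" if "r \<in> set root_table" "s \<in> set root_table" "\<And>i. i \<in> {1..6} \<Longrightarrow> simple_coeff r i = simple_coeff s i" for r s
    by (rule coefficients_inj[OF that])
  show "c i = 0" if "(\<Sum>i\<in>{1..6}. c i *\<^sub>R root_dual (simple_label i)) = 0" "i \<in> {1..6}" for c i
    by (rule simple_roots_independent[OF that])
  show "range (axis 0) \<subseteq> span ((\<lambda>i. root_dual (simple_label i)) ` {1..6})" by (rule simple_roots_span)
  show "2 * (root_dual (simple_label i) \<bullet> root_dual (simple_label j)) =
      of_int (cartan_matrix_E6 i j) * (root_dual (simple_label i) \<bullet> root_dual (simple_label i))"
    if "i \<in> {1..6}" "j \<in> {1..6}" for i j by (rule cartan_integers[OF that])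
  show "\<exists>i\<in>J. \<exists>j\<in>{1..6} - J. cartan_matrix_E6 i j \<noteq> 0" if "J \<subseteq> {1..6}" "J \<noteq> {}" "J \<noteq> {1..6}" for J
    by (rule connected_E6[OF that])
qed

theorem mainTheorem3:
  fixes br :: "V78 \<Rightarrow> V78 \<Rightarrow> V78"
  assumes "bilinear br"
    and "G_invariant br"
    and "br (axis 0 (vec3 1 0 0)) (axis 1 (vec3 1 0 0)) =
           axis 3 (vec3 \<omega>' 1 1) - axis 9 (vec3 1 \<omega>' \<omega>')"
  shows "simple_lie_algebra scaleR br \<and>
    complex_simple_lie_algebra_E6 complexified_scale (complexified_bracket br) \<and>
    (\<forall>x. x \<noteq> 0 \<longrightarrow> killing_form br x x < 0)"
proof -
  interpret G_product br by (rule G_product.intro[OF assms])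
  interpret D: compact_root_datum br "range (axis 0)" "set root_table" root_dual plane_1 plane_2
    "{1..6}" simple_label simple_coeff cartan_matrix_E6
    by (rule root_datum)
  have real: "simple_lie_algebra scaleR br"
    by (rule D.simple_real_form[OF D.simple_complexification])
  moreover have "complex_simple_lie_algebra_E6 complexified_scale (complexified_bracket br)"
    by (intro complex_simple_lie_algebra_E6.intro complex_simple_lie_algebra_E6_axioms.intro
        D.simple_complexification D.finite_span D.has_cartan_matrix)
  moreover have "\<forall>x. x \<noteq> 0 \<longrightarrow> killing_form br x x < 0"
    using D.killing_form_negative[OF real] by blast
  ultimately show ?thesis by blast
qed

end
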